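(* Let $c\in\mathbb{R}$, let $z_0=(u_0,\rho_0)\in H^s(\mathbb{R})\times H^{s-1}(\mathbb{R})$ with $s>\frac32$, and let $T$ be the maximal existence time of the solution $z=(u,\rho)$ to the two-component Degasperis-Procesi system $$\begin{cases} u_t+uu_x=P(D)\left(\frac32u^2+\frac c2\rho^2\right),\\ \rho_t+u\rho_x=-2u_x\rho,\\ u(0,x)=u_0(x),\quad \rho(0,x)=\rho_0(x),\end{cases}\qquad x\in\mathbb{R}.$$ Assume that there is $M>0$ such that $\|\rho(t,\cdot)\|_{L^\infty}\leq e^{2Mt}\|\rho_0\|_{H^{s-1}}$ and $\|\rho(t,\cdot)\|_{L^2}\leq e^{2Mt}\|\rho_0\|_{H^{s-1}}$ for all $t\in[0,T)$. Let $\varepsilon>0$ and $$T^\star=\frac{\ln\left(1+\frac2\varepsilon\right)}{\sqrt{|c|+1}\,\left(\|\rho_0\|_{H^{s-1}}+1\right)}>0.$$ If there is a point $x_0\in\mathbb{R}$ such that $$u_0'(x_0)<-(1+\varepsilon)K(T^\star),\qquad K(T^\star)=\left(\frac{3(|c|+1)}{4}\left(e^{2MT^\star}(\|\rho_0\|_{H^{s-1}}+1)\right)^2+\frac32J^2(T^\star)\right)^{1/2}>0,$$ where $$J(t)=\|u_0\|_{L^\infty}+\frac32\,t\,e^{2|c|t}\left(2\|u_0\|_{L^2}^2+|c|\,t(1+8Mt)\left(e^{2Mt}\|\rho_0\|_{H^{s-1}}\right)^4+\frac{|c|}{4}\left(e^{2Mt}\|\rho_0\|_{H^{s-1}}\right)^2\right),$$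 then $T<T^\star$. In other words, the corresponding solution blows up in finite time.
   Context: $P(D)=-\partial_x(1-\partial_x^2)^{-1}$ on $\mathbb{R}$. For $s>\frac32$ and $z_0\in H^s(\mathbb{R})\times H^{s-1}(\mathbb{R})$ the system has a unique maximal solution $z\in C([0,T);H^s\times H^{s-1})\cap C^1([0,T);H^{s-1}\times H^{s-2})$; $T\in(0,\infty]$ is its maximal existence time. "Blows up in finite time" means $T<\infty$. *)

theory Defs
  imports "HOL-Analysis.Analysis" "HOL-Probability.Essential_Supremum"
begin

section \<open>Tempered distributions and Sobolev spaces on the real line\<close>

definition schwartz :: "(real \<Rightarrow> complex) set" where
  "schwartz = {\<phi>.
     (\<forall>j x. ((\<lambda>f x. vector_derivative f (at x)) ^^ j) \<phi> differentiable (at x)) \<and>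
     (\<forall>j k. bounded (range (\<lambda>x. x ^ k *\<^sub>R ((\<lambda>f x. vector_derivative f (at x)) ^^ j) \<phi> x)))}"

text \<open>The Fourier transform is normalised to be unitary, so that the norm of
  \<open>H\<^sup>0\<close> is the norm of \<open>L\<^sup>2\<close>.\<close>

definition fourier :: "(real \<Rightarrow> complex) \<Rightarrow> real \<Rightarrow> complex" where
  "fourier f \<xi> = (LINT x|lborel. cis (- (x * \<xi>)) * f x) / complex_of_real (sqrt (2 * pi))"

definition inv_fourier :: "(real \<Rightarrow> complex) \<Rightarrow> real \<Rightarrow> complex" where
  "inv_fourier f x = (LINT \<xi>|lborel. cis (x * \<xi>) * f \<xi>) / complex_of_real (sqrt (2 * pi))"

text \<open>A distribution is represented by its values on test functions; only the values on
  \<^const>\<open>schwartz\<close> are meaningful, hence \<open>distr_eq\<close> instead of equality.\<close>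

type_synonym distr = "(real \<Rightarrow> complex) \<Rightarrow> complex"

definition distr_eq :: "distr \<Rightarrow> distr \<Rightarrow> bool" where
  "distr_eq \<Lambda> \<Lambda>' \<longleftrightarrow> (\<forall>\<phi>\<in>schwartz. \<Lambda> \<phi> = \<Lambda>' \<phi>)"

definition distr_of :: "(real \<Rightarrow> real) \<Rightarrow> distr" where
  "distr_of f \<phi> = (LINT x|lborel. complex_of_real (f x) * \<phi> x)"

definition distr_deriv :: "distr \<Rightarrow> distr" where
  "distr_deriv \<Lambda> \<phi> = - \<Lambda> (\<lambda>x. vector_derivative \<phi> (at x))"

text \<open>The Fourier transform of the distribution \<open>\<Lambda>\<close>, defined by duality, is the function \<open>g\<close>.\<close>

definition has_fourier :: "distr \<Rightarrow> (real \<Rightarrow> complex) \<Rightarrow> bool" where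
  "has_fourier \<Lambda> g \<longleftrightarrow> g \<in> borel_measurable lborel \<and>
     (\<forall>\<phi>\<in>schwartz. integrable lborel (\<lambda>\<xi>. g \<xi> * \<phi> \<xi>) \<and>
        \<Lambda> (fourier \<phi>) = (LINT \<xi>|lborel. g \<xi> * \<phi> \<xi>))"

text \<open>Linearity and continuity of \<open>\<Lambda>\<close> on the Schwartz space are not listed in the definition of
  \<open>H\<^sup>\<sigma>\<close>: the Fourier transform is an automorphism of that space, and
  \<open>\<phi> \<mapsto> \<integral> g \<phi>\<close> is linear and continuous for \<open>g\<close> in a weighted \<open>L\<^sup>2\<close> space.\<close>

definition sobolev :: "real \<Rightarrow> distr set" where
  "sobolev \<sigma> = {\<Lambda>. \<exists>g. has_fourier \<Lambda> g \<and>
     integrable lborel (\<lambda>\<xi>. (1 + \<xi>\<^sup>2) powr \<sigma> * (cmod (g \<xi>))\<^sup>2)}"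

text \<open>The function \<open>g\<close> in \<^const>\<open>has_fourier\<close> is unique almost everywhere, so the choice below
  does not affect the integrals in which it is used.\<close>

definition distr_fourier :: "distr \<Rightarrow> real \<Rightarrow> complex" where
  "distr_fourier \<Lambda> = (SOME g. has_fourier \<Lambda> g)"

text \<open>Only meaningful on \<open>sobolev \<sigma>\<close> (the integral of a non-integrable function is \<open>0\<close>).\<close>

definition sobolev_norm :: "real \<Rightarrow> distr \<Rightarrow> real" where
  "sobolev_norm \<sigma> \<Lambda> = sqrt (LINT \<xi>|lborel. (1 + \<xi>\<^sup>2) powr \<sigma> * (cmod (distr_fourier \<Lambda> \<xi>))\<^sup>2)"

text \<open>Real-valued elements of \<open>H\<^sup>\<sigma>\<close> for \<open>\<sigma> > 1/2\<close>, each given by its continuous representative.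
  The condition \<open>f \<in> L\<^sup>2\<close> makes sure that \<^term>\<open>distr_of f\<close> is a genuine distribution.\<close>

definition sobolev_fun :: "real \<Rightarrow> (real \<Rightarrow> real) set" where
  "sobolev_fun \<sigma> = {f. continuous_on UNIV f \<and> integrable lborel (\<lambda>x. (f x)\<^sup>2) \<and>
     distr_of f \<in> sobolev \<sigma>}"

definition L2_norm :: "(real \<Rightarrow> real) \<Rightarrow> real" where
  "L2_norm f = sqrt (LINT x|lborel. (f x)\<^sup>2)"

text \<open>Only meaningful for essentially bounded \<open>f\<close>, such as the elements of \<open>H\<^sup>\<sigma>\<close>, \<open>\<sigma> > 1/2\<close>.\<close>

definition Linf_norm :: "(real \<Rightarrow> real) \<Rightarrow> real" where
  "Linf_norm f = real_of_ereal (esssup lborel (\<lambda>x. ereal \<bar>f x\<bar>))"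

definition sobolev_C0 :: "real \<Rightarrow> real set \<Rightarrow> (real \<Rightarrow> distr) \<Rightarrow> bool" where
  "sobolev_C0 \<sigma> I F \<longleftrightarrow> (\<forall>t\<in>I. F t \<in> sobolev \<sigma> \<and>
     ((\<lambda>r. sobolev_norm \<sigma> (\<lambda>\<phi>. F r \<phi> - F t \<phi>)) \<longlongrightarrow> 0) (at t within I))"

text \<open>\<open>F \<in> C\<^sup>1(I; H\<^sup>\<sigma>)\<close> with derivative \<open>F'\<close>; the derivative is one-sided at an endpoint of \<open>I\<close>.\<close>

definition sobolev_C1 :: "real \<Rightarrow> real set \<Rightarrow> (real \<Rightarrow> distr) \<Rightarrow> (real \<Rightarrow> distr) \<Rightarrow> bool" where
  "sobolev_C1 \<sigma> I F F' \<longleftrightarrow> sobolev_C0 \<sigma> I F \<and> sobolev_C0 \<sigma> I F' \<and>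
     (\<forall>t\<in>I. ((\<lambda>r. sobolev_norm \<sigma> (\<lambda>\<phi>. (F r \<phi> - F t \<phi>) / complex_of_real (r - t) - F' t \<phi>))
        \<longlongrightarrow> 0) (at t within I))"

definition fourier_multiplier :: "(real \<Rightarrow> complex) \<Rightarrow> distr \<Rightarrow> distr" where
  "fourier_multiplier m \<Lambda> \<phi> = (LINT \<xi>|lborel. m \<xi> * distr_fourier \<Lambda> \<xi> * inv_fourier \<phi> \<xi>)"

text \<open>\<open>P(D) = - \<partial>\<^sub>x (1 - \<partial>\<^sub>x\<^sup>2)\<^sup>-\<^sup>1\<close>, where \<open>1 - \<partial>\<^sub>x\<^sup>2\<close> has the symbol \<open>1 + \<xi>\<^sup>2\<close>.\<close>

definition P_D :: "distr \<Rightarrow> distr" where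
  "P_D \<Lambda> \<phi> = - distr_deriv (fourier_multiplier (\<lambda>\<xi>. complex_of_real (1 / (1 + \<xi>\<^sup>2))) \<Lambda>) \<phi>"

text \<open>The product \<open>f \<Lambda>\<close> of \<open>f \<in> H\<^sup>s\<close> and \<open>\<Lambda> \<in> H\<^bsup>s-2\<^esup>\<close>, \<open>s > 3/2\<close>: by duality its value on
  \<open>\<phi>\<close> is \<open>\<Lambda> (f \<phi>)\<close>. Here \<open>f \<phi>\<close> need not be a Schwartz function but lies in
  \<open>H\<^sup>s \<subseteq> H\<^bsup>2-s\<^esup>\<close>, to which \<open>\<Lambda>\<close> extends by the pairing below.\<close>

definition distr_mult :: "(real \<Rightarrow> real) \<Rightarrow> distr \<Rightarrow> distr" where
  "distr_mult f \<Lambda> \<phi> =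
     (LINT \<xi>|lborel. distr_fourier \<Lambda> \<xi> * inv_fourier (\<lambda>x. complex_of_real (f x) * \<phi> x) \<xi>)"

section \<open>The two-component Degasperis-Procesi system\<close>

definition time_interval :: "ereal \<Rightarrow> real set" where
  "time_interval T = {t. 0 \<le> t \<and> ereal t < T}"

text \<open>The first equation holds in \<open>H\<^bsup>s-1\<^esup>\<close> and the second one in \<open>H\<^bsup>s-2\<^esup>\<close>, which for
  \<open>s < 2\<close> contains distributions that are not functions. Since \<open>s > 3/2\<close>, the function
  \<open>u t\<close> is continuously differentiable, so \<open>u\<^sub>x\<close> is its classical derivative.\<close>

definition dp2_solution ::
  "real \<Rightarrow> real \<Rightarrow> (real \<Rightarrow> real) \<Rightarrow> (real \<Rightarrow> real) \<Rightarrow> ereal \<Rightarrow>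
     (real \<Rightarrow> real \<Rightarrow> real) \<Rightarrow> (real \<Rightarrow> real \<Rightarrow> real) \<Rightarrow> bool" where
  "dp2_solution c s u0 \<rho>0 T u \<rho> \<longleftrightarrow>
     0 < T \<and>
     (\<forall>t\<in>time_interval T. u t \<in> sobolev_fun s \<and> \<rho> t \<in> sobolev_fun (s - 1)) \<and>
     sobolev_C0 s (time_interval T) (\<lambda>t. distr_of (u t)) \<and>
     sobolev_C0 (s - 1) (time_interval T) (\<lambda>t. distr_of (\<rho> t)) \<and>
     (\<exists>u\<^sub>t \<rho>\<^sub>t.
        sobolev_C1 (s - 1) (time_interval T) (\<lambda>t. distr_of (u t)) u\<^sub>t \<and>
        sobolev_C1 (s - 2) (time_interval T) (\<lambda>t. distr_of (\<rho> t)) \<rho>\<^sub>t \<and>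
        (\<forall>t\<in>time_interval T.
           distr_eq
             (\<lambda>\<phi>. u\<^sub>t t \<phi> + distr_of (\<lambda>x. u t x * deriv (u t) x) \<phi>)
             (P_D (distr_of (\<lambda>x. 3 / 2 * (u t x)\<^sup>2 + c / 2 * (\<rho> t x)\<^sup>2))) \<and>
           distr_eq
             (\<lambda>\<phi>. \<rho>\<^sub>t t \<phi> + distr_mult (u t) (distr_deriv (distr_of (\<rho> t))) \<phi>)
             (distr_of (\<lambda>x. - 2 * deriv (u t) x * \<rho> t x)))) \<and>
     u 0 = u0 \<and> \<rho> 0 = \<rho>0"

text \<open>The solution \<open>(u, \<rho>)\<close> on \<open>[0,T)\<close> cannot be extended to a longer time interval.\<close>

definition dp2_maximal_solution ::
  "real \<Rightarrow> real \<Rightarrow> (real \<Rightarrow> real) \<Rightarrow> (real \<Rightarrow> real) \<Rightarrow> ereal \<Rightarrow>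
     (real \<Rightarrow> real \<Rightarrow> real) \<Rightarrow> (real \<Rightarrow> real \<Rightarrow> real) \<Rightarrow> bool" where
  "dp2_maximal_solution c s u0 \<rho>0 T u \<rho> \<longleftrightarrow>
     dp2_solution c s u0 \<rho>0 T u \<rho> \<and>
     (\<forall>T' u' \<rho>'. dp2_solution c s u0 \<rho>0 T' u' \<rho>' \<and> T \<le> T' \<and>
        (\<forall>t\<in>time_interval T. u' t = u t \<and> \<rho>' t = \<rho> t) \<longrightarrow> T' = T)"

definition T_star :: "real \<Rightarrow> real \<Rightarrow> (real \<Rightarrow> real) \<Rightarrow> real \<Rightarrow> real" where
  "T_star c s \<rho>0 \<epsilon> =
     ln (1 + 2 / \<epsilon>) / (sqrt (\<bar>c\<bar> + 1) * (sobolev_norm (s - 1) (distr_of \<rho>0) + 1))"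

definition J_bound ::
  "real \<Rightarrow> real \<Rightarrow> real \<Rightarrow> (real \<Rightarrow> real) \<Rightarrow> (real \<Rightarrow> real) \<Rightarrow> real \<Rightarrow> real" where
  "J_bound c s M u0 \<rho>0 t =
     Linf_norm u0 + 3 / 2 * t * exp (2 * \<bar>c\<bar> * t) *
       (2 * (L2_norm u0)\<^sup>2
        + \<bar>c\<bar> * t * (1 + 8 * M * t) * (exp (2 * M * t) * sobolev_norm (s - 1) (distr_of \<rho>0)) ^ 4
        + \<bar>c\<bar> / 4 * (exp (2 * M * t) * sobolev_norm (s - 1) (distr_of \<rho>0))\<^sup>2)"

definition K_bound ::
  "real \<Rightarrow> real \<Rightarrow> real \<Rightarrow> (real \<Rightarrow> real) \<Rightarrow> (real \<Rightarrow> real) \<Rightarrow> real \<Rightarrow> real" where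
  "K_bound c s M u0 \<rho>0 t =
     sqrt (3 * (\<bar>c\<bar> + 1) / 4 * (exp (2 * M * t) * (sobolev_norm (s - 1) (distr_of \<rho>0) + 1))\<^sup>2
       + 3 / 2 * (J_bound c s M u0 \<rho>0 t)\<^sup>2)"

end

theory Submission
  imports Defs "HOL-Probability.Probability" "HOL-Real_Asymp.Real_Asymp"
begin

text \<open>The proof is by contradiction: if the solution lived on \<open>[0,T\<^sup>\<star>)\<close>, then two particle trajectories
of the field \<open>u\<close> would collide before time \<open>T\<^sup>\<star>\<close>, which is impossible because \<open>u(t,\<cdot>)\<close> is
Lipschitz, uniformly on compact time intervals.

Write \<open>f = 3/2 u\<^sup>2 + c/2 \<rho>\<^sup>2\<close> and \<open>p = (1 - \<partial>\<^sub>x\<^sup>2)\<^sup>-\<^sup>1 f\<close>. The first equation reads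
\<open>u\<^sub>t + u u\<^sub>x = - p\<^sub>x\<close>, so that a trajectory \<open>q' = u(t,q)\<close> satisfies \<open>q'' = - p\<^sub>x(t,q)\<close>. Let
\<open>D = q\<^sub>2 - q\<^sub>1 > 0\<close> be the distance between the trajectories that start at \<open>x\<^sub>0\<close> and at a point
slightly to its right. Because \<open>p\<^sub>x\<^sub>x = p - f\<close>, the mean value theorem gives \<open>D'' \<le> K\<^sup>2 D\<close> as soon as
\<open>f - p \<le> K\<^sup>2\<close>, while the slope condition says \<open>D'(0) < - (1 + \<epsilon>) K D(0)\<close>. Comparison with the linear
equation \<open>D'' = K\<^sup>2 D\<close> forces \<open>D\<close> to vanish no later than at the time \<open>ln (1 + 2/\<epsilon>) / (2 K)\<close>, which is smaller
than \<open>T\<^sup>\<star>\<close> (\<open>no_steep_slope\<close>). This is the Riccati argument for \<open>u\<^sub>x\<close> along a trajectory, in a form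
that does not differentiate the equation: for \<open>s < 5/2\<close> the function \<open>u\<^sub>x\<close> need not be differentiable.

The bound \<open>f - p \<le> K\<^sup>2\<close> needs \<open>|u| \<le> J(T\<^sup>\<star>)\<close>. Along trajectories \<open>|d/dt u| = |p\<^sub>x| \<le> 1/2 \<integral>|f|\<close>, so it
suffices to control \<open>\<parallel>u\<parallel>\<close> in \<open>L\<^sup>2\<close> (\<open>u_sup_bound\<close>). With \<open>v = (4 - \<partial>\<^sub>x\<^sup>2)\<^sup>-\<^sup>1 u\<close> the energy
\<open>E = \<integral> u (u - 3 v) = \<integral> u (1 - \<partial>\<^sub>x\<^sup>2) v\<close> lies between \<open>\<parallel>u\<parallel>\<^sup>2 / 4\<close> and \<open>\<parallel>u\<parallel>\<^sup>2\<close>; it is conserved by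
the scalar Degasperis-Procesi equation, and here \<open>E' = c \<integral> \<rho>\<^sup>2 v\<^sub>x\<close> (\<open>energy_flux\<close>), which Young's inequality
and the assumed bounds on \<open>\<rho>\<close> turn into \<open>E' \<le> |c| (2 E + R\<^sup>4 / 16)\<close> (\<open>energy_growth\<close>).

What remains is to pass from distributions to functions. Gaussian test functions and the uniqueness
theorem for characteristic functions give uniqueness and inversion of the Fourier transform
(\<open>fourier_inversion\<close>); the Cauchy-Schwarz inequality and a Plancherel inequality then turn convergence in \<open>H\<^sup>\<sigma>\<close>
into uniform and \<open>L\<^sup>2\<close> convergence, with one derivative to spare when \<open>\<sigma> > 3/2\<close>
(\<open>sobolev_representation\<close>, \<open>sobolev_embedding_C1\<close>). Consequently the first equation holds pointwise, and the difference quotients of \<open>u\<close>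
in time converge uniformly and in \<open>L\<^sup>2\<close> (\<open>dp2_solution_time_derivative\<close>). Both inverse operators are
treated as sums of one-sided exponential averages, which solve first-order linear equations.\<close>

section \<open>Integrals over the real line\<close>

lemma integrable_pair_mult:
  fixes a b :: "real \<Rightarrow> 'a::{real_normed_field, banach, second_countable_topology}"
  assumes a: "integrable lborel a" and b: "integrable lborel b"
  shows "integrable (lborel \<Otimes>\<^sub>M lborel) (\<lambda>(x, y). a x * b y)"
proof (rule lborel_pair.Fubini_integrable)
  have [measurable]: "a \<in> borel_measurable lborel" "b \<in> borel_measurable lborel"
    using a b by auto
  show "(\<lambda>(x, y). a x * b y) \<in> borel_measurable (lborel \<Otimes>\<^sub>M lborel)"
    by measurable
  show "integrable lborel (\<lambda>x. LINT y|lborel. norm (case (x, y) of (x, y) \<Rightarrow> a x * b y))"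
    using a by (simp add: norm_mult)
  show "AE x in lborel. integrable lborel (\<lambda>y. case (x, y) of (x, y) \<Rightarrow> a x * b y)"
    using b by simp
qed

lemma integrable_translate:
  fixes f :: "real \<Rightarrow> 'a::{banach, second_countable_topology}"
  assumes "integrable lborel f"
  shows "integrable lborel (\<lambda>x. f (x + t))" "(LINT x|lborel. f (x + t)) = (LINT x|lborel. f x)"
    "integrable lborel (\<lambda>x. f (x - t))" "(LINT x|lborel. f (x - t)) = (LINT x|lborel. f x)"
    "integrable lborel (\<lambda>x. f (t - x))" "(LINT x|lborel. f (t - x)) = (LINT x|lborel. f x)"
    "integrable lborel (\<lambda>x. f (- x))" "(LINT x|lborel. f (- x)) = (LINT x|lborel. f x)"
  using lborel_integrable_real_affine[OF assms, of 1 t] lborel_integral_real_affine[of 1 f t]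
    lborel_integrable_real_affine[OF assms, of 1 "-t"] lborel_integral_real_affine[of 1 f "-t"]
    lborel_integrable_real_affine[OF assms, of "-1" t] lborel_integral_real_affine[of "-1" f t]
    lborel_integrable_real_affine[OF assms, of "-1" 0] lborel_integral_real_affine[of "-1" f 0]
  by (simp_all add: add.commute)

lemma integrable_pair_shift:
  fixes k b :: "real \<Rightarrow> 'a::{real_normed_field, banach, second_countable_topology}"
  assumes k: "integrable lborel k" and b: "integrable lborel b"
  shows "integrable (lborel \<Otimes>\<^sub>M lborel) (\<lambda>(z, x). k z * b (x - \<sigma> * z))"
proof (rule lborel_pair.Fubini_integrable)
  have [measurable]: "k \<in> borel_measurable lborel" "b \<in> borel_measurable lborel"
    using k b by auto
  show "(\<lambda>(z, x). k z * b (x - \<sigma> * z)) \<in> borel_measurable (lborel \<Otimes>\<^sub>M lborel)"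
    by measurable
  have "(LINT x|lborel. norm (b (x - z))) = (LINT x|lborel. norm (b x))" for z
    by (rule integrable_translate) (use b in simp)
  then show "integrable lborel (\<lambda>z. LINT x|lborel. norm (case (z, x) of (z, x) \<Rightarrow> k z * b (x - \<sigma> * z)))"
    using k by (simp add: norm_mult)
  show "AE z in lborel. integrable lborel (\<lambda>x. case (z, x) of (z, x) \<Rightarrow> k z * b (x - \<sigma> * z))"
    using integrable_translate(3)[OF b] by simp
qed

text \<open>Integrate \<open>f(x + 1) - f(x) = \<integral>\<^sub>0\<^sup>1 f'(x + t) dt\<close> over \<open>x\<close>: the left-hand side gives \<open>0\<close> by translation
invariance, the right-hand side \<open>\<integral> f'\<close> by Fubini. This replaces a discussion of the limits of \<open>f\<close> at
infinity and serves as integration by parts throughout.\<close>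

lemma integral_derivative_eq_0:
  fixes f :: "real \<Rightarrow> 'a::{real_normed_field, euclidean_space}"
  assumes d: "\<And>x. (f has_vector_derivative f' x) (at x)"
    and c: "continuous_on UNIV f'"
    and f: "integrable lborel f" and f': "integrable lborel f'"
  shows "(LINT x|lborel. f' x) = 0"
proof -
  let ?i = "\<lambda>t::real. of_real (indicator {0..1} t) :: 'a"
  have i: "integrable lborel ?i"
    by (rule integrable_of_real) simp
  have int: "integrable (lborel \<Otimes>\<^sub>M lborel) (\<lambda>(t, x). ?i t * f' (x + t))"
    using integrable_pair_shift[OF i f', of "-1"] by simp
  have 1: "(LINT t|lborel. ?i t * f' (x + t)) = f (x + 1) - f x" for x
  proof -
    have "(LINT t|lborel. indicator {0..1} t *\<^sub>R f' (x + t)) = f (x + 1) - f (x + 0)"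
    proof (rule integral_FTC_atLeastAtMost)
      show "((\<lambda>t. f (x + t)) has_vector_derivative f' (x + t)) (at t within {0..1})" for t
      proof -
        have "((\<lambda>t. x + t) has_vector_derivative 1) (at t)"
          by (auto intro!: derivative_eq_intros)
        from vector_diff_chain_at[OF this, of f "f' (x + t)"] d[of "x + t"] show ?thesis
          by (auto simp: o_def intro: has_vector_derivative_at_within)
      qed
      show "continuous_on {0..1} (\<lambda>t. f' (x + t))"
        by (intro continuous_on_compose2[OF c] continuous_intros) auto
    qed auto
    moreover have "indicator {0..1} t *\<^sub>R f' (x + t) = ?i t * f' (x + t)" for t
      by (auto simp: indicator_def)
    ultimately show ?thesis by simp
  qed
  have "(LINT x|lborel. LINT t|lborel. ?i t * f' (x + t)) = 0"
    unfolding 1 using integrable_translate(1,2)[OF f, of 1] f by simp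
  moreover have "(LINT x|lborel. LINT t|lborel. ?i t * f' (x + t))
      = (LINT t|lborel. LINT x|lborel. ?i t * f' (x + t))"
    by (rule lborel_pair.Fubini_integral[OF int])
  moreover have "\<dots> = (LINT t|lborel. ?i t * (LINT x|lborel. f' x))"
    using integrable_translate(2)[OF f'] by simp
  moreover have "\<dots> = (LINT x|lborel. f' x)"
    using i by simp
  ultimately show ?thesis by simp
qed

text \<open>The Cauchy-Schwarz inequality, from the nonnegativity of \<open>\<integral> (r a + b)\<^sup>2\<close> as a quadratic polynomial in \<open>r\<close>.\<close>

lemma L2_mult:
  fixes a b :: "real \<Rightarrow> real"
  assumes [measurable]: "a \<in> borel_measurable M" "b \<in> borel_measurable M"
    and a2: "integrable M (\<lambda>x. (a x)\<^sup>2)" and b2: "integrable M (\<lambda>x. (b x)\<^sup>2)"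
  shows "integrable M (\<lambda>x. a x * b x)"
    and "\<bar>LINT x|M. a x * b x\<bar> \<le> sqrt (LINT x|M. (a x)\<^sup>2) * sqrt (LINT x|M. (b x)\<^sup>2)"
proof -
  have bd: "\<bar>y * z\<bar> \<le> y\<^sup>2 + z\<^sup>2" for y z :: real
  proof -
    have "0 \<le> (\<bar>y\<bar> - \<bar>z\<bar>)\<^sup>2" by simp
    then have "2 * \<bar>y * z\<bar> \<le> y\<^sup>2 + z\<^sup>2"
      by (simp add: power2_diff abs_mult)
    then show ?thesis by simp
  qed
  show ab: "integrable M (\<lambda>x. a x * b x)"
    by (rule Bochner_Integration.integrable_bound[of M "\<lambda>x. (a x)\<^sup>2 + (b x)\<^sup>2"])
       (use a2 b2 bd in auto)
  let ?A = "LINT x|M. (a x)\<^sup>2" and ?B = "LINT x|M. (b x)\<^sup>2" and ?C = "LINT x|M. a x * b x"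
  have q: "0 \<le> ?A * r\<^sup>2 + 2 * r * ?C + ?B" for r
  proof -
    have "0 \<le> (LINT x|M. (r * a x + b x)\<^sup>2)"
      by simp
    also have "\<dots> = (LINT x|M. r\<^sup>2 * (a x)\<^sup>2 + (2 * r) * (a x * b x) + (b x)\<^sup>2)"
      by (intro Bochner_Integration.integral_cong) (auto simp: power2_eq_square algebra_simps)
    also have "\<dots> = r\<^sup>2 * ?A + (2 * r) * ?C + ?B"
      using a2 b2 ab by simp
    finally show ?thesis by (simp add: mult.commute)
  qed
  have "?C\<^sup>2 \<le> ?A * ?B"
  proof (cases "?A = 0")
    case True
    have "?C = 0"
    proof (rule ccontr)
      assume "?C \<noteq> 0"
      then show False
        using q[of "- (?B + 1) / (2 * ?C)"] True by (simp add: field_simps)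
    qed
    then show ?thesis by (simp add: True)
  next
    case False
    moreover have "0 \<le> ?A" by simp
    ultimately have "0 < ?A" by linarith
    with q[of "- ?C / ?A"] show ?thesis
      by (simp add: field_simps power2_eq_square)
  qed
  then have "\<bar>?C\<bar> \<le> sqrt (?A * ?B)"
    by (metis real_sqrt_abs real_sqrt_le_mono)
  then show "\<bar>?C\<bar> \<le> sqrt ?A * sqrt ?B"
    by (simp add: real_sqrt_mult)
qed

section \<open>One-sided exponential averages\<close>

text \<open>This is \<open>\<integral> exp (- \<kappa> (x - y)) f y dy\<close> over \<open>y \<le> x\<close>, after the substitution \<open>y = x - z\<close>; in this form the kernel
does not depend on \<open>x\<close>. The bounded solution of \<open>\<kappa>\<^sup>2 w - w'' = f\<close> is \<open>(lexp \<kappa> f + rexp \<kappa> f) / (2 \<kappa>)\<close>, with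
\<open>rexp\<close> the mirror image.\<close>

definition lexp :: "real \<Rightarrow> (real \<Rightarrow> real) \<Rightarrow> real \<Rightarrow> real" where
  "lexp \<kappa> f x = (LINT z|lborel. (indicator {0..} z * exp (- (\<kappa> * z))) * f (x - z))"

definition rexp :: "real \<Rightarrow> (real \<Rightarrow> real) \<Rightarrow> real \<Rightarrow> real" where
  "rexp \<kappa> f x = lexp \<kappa> (\<lambda>y. f (- y)) (- x)"

lemma rexp_eq:
  "rexp \<kappa> f x = (LINT z|lborel. (indicator {0..} z * exp (- (\<kappa> * z))) * f (x + z))"
  by (simp add: rexp_def lexp_def add.commute)

lemma exp_kernel:
  assumes "\<kappa> > (0::real)"
  shows "integrable lborel (\<lambda>z. indicator {0..} z * exp (- (\<kappa> * z)) :: real)"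
    and "(LINT z|lborel. indicator {0..} z * exp (- (\<kappa> * z)) :: real) = 1 / \<kappa>"
proof -
  have "((\<lambda>z. exp (- \<kappa> * z)) has_integral exp (- \<kappa> * 0) / \<kappa>) {0..}"
    using assms by (intro has_integral_exp_minus_to_infinity)
  then have h: "((\<lambda>z. exp (- \<kappa> * z)) has_integral 1 / \<kappa>) {0..}"
    by simp
  then have "(\<lambda>z. exp (- \<kappa> * z)) absolutely_integrable_on {0..}"
    by (intro nonnegative_absolutely_integrable_1) (auto simp: integrable_on_def)
  then have s: "set_integrable lborel {0..} (\<lambda>z. exp (- \<kappa> * z))"
    unfolding set_integrable_def by (subst (asm) integrable_completion) (auto)
  then show "integrable lborel (\<lambda>z. indicator {0..} z * exp (- (\<kappa> * z)) :: real)"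
    by (simp add: set_integrable_def)
  have "(LINT z:{0..}|lborel. exp (- \<kappa> * z)) = integral {0..} (\<lambda>z. exp (- \<kappa> * z))"
    by (rule set_borel_integral_eq_integral(2)[OF s])
  with h show "(LINT z|lborel. indicator {0..} z * exp (- (\<kappa> * z)) :: real) = 1 / \<kappa>"
    by (simp add: set_lebesgue_integral_def integral_unique)
qed

lemma lexp_integrable:
  fixes f :: "real \<Rightarrow> real" and \<kappa> :: real
  assumes "\<kappa> > 0" and [measurable]: "f \<in> borel_measurable borel" and "\<And>x. \<bar>f x\<bar> \<le> B"
  shows "integrable lborel (\<lambda>z. (indicator {0..} z * exp (- (\<kappa> * z))) * f (x - z))"
proof (rule Bochner_Integration.integrable_bound)
  show "integrable lborel (\<lambda>z. (indicator {0..} z * exp (- (\<kappa> * z))) * B)"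
    using exp_kernel(1)[OF assms(1)] by simp
  show "AE z in lborel. norm (indicator {0..} z * exp (- (\<kappa> * z)) * f (x - z))
      \<le> norm (indicator {0..} z * exp (- (\<kappa> * z)) * B)"
    using assms(3) by (intro AE_I2) (auto simp: abs_mult intro!: mult_left_mono order.trans[OF assms(3)])
qed measurable

lemma lexp_bound:
  assumes "\<kappa> > 0" "f \<in> borel_measurable borel" "\<And>x. \<bar>f x\<bar> \<le> B"
  shows "\<bar>lexp \<kappa> f x\<bar> \<le> B / \<kappa>"
proof -
  have "\<bar>lexp \<kappa> f x\<bar> \<le> (LINT z|lborel. (indicator {0..} z * exp (- (\<kappa> * z))) * B)"
    unfolding lexp_def real_norm_def[symmetric]
    by (rule Bochner_Integration.integral_norm_bound_integral[OF lexp_integrable[OF assms]])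
       (use exp_kernel(1)[OF assms(1)] assms(3) in \<open>auto simp: abs_mult intro!: mult_left_mono\<close>)
  also have "\<dots> = B / \<kappa>"
    using exp_kernel[OF assms(1)] by simp
  finally show ?thesis .
qed

lemma lexp_L1:
  assumes l: "\<kappa> > 0" and f: "integrable lborel f"
  shows "integrable lborel (lexp \<kappa> f)" "(LINT x|lborel. lexp \<kappa> f x) = (LINT x|lborel. f x) / \<kappa>"
proof -
  note int = integrable_pair_shift[OF exp_kernel(1)[OF l] f, of 1, simplified]
  show "integrable lborel (lexp \<kappa> f)"
    unfolding lexp_def[abs_def] using lborel_pair.integrable_snd[OF int] .
  have "(LINT x|lborel. lexp \<kappa> f x)
      = (LINT z|lborel. LINT x|lborel. (indicator {0..} z * exp (- (\<kappa> * z))) * f (x - z))"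
    unfolding lexp_def by (rule lborel_pair.Fubini_integral[OF int])
  also have "\<dots> = (LINT x|lborel. f x) / \<kappa>"
    using exp_kernel[OF l] integrable_translate(4)[OF f] by simp
  finally show "(LINT x|lborel. lexp \<kappa> f x) = (LINT x|lborel. f x) / \<kappa>" .
qed

text \<open>Up to the factor \<open>exp (- \<kappa> x)\<close> the average is an indefinite integral of the continuous function
\<open>exp (\<kappa> y) f y\<close>, so the fundamental theorem of calculus applies.\<close>

lemma lexp_deriv:
  assumes l: "\<kappa> > 0" and c: "continuous_on UNIV f" and b: "\<And>x. \<bar>f x\<bar> \<le> B"
  shows "(lexp \<kappa> f has_real_derivative f x - \<kappa> * lexp \<kappa> f x) (at x)"
proof -
  define a where "a = x - 1"
  have m[measurable]: "f \<in> borel_measurable borel"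
    using c by (rule borel_measurable_continuous_onI)
  define g where "g y = exp (\<kappa> * y) * f y" for y
  have cg: "continuous_on A g" for A
    unfolding g_def using c by (intro continuous_intros) (auto intro: continuous_on_subset)
  have E: "lexp \<kappa> f y = exp (- (\<kappa> * y)) * (LINT w|lborel. indicator {..y} w * g w)" for y
  proof -
    have "(LINT w|lborel. indicator {..y} w * g w) = (LINT z|lborel. indicator {..y} (y - z) * g (y - z))"
      using lborel_integral_real_affine[of "-1" "\<lambda>w. indicator {..y} w * g w" y] by simp
    also have "\<dots> = (LINT z|lborel. exp (\<kappa> * y) * (indicator {0..} z * exp (- (\<kappa> * z)) * f (y - z)))"
      by (intro Bochner_Integration.integral_cong)
         (auto simp: g_def indicator_def right_diff_distrib exp_diff exp_minus field_simps)
    also have "\<dots> = exp (\<kappa> * y) * lexp \<kappa> f y"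
      by (simp add: lexp_def)
    finally show ?thesis by (simp add: exp_minus)
  qed
  have int: "integrable lborel (\<lambda>w. indicator {..y} w * g w)" for y
  proof -
    have "integrable lborel (\<lambda>z. exp (\<kappa> * y) * (indicator {0..} z * exp (- (\<kappa> * z)) * f (y - z)))"
      using lexp_integrable[OF l m b] by simp
    moreover have "exp (\<kappa> * y) * (indicator {0..} z * exp (- (\<kappa> * z)) * f (y - z))
        = indicator {..y} (y - z) * g (y - z)" for z
       by (auto simp: g_def indicator_def right_diff_distrib exp_diff exp_minus field_simps)
    ultimately have "integrable lborel (\<lambda>z. indicator {..y} (y - z) * g (y - z))"
      by simp
    then show ?thesis
      using lborel_integrable_real_affine_iff[of "-1" "\<lambda>w. indicator {..y} w * g w" y] by simp
  qed
  have S: "(LINT w|lborel. indicator {..y} w * g w)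
      = (LINT w|lborel. indicator {..a} w * g w) + integral {a..y} g" if "a \<le> y" for y
  proof -
    have si: "set_integrable lborel {a..y} g"
      by (rule borel_integrable_atLeastAtMost') (rule cg)
    have "(LINT w|lborel. indicator {..y} w * g w)
        = (LINT w|lborel. indicator {..a} w * g w + indicator {a..y} w *\<^sub>R g w)"
      by (rule integral_cong_AE)
         (use that AE_lborel_singleton[of a] in \<open>auto simp: indicator_def g_def elim!: eventually_mono\<close>)
    also have "\<dots> = (LINT w|lborel. indicator {..a} w * g w) + (LINT w:{a..y}|lborel. g w)"
      using int si unfolding set_lebesgue_integral_def set_integrable_def by simp
    finally show ?thesis
      using set_borel_integral_eq_integral(2)[OF si] by simp
  qed
  let ?C = "LINT w|lborel. indicator {..a} w * g w"
  have "((\<lambda>y. integral {a..y} g) has_real_derivative g x) (at x within {a..x+1})"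
    by (rule integral_has_real_derivative[OF cg]) (auto simp: a_def)
  then have D: "((\<lambda>y. integral {a..y} g) has_real_derivative g x) (at x)"
    by (subst (asm) at_within_interior) (auto simp: a_def)
  have "((\<lambda>y. exp (- (\<kappa> * y)) * (?C + integral {a..y} g)) has_real_derivative
      exp (- (\<kappa> * x)) * g x + (- \<kappa> * exp (- (\<kappa> * x))) * (?C + integral {a..x} g)) (at x)"
    by (auto intro!: derivative_eq_intros D)
  moreover have "exp (- (\<kappa> * x)) * g x + (- \<kappa> * exp (- (\<kappa> * x))) * (?C + integral {a..x} g)
      = f x - \<kappa> * lexp \<kappa> f x"
    using S[of x] E[of x] by (simp add: a_def g_def exp_minus)
  ultimately have A: "((\<lambda>y. exp (- (\<kappa> * y)) * (?C + integral {a..y} g)) has_real_derivative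
      f x - \<kappa> * lexp \<kappa> f x) (at x)" by simp
  have "exp (- (\<kappa> * y)) * (?C + integral {a..y} g) = lexp \<kappa> f y" if "y \<in> {a<..}" for y
    unfolding E[of y] using S[of y] that by simp
  then show ?thesis
    by (intro has_field_derivative_transform_within_open[OF A, of "{a<..}"]) (auto simp: a_def)
qed

lemma rexp_deriv:
  assumes k: "\<kappa> > 0" and c: "continuous_on UNIV f" and b: "\<And>x. \<bar>f x\<bar> \<le> B"
  shows "(rexp \<kappa> f has_real_derivative \<kappa> * rexp \<kappa> f x - f x) (at x)"
proof -
  have "continuous_on UNIV (\<lambda>y. f (- y))"
    by (intro continuous_on_compose2[OF c] continuous_intros) auto
  note d = lexp_deriv[OF k this, of B]
  have "((\<lambda>x. - x) has_real_derivative -1) (at x)"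
    by (auto intro!: derivative_eq_intros)
  from DERIV_chain2[OF d this] b show ?thesis
    unfolding rexp_def[abs_def] by simp
qed

lemma lexp_rexp_continuous:
  assumes "\<kappa> > 0" "continuous_on UNIV f" "\<And>x. \<bar>f x\<bar> \<le> B"
  shows "continuous_on UNIV (lexp \<kappa> f)" "continuous_on UNIV (rexp \<kappa> f)"
  using DERIV_continuous_on[OF DERIV_subset[OF lexp_deriv[OF assms]]]
    DERIV_continuous_on[OF DERIV_subset[OF rexp_deriv[OF assms]]] by auto

lemma rexp_bound:
  assumes "\<kappa> > 0" and [measurable]: "f \<in> borel_measurable borel" and "\<And>x. \<bar>f x\<bar> \<le> B"
  shows "\<bar>rexp \<kappa> f x\<bar> \<le> B / \<kappa>"
  unfolding rexp_def by (rule lexp_bound) (use assms in auto)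

lemma rexp_L1:
  assumes k: "\<kappa> > 0" and f: "integrable lborel f"
  shows "integrable lborel (rexp \<kappa> f)" "(LINT x|lborel. rexp \<kappa> f x) = (LINT x|lborel. f x) / \<kappa>"
  using integrable_translate(7,8)[OF lexp_L1(1)[OF k integrable_translate(7)[OF f]]]
    lexp_L1(2)[OF k integrable_translate(7)[OF f]] integrable_translate(8)[OF f]
  unfolding rexp_def[abs_def] by auto

lemma lexp_ge:
  assumes k: "\<kappa> > 0" and f: "f \<in> borel_measurable borel" "\<And>x. \<bar>f x\<bar> \<le> B" and m: "\<And>x. m \<le> f x"
  shows "m / \<kappa> \<le> lexp \<kappa> f x"
proof -
  have "m / \<kappa> = (LINT z|lborel. (indicator {0..} z * exp (- (\<kappa> * z))) * m)"
    using exp_kernel[OF k] by simp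
  also have "\<dots> \<le> lexp \<kappa> f x"
    unfolding lexp_def
    by (intro integral_mono lexp_integrable[OF k f])
       (use exp_kernel(1)[OF k] m in \<open>auto intro!: mult_left_mono\<close>)
  finally show ?thesis .
qed

lemma rexp_ge:
  assumes "\<kappa> > 0" and [measurable]: "f \<in> borel_measurable borel" and "\<And>x. \<bar>f x\<bar> \<le> B" "\<And>x. m \<le> f x"
  shows "m / \<kappa> \<le> rexp \<kappa> f x"
  unfolding rexp_def by (rule lexp_ge) (use assms in auto)

text \<open>Transposing the kernel reverses its direction: the translation \<open>x \<mapsto> x + z\<close> in the inner integral
moves the shift from \<open>f\<close> to \<open>n\<close>.\<close>

lemma lexp_adjoint:
  assumes k: "\<kappa> > 0" and f: "integrable lborel f"
    and [measurable]: "n \<in> borel_measurable borel" and b: "\<And>x. \<bar>n x\<bar> \<le> B"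
  shows "integrable lborel (\<lambda>x. lexp \<kappa> f x * n x)" "integrable lborel (\<lambda>x. f x * rexp \<kappa> n x)"
    "(LINT x|lborel. lexp \<kappa> f x * n x) = (LINT x|lborel. f x * rexp \<kappa> n x)"
proof -
  let ?k = "\<lambda>z. indicator {0..} z * exp (- (\<kappa> * z)) :: real"
  have [measurable]: "f \<in> borel_measurable borel"
    using f by auto
  have int1: "integrable (lborel \<Otimes>\<^sub>M lborel) (\<lambda>(z, x). ?k z * f (x - z) * n x)"
  proof (rule Bochner_Integration.integrable_bound)
    show "integrable (lborel \<Otimes>\<^sub>M lborel) (\<lambda>p. (case p of (z, x) \<Rightarrow> ?k z * f (x - z)) * B)"
      using integrable_pair_shift[OF exp_kernel(1)[OF k] f, of 1] by simp
    show "AE p in lborel \<Otimes>\<^sub>M lborel. norm (case p of (z, x) \<Rightarrow> ?k z * f (x - z) * n x)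
        \<le> norm ((case p of (z, x) \<Rightarrow> ?k z * f (x - z)) * B)"
      by (intro AE_I2) (auto simp: abs_mult intro!: mult_left_mono order.trans[OF b])
  qed measurable
  have int2: "integrable (lborel \<Otimes>\<^sub>M lborel) (\<lambda>(z, x). ?k z * f x * n (x + z))"
  proof (rule Bochner_Integration.integrable_bound)
    show "integrable (lborel \<Otimes>\<^sub>M lborel) (\<lambda>p. (case p of (z, x) \<Rightarrow> ?k z * f x) * B)"
      using integrable_pair_mult[OF exp_kernel(1)[OF k] f] by simp
    show "AE p in lborel \<Otimes>\<^sub>M lborel. norm (case p of (z, x) \<Rightarrow> ?k z * f x * n (x + z))
        \<le> norm ((case p of (z, x) \<Rightarrow> ?k z * f x) * B)"
      by (intro AE_I2) (auto simp: abs_mult intro!: mult_left_mono order.trans[OF b])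
  qed measurable
  have l: "lexp \<kappa> f x * n x = (LINT z|lborel. ?k z * f (x - z) * n x)" for x
    by (simp add: lexp_def)
  have r: "f x * rexp \<kappa> n x = (LINT z|lborel. ?k z * f x * n (x + z))" for x
  proof -
    have "f x * rexp \<kappa> n x = (LINT z|lborel. f x * (?k z * n (x + z)))"
      by (simp add: rexp_eq)
    then show ?thesis by (simp add: ac_simps)
  qed
  have s: "(LINT x|lborel. ?k z * f (x - z) * n x) = (LINT x|lborel. ?k z * f x * n (x + z))" for z
    using lborel_integral_real_affine[of 1 "\<lambda>x. ?k z * f (x - z) * n x" z] by (simp add: add.commute)
  show "integrable lborel (\<lambda>x. lexp \<kappa> f x * n x)"
    unfolding l by (rule lborel_pair.integrable_snd[OF int1])
  show "integrable lborel (\<lambda>x. f x * rexp \<kappa> n x)"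
    unfolding r by (rule lborel_pair.integrable_snd[OF int2])
  show "(LINT x|lborel. lexp \<kappa> f x * n x) = (LINT x|lborel. f x * rexp \<kappa> n x)"
    unfolding l r
    by (simp only: lborel_pair.Fubini_integral[OF int1] lborel_pair.Fubini_integral[OF int2] s)
qed

text \<open>Jensen's inequality for the probability density \<open>\<kappa> exp (- \<kappa> z)\<close>: expand the nonnegative average of
\<open>(\<kappa> lexp \<kappa> f x - f (x - z))\<^sup>2\<close>.\<close>

lemma lexp_square_le:
  assumes k: "\<kappa> > 0" and [measurable]: "f \<in> borel_measurable borel" and b: "\<And>x. \<bar>f x\<bar> \<le> B"
  shows "(lexp \<kappa> f x)\<^sup>2 \<le> lexp \<kappa> (\<lambda>y. (f y)\<^sup>2) x / \<kappa>"
proof -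
  let ?k = "\<lambda>z. indicator {0..} z * exp (- (\<kappa> * z)) :: real"
  let ?L = "lexp \<kappa> f x"
  have b2: "\<bar>(f y)\<^sup>2\<bar> \<le> B\<^sup>2" for y
    using power_mono[OF b[of y], of 2] by simp
  note i1 = lexp_integrable[OF k assms(2) b, of x]
  have i2: "integrable lborel (\<lambda>z. ?k z * (f (x - z))\<^sup>2)"
    by (rule lexp_integrable[OF k _ b2]) measurable
  have "0 \<le> (LINT z|lborel. ?k z * (\<kappa> * ?L - f (x - z))\<^sup>2)"
    by (intro Bochner_Integration.integral_nonneg) auto
  also have "\<dots> = (LINT z|lborel. (\<kappa> * ?L)\<^sup>2 * ?k z - (2 * \<kappa> * ?L) * (?k z * f (x - z)) + ?k z * (f (x - z))\<^sup>2)"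
    by (intro Bochner_Integration.integral_cong) (auto simp: power2_eq_square algebra_simps)
  also have "\<dots> = (\<kappa> * ?L)\<^sup>2 * (1 / \<kappa>) - (2 * \<kappa> * ?L) * ?L + lexp \<kappa> (\<lambda>y. (f y)\<^sup>2) x"
    using i1 i2 exp_kernel[OF k] unfolding lexp_def by simp
  also have "\<dots> = lexp \<kappa> (\<lambda>y. (f y)\<^sup>2) x - \<kappa> * ?L\<^sup>2"
    using k by (simp add: field_simps power2_eq_square)
  finally show ?thesis
    using k by (simp add: field_simps)
qed

lemma lexp_L2:
  assumes k: "\<kappa> > 0" and c: "continuous_on UNIV f" and b: "\<And>x. \<bar>f x\<bar> \<le> B"
    and f2: "integrable lborel (\<lambda>x. (f x)\<^sup>2)"
  shows "integrable lborel (\<lambda>x. (lexp \<kappa> f x)\<^sup>2)"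
    "(LINT x|lborel. (lexp \<kappa> f x)\<^sup>2) \<le> (LINT x|lborel. (f x)\<^sup>2) / \<kappa>\<^sup>2"
proof -
  have m[measurable]: "f \<in> borel_measurable borel" "lexp \<kappa> f \<in> borel_measurable borel"
    using c lexp_rexp_continuous(1)[OF k c b] by (auto intro: borel_measurable_continuous_onI)
  note le = lexp_square_le[OF k m(1) b]
  have i: "integrable lborel (\<lambda>x. lexp \<kappa> (\<lambda>y. (f y)\<^sup>2) x / \<kappa>)"
    using lexp_L1(1)[OF k f2] by simp
  show *: "integrable lborel (\<lambda>x. (lexp \<kappa> f x)\<^sup>2)"
    by (rule Bochner_Integration.integrable_bound[OF i])
       (use k le in \<open>auto intro!: always_eventually order.trans[OF le] divide_right_mono\<close>)
  have "(LINT x|lborel. (lexp \<kappa> f x)\<^sup>2) \<le> (LINT x|lborel. lexp \<kappa> (\<lambda>y. (f y)\<^sup>2) x / \<kappa>)"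
    by (rule integral_mono[OF * i le])
  also have "\<dots> = (LINT x|lborel. (f x)\<^sup>2) / \<kappa>\<^sup>2"
    using lexp_L1(2)[OF k f2] by (simp add: power2_eq_square)
  finally show "(LINT x|lborel. (lexp \<kappa> f x)\<^sup>2) \<le> (LINT x|lborel. (f x)\<^sup>2) / \<kappa>\<^sup>2" .
qed

lemma rexp_L2:
  assumes k: "\<kappa> > 0" and c: "continuous_on UNIV f" and b: "\<And>x. \<bar>f x\<bar> \<le> B"
    and f2: "integrable lborel (\<lambda>x. (f x)\<^sup>2)"
  shows "integrable lborel (\<lambda>x. (rexp \<kappa> f x)\<^sup>2)"
    "(LINT x|lborel. (rexp \<kappa> f x)\<^sup>2) \<le> (LINT x|lborel. (f x)\<^sup>2) / \<kappa>\<^sup>2"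
proof -
  have c': "continuous_on UNIV (\<lambda>y. f (- y))"
    by (intro continuous_on_compose2[OF c] continuous_intros) auto
  note L = lexp_L2[OF k c' b integrable_translate(7)[OF f2]]
  show "integrable lborel (\<lambda>x. (rexp \<kappa> f x)\<^sup>2)"
    unfolding rexp_def by (rule integrable_translate(7)[OF L(1)])
  show "(LINT x|lborel. (rexp \<kappa> f x)\<^sup>2) \<le> (LINT x|lborel. (f x)\<^sup>2) / \<kappa>\<^sup>2"
    unfolding rexp_def integrable_translate(8)[OF L(1)]
    using L(2) integrable_translate(8)[OF f2] by simp
qed

lemma half_line_integrals:
  assumes g: "integrable lborel (g :: real \<Rightarrow> real)"
  shows "integrable lborel (\<lambda>z. indicator {0..} z * g (x - z))"
    "integrable lborel (\<lambda>z. indicator {0..} z * g (x + z))"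
    "(LINT z|lborel. indicator {0..} z * g (x - z)) + (LINT z|lborel. indicator {0..} z * g (x + z))
      = (LINT y|lborel. g y)"
proof -
  have i: "integrable lborel (\<lambda>z. indicator A z * h z :: real)" if "A \<in> sets borel" "integrable lborel h"
    for A and h :: "real \<Rightarrow> real"
    using integrable_mult_indicator[of A lborel h] that by simp
  have g1: "integrable lborel (\<lambda>z. g (x - z))" "integrable lborel (\<lambda>z. g (x + z))"
    using integrable_translate(1,5)[OF g, of x] by (auto simp: add.commute)
  show 1: "integrable lborel (\<lambda>z. indicator {0..} z * g (x - z))"
    "integrable lborel (\<lambda>z. indicator {0..} z * g (x + z))"
    using g1 by (auto intro!: i)
  have "(LINT z|lborel. indicator {0..} z * g (x + z)) = (LINT z|lborel. indicator {..0} z * g (x - z))"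
    using lborel_integral_real_affine[of "-1" "\<lambda>z. indicator {0..} z * g (x + z)" 0]
    by (auto simp: indicator_def intro!: Bochner_Integration.integral_cong)
  then have "(LINT z|lborel. indicator {0..} z * g (x - z)) + (LINT z|lborel. indicator {0..} z * g (x + z))
      = (LINT z|lborel. indicator {0..} z * g (x - z) + indicator {..0} z * g (x - z))"
    using 1 g1 by (subst Bochner_Integration.integral_add) (auto intro!: i)
  also have "\<dots> = (LINT z|lborel. g (x - z))"
    by (rule integral_cong_AE)
       (use g1 AE_lborel_singleton[of 0] in \<open>auto simp: indicator_def elim!: eventually_mono\<close>)
  also have "\<dots> = (LINT y|lborel. g y)"
    by (rule integrable_translate(6)[OF g])
  finally show "(LINT z|lborel. indicator {0..} z * g (x - z)) + (LINT z|lborel. indicator {0..} z * g (x + z))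
      = (LINT y|lborel. g y)" .
qed

text \<open>The two averages look at the disjoint half-lines on either side of \<open>x\<close>, and the kernel is at most \<open>1\<close>;
hence the constant is \<open>1\<close> and not \<open>2\<close>.\<close>

lemma rexp_lexp_diff_le_L1:
  assumes k: "\<kappa> > 0" and f: "integrable lborel f"
  shows "\<bar>rexp \<kappa> f x - lexp \<kappa> f x\<bar> \<le> (LINT y|lborel. \<bar>f y\<bar>)"
proof -
  note h = half_line_integrals[OF integrable_abs[OF f], of x]
  have e: "indicator {0..} z * exp (- (\<kappa> * z)) \<le> (indicator {0..} z :: real)" for z :: real
    using k by (auto simp: indicator_def)
  have "\<bar>lexp \<kappa> f x\<bar> \<le> (LINT z|lborel. indicator {0..} z * \<bar>f (x - z)\<bar>)"
    unfolding lexp_def real_norm_def[symmetric]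
    by (rule order.trans[OF integral_norm_bound Bochner_Integration.integral_mono'])
       (use h e in \<open>auto simp: abs_mult intro!: mult_right_mono\<close>)
  moreover have "\<bar>rexp \<kappa> f x\<bar> \<le> (LINT z|lborel. indicator {0..} z * \<bar>f (x + z)\<bar>)"
    unfolding rexp_eq real_norm_def[symmetric]
    by (rule order.trans[OF integral_norm_bound Bochner_Integration.integral_mono'])
       (use h e in \<open>auto simp: abs_mult intro!: mult_right_mono\<close>)
  ultimately show ?thesis
    using h(3) by linarith
qed

text \<open>Young's inequality is applied under the integral, \<open>r e |y| \<le> y\<^sup>2 + r\<^sup>2 e\<^sup>2 / 4\<close> with \<open>e = exp (- 2 z)\<close>; then
\<open>\<integral> e\<^sup>2 dz = 1/4\<close> on each half-line. For \<open>r = R\<^sup>2\<close> this estimates the source term of the energy.\<close>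

lemma rexp_lexp_diff_le_L2:
  assumes [measurable]: "f \<in> borel_measurable borel" and f2: "integrable lborel (\<lambda>y. (f y)\<^sup>2)" and r: "0 \<le> r"
  shows "r * \<bar>rexp 2 f x - lexp 2 f x\<bar> / 2 \<le> (LINT y|lborel. (f y)\<^sup>2) / 2 + r\<^sup>2 / 16"
proof -
  let ?i = "indicator {0..} :: real \<Rightarrow> real"
  note h = half_line_integrals[OF f2, of x]
  note e4 = exp_kernel[of 4, simplified]
  have young: "r * (e * \<bar>y\<bar>) \<le> y\<^sup>2 + r\<^sup>2 * e\<^sup>2 / 4" for e y :: real
  proof -
    have "0 \<le> (\<bar>y\<bar> - r * e / 2)\<^sup>2" by simp
    then show ?thesis by (simp add: power2_diff power_mult_distrib power_divide field_simps)
  qed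
  have kern: "r * \<bar>LINT z|lborel. ?i z * exp (- (2 * z)) * g z\<bar>
      \<le> (LINT z|lborel. ?i z * (g z)\<^sup>2) + r\<^sup>2 / 16"
    if [measurable]: "g \<in> borel_measurable borel" and g: "integrable lborel (\<lambda>z. ?i z * (g z)\<^sup>2)" for g
  proof -
    have "r * \<bar>LINT z|lborel. ?i z * exp (- (2 * z)) * g z\<bar>
        \<le> r * (LINT z|lborel. norm (?i z * exp (- (2 * z)) * g z))"
      using r integral_norm_bound[of lborel "\<lambda>z. ?i z * exp (- (2 * z)) * g z"]
      by (intro mult_left_mono) auto
    also have "\<dots> = (LINT z|lborel. r * norm (?i z * exp (- (2 * z)) * g z))"
      by simp
    also have "\<dots> = (LINT z|lborel. ?i z * (r * (exp (- (2 * z)) * \<bar>g z\<bar>)))"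
      by (intro Bochner_Integration.integral_cong) (auto simp: abs_mult)
    also have "\<dots> \<le> (LINT z|lborel. ?i z * (g z)\<^sup>2 + r\<^sup>2 / 4 * (?i z * exp (- (4 * z))))"
    proof (rule Bochner_Integration.integral_mono')
      show "integrable lborel (\<lambda>z. ?i z * (g z)\<^sup>2 + r\<^sup>2 / 4 * (?i z * exp (- (4 * z))))"
        using g e4 by auto
      show "?i z * (r * (exp (- (2 * z)) * \<bar>g z\<bar>)) \<le> ?i z * (g z)\<^sup>2 + r\<^sup>2 / 4 * (?i z * exp (- (4 * z)))" for z
      proof -
        have "(exp (- (2 * z)))\<^sup>2 = exp (- (4 * z))"
          by (simp add: power2_eq_square flip: exp_add)
        with young[of "exp (- (2 * z))" "g z"] show ?thesis
          by (auto simp: indicator_def)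
      qed
    qed (use r in auto)
    also have "\<dots> = (LINT z|lborel. ?i z * (g z)\<^sup>2) + r\<^sup>2 / 16"
      using g e4 by simp
    finally show ?thesis .
  qed
  have "r * \<bar>lexp 2 f x\<bar> \<le> (LINT z|lborel. ?i z * (f (x - z))\<^sup>2) + r\<^sup>2 / 16"
    unfolding lexp_def by (rule kern) (use h in auto)
  moreover have "r * \<bar>rexp 2 f x\<bar> \<le> (LINT z|lborel. ?i z * (f (x + z))\<^sup>2) + r\<^sup>2 / 16"
    unfolding rexp_eq by (rule kern) (use h in auto)
  moreover have "r * \<bar>rexp 2 f x - lexp 2 f x\<bar> \<le> r * \<bar>rexp 2 f x\<bar> + r * \<bar>lexp 2 f x\<bar>"
    using r mult_left_mono[OF abs_triangle_ineq4[of "rexp 2 f x" "lexp 2 f x"], of r]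
    by (simp add: distrib_left)
  ultimately show ?thesis
    using h(3) by linarith
qed

text \<open>The difference of two solutions is a multiple of \<open>exp (- \<kappa> x)\<close>, and \<open>0\<close> is the only bounded one.\<close>

lemma lexp_unique:
  assumes k: "\<kappa> > 0" and c: "continuous_on UNIV n" and b: "\<And>x. \<bar>n x\<bar> \<le> B"
    and d: "\<And>x. (y has_real_derivative n x - \<kappa> * y x) (at x)" and yb: "\<And>x. \<bar>y x\<bar> \<le> C"
  shows "lexp \<kappa> n x = y x"
proof -
  let ?e = "\<lambda>x. exp (\<kappa> * x) * (y x - lexp \<kappa> n x)"
  have "(?e has_real_derivative 0) (at x)" for x
    by (auto intro!: derivative_eq_intros d lexp_deriv[OF k c b] simp: algebra_simps)
  then have K: "?e x = ?e 0" for x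
    by (intro DERIV_isconst_all) auto
  define K where "K = ?e 0"
  note K = K[folded K_def]
  have "n \<in> borel_measurable borel"
    using c by (rule borel_measurable_continuous_onI)
  note lb = lexp_bound[OF k this b]
  have "\<bar>K\<bar> \<le> exp (\<kappa> * x) * (C + B / \<kappa>)" for x
  proof -
    have "\<bar>K\<bar> = exp (\<kappa> * x) * \<bar>y x - lexp \<kappa> n x\<bar>"
      unfolding K[of x, symmetric] abs_mult by simp
    also have "\<dots> \<le> exp (\<kappa> * x) * (C + B / \<kappa>)"
      using yb[of x] lb[of x] by (intro mult_left_mono) auto
    finally show ?thesis .
  qed
  moreover have "((\<lambda>x. exp (\<kappa> * x) * (C + B / \<kappa>)) \<longlongrightarrow> 0) at_bot"
  proof -
    have "((\<lambda>x. exp (\<kappa> * x)) \<longlongrightarrow> 0) at_bot"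
      using k by real_asymp
    then show ?thesis
      by (rule tendsto_mult_left_zero)
  qed
  ultimately have "\<bar>K\<bar> \<le> 0"
    by (intro tendsto_lowerbound[of _ 0 at_bot]) (auto intro: always_eventually)
  with K[of x] show ?thesis by auto
qed

lemma rexp_unique:
  assumes k: "\<kappa> > 0" and c: "continuous_on UNIV n" and b: "\<And>x. \<bar>n x\<bar> \<le> B"
    and d: "\<And>x. (y has_real_derivative \<kappa> * y x - n x) (at x)" and yb: "\<And>x. \<bar>y x\<bar> \<le> C"
  shows "rexp \<kappa> n x = y x"
proof -
  have "lexp \<kappa> (\<lambda>x. n (- x)) (- x) = y (- (- x))"
  proof (rule lexp_unique[OF k _ b, where y = "\<lambda>x. y (- x)"])
    show "continuous_on UNIV (\<lambda>x. n (- x))"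
      by (intro continuous_on_compose2[OF c] continuous_intros) auto
    show "((\<lambda>x. y (- x)) has_real_derivative n (- x) - \<kappa> * y (- x)) (at x)" for x
    proof -
      have "((\<lambda>x. - x) has_real_derivative -1) (at x)"
        by (auto intro!: derivative_eq_intros)
      from DERIV_chain2[OF d this] show ?thesis by simp
    qed
  qed (use yb in auto)
  then show ?thesis by (simp add: rexp_def)
qed

section \<open>Trajectories of a Lipschitz field\<close>

text \<open>Picard iteration on the bounded continuous functions. The unknown is \<open>exp (- 2 L t) q t\<close>: with this weight
the integral operator contracts by \<open>1/2\<close> on the whole interval at once. Time is clamped to \<open>[0, \<tau>]\<close> because
the function space consists of functions on the whole line.\<close>

lemma ode_exists:
  fixes b :: "real \<Rightarrow> real \<Rightarrow> real" and \<tau> L x :: real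
  assumes \<tau>: "0 \<le> \<tau>"
    and cont: "\<And>y. continuous_on {0..\<tau>} (\<lambda>t. b t y)"
    and L: "0 < L" "\<And>t y z. t \<in> {0..\<tau>} \<Longrightarrow> \<bar>b t y - b t z\<bar> \<le> L * \<bar>y - z\<bar>"
  shows "\<exists>q. q 0 = x \<and> (\<forall>t\<in>{0..\<tau>}. (q has_real_derivative b t (q t)) (at t within {0..\<tau>}))"
proof -
  have cb: "continuous_on {0..\<tau>} (\<lambda>t. b t (y t))" if y: "continuous_on {0..\<tau>} y" for y
    unfolding continuous_on_sequentially o_def
  proof (intro allI ballI impI)
    fix r t assume r0: "t \<in> {0..\<tau>}" and r1: "(\<forall>n. r n \<in> {0..\<tau>}) \<and> r \<longlonglongrightarrow> t"
    then have r: "\<forall>n. r n \<in> {0..\<tau>}" "t \<in> {0..\<tau>}" and rt: "r \<longlonglongrightarrow> t" by auto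
    have 1: "(\<lambda>n. b (r n) (y t)) \<longlonglongrightarrow> b t (y t)"
      using cont[of "y t"] r rt unfolding continuous_on_sequentially by (auto simp: o_def)
    have yr: "(\<lambda>n. y (r n)) \<longlonglongrightarrow> y t"
      using y r rt unfolding continuous_on_sequentially by (auto simp: o_def)
    have "(\<lambda>n. L * \<bar>y (r n) - y t\<bar>) \<longlonglongrightarrow> L * \<bar>y t - y t\<bar>"
      by (intro tendsto_intros yr)
    then have 0: "(\<lambda>n. L * \<bar>y (r n) - y t\<bar>) \<longlonglongrightarrow> 0"
      by simp
    have "(\<lambda>n. b (r n) (y (r n)) - b (r n) (y t)) \<longlonglongrightarrow> 0"
    proof (rule Lim_null_comparison[OF _ 0], rule always_eventually, rule allI)
      show "norm (b (r n) (y (r n)) - b (r n) (y t)) \<le> L * \<bar>y (r n) - y t\<bar>" for n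
        unfolding real_norm_def by (rule L(2)) (use r in blast)
    qed
    from tendsto_add[OF this 1] show "(\<lambda>n. b (r n) (y (r n))) \<longlonglongrightarrow> b t (y t)"
      by simp
  qed
  define cl where "cl t = max 0 (min \<tau> t)" for t
  have cl: "cl t \<in> {0..\<tau>}" "cl t = t \<longleftrightarrow> t \<in> {0..\<tau>}" for t
    using \<tau> by (auto simp: cl_def)
  have ccl: "continuous_on UNIV cl"
    unfolding cl_def[abs_def] by (intro continuous_intros)
  define w where "w y t = exp (2 * L * t) * apply_bcontfun y t" for y :: "real \<Rightarrow>\<^sub>C real" and t
  have cw: "continuous_on A (w y)" for A y
    unfolding w_def[abs_def] by (intro continuous_intros) auto
  define G where "G y t = exp (- (2 * L * cl t)) * (x + integral {0..cl t} (\<lambda>r. b r (w y r)))" for y t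
  have cG: "G y \<in> bcontfun" for y
  proof -
    have "continuous_on {0..\<tau>} (\<lambda>t. integral {0..t} (\<lambda>r. b r (w y r)))"
      by (intro indefinite_integral_continuous_1 integrable_continuous_real cb cw)
    then have 1: "continuous_on {0..\<tau>} (\<lambda>t. exp (- (2 * L * t)) * (x + integral {0..t} (\<lambda>r. b r (w y r))))"
      by (intro continuous_intros)
    have "continuous_on UNIV (G y)"
      unfolding G_def[abs_def] using cl by (intro continuous_on_compose2[OF 1 ccl]) auto
    moreover have "bounded (range (G y))"
    proof (rule bounded_subset)
      show "bounded ((\<lambda>t. exp (- (2 * L * t)) * (x + integral {0..t} (\<lambda>r. b r (w y r)))) ` {0..\<tau>})"
        by (intro compact_imp_bounded compact_continuous_image 1) auto
    qed (use cl in \<open>auto simp: G_def\<close>)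
    ultimately show ?thesis by (simp add: bcontfun_def)
  qed
  define P where "P y = Bcontfun (G y)" for y
  have P: "apply_bcontfun (P y) = G y" for y
    unfolding P_def by (rule Bcontfun_inverse[OF cG])
  have "\<exists>!y\<in>UNIV. P y = y"
  proof (rule Banach_fix[where c = "1/2"])
    show "dist (P y) (P z) \<le> 1 / 2 * dist y z" for y z
    proof (rule dist_bound)
      fix t
      define s where "s = cl t"
      have s: "s \<in> {0..\<tau>}" unfolding s_def by (rule cl(1))
      have iy: "(\<lambda>r. b r (w y r)) integrable_on {0..s}" for y
      proof (rule integrable_continuous_real, rule continuous_on_subset[OF cb[OF cw[of _ y]]])
        show "{0..s} \<subseteq> {0..\<tau>}" using s by auto
      qed
      have e: "((\<lambda>r. L * (exp (2 * L * r) * dist y z)) has_integral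
          exp (2 * L * s) / 2 * dist y z - exp (2 * L * 0) / 2 * dist y z) {0..s}"
        by (rule fundamental_theorem_of_calculus)
           (use s L in \<open>auto intro!: derivative_eq_intros simp flip: has_real_derivative_iff_has_vector_derivative\<close>)
      have "norm (integral {0..s} (\<lambda>r. b r (w y r) - b r (w z r)))
          \<le> integral {0..s} (\<lambda>r. L * (exp (2 * L * r) * dist y z))"
      proof (rule integral_norm_bound_integral)
        show "(\<lambda>r. b r (w y r) - b r (w z r)) integrable_on {0..s}"
          using iy by (rule integrable_diff) (rule iy)
        show "(\<lambda>r. L * (exp (2 * L * r) * dist y z)) integrable_on {0..s}"
          using e by blast
        fix r assume "r \<in> {0..s}"
        then have "norm (b r (w y r) - b r (w z r)) \<le> L * \<bar>w y r - w z r\<bar>"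
          using L(2) s by auto
        also have "\<bar>w y r - w z r\<bar> = exp (2 * L * r) * dist (y r) (z r)"
          by (simp add: w_def dist_real_def abs_mult flip: right_diff_distrib)
        also have "\<dots> \<le> exp (2 * L * r) * dist y z"
          by (intro mult_left_mono dist_bounded) auto
        finally show "norm (b r (w y r) - b r (w z r)) \<le> L * (exp (2 * L * r) * dist y z)"
          using L(1) by simp
      qed
      also have "\<dots> \<le> exp (2 * L * s) / 2 * dist y z"
        unfolding integral_unique[OF e] by simp
      finally have I: "\<bar>integral {0..s} (\<lambda>r. b r (w y r)) - integral {0..s} (\<lambda>r. b r (w z r))\<bar>
          \<le> exp (2 * L * s) / 2 * dist y z"
        unfolding integral_diff[OF iy iy] real_norm_def .
      have "dist (P y t) (P z t) = exp (- (2 * L * s)) *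
          \<bar>integral {0..s} (\<lambda>r. b r (w y r)) - integral {0..s} (\<lambda>r. b r (w z r))\<bar>"
        unfolding P G_def s_def[symmetric] by (simp add: dist_real_def abs_mult flip: right_diff_distrib)
      also have "\<dots> \<le> exp (- (2 * L * s)) * (exp (2 * L * s) / 2 * dist y z)"
        by (intro mult_left_mono I) auto
      also have "\<dots> = 1 / 2 * dist y z"
        by (simp add: exp_minus)
      finally show "dist (P y t) (P z t) \<le> 1 / 2 * dist y z" .
    qed
  qed (auto simp: complete_UNIV)
  then obtain y where y: "P y = y" by auto
  have q: "w y t = x + integral {0..t} (\<lambda>r. b r (w y r))" if t: "t \<in> {0..\<tau>}" for t
  proof -
    have "y t = G y t" using P[of y] y by simp
    then show ?thesis using cl(2)[of t] t by (simp add: w_def G_def exp_minus)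
  qed
  have "(w y has_real_derivative b t (w y t)) (at t within {0..\<tau>})" if t: "t \<in> {0..\<tau>}" for t
  proof -
    have "((\<lambda>t. x + integral {0..t} (\<lambda>r. b r (w y r))) has_real_derivative 0 + b t (w y t)) (at t within {0..\<tau>})"
      by (intro DERIV_add DERIV_const integral_has_real_derivative cb cw t)
    then show ?thesis
      using has_field_derivative_transform_within[of _ "0 + b t (w y t)" t "{0..\<tau>}" 1 "w y"] q t by auto
  qed
  moreover have "w y 0 = x" using q[of 0] \<tau> by simp
  ultimately show ?thesis by blast
qed

text \<open>A trajectory with prescribed end point: reverse time.\<close>

lemma ode_exists_through:
  fixes b :: "real \<Rightarrow> real \<Rightarrow> real" and \<tau> L x :: real
  assumes \<tau>: "0 \<le> \<tau>"
    and cont: "\<And>y. continuous_on {0..\<tau>} (\<lambda>t. b t y)"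
    and L: "0 < L" "\<And>t y z. t \<in> {0..\<tau>} \<Longrightarrow> \<bar>b t y - b t z\<bar> \<le> L * \<bar>y - z\<bar>"
  shows "\<exists>q. q \<tau> = x \<and> (\<forall>t\<in>{0..\<tau>}. (q has_real_derivative b t (q t)) (at t within {0..\<tau>}))"
proof -
  have "\<exists>q. q 0 = x \<and> (\<forall>t\<in>{0..\<tau>}. (q has_real_derivative - b (\<tau> - t) (q t)) (at t within {0..\<tau>}))"
  proof (rule ode_exists[OF \<tau> _ L(1)])
    show "continuous_on {0..\<tau>} (\<lambda>t. - b (\<tau> - t) y)" for y
      by (intro continuous_intros continuous_on_compose2[OF cont]) auto
    show "\<bar>- b (\<tau> - t) y - - b (\<tau> - t) z\<bar> \<le> L * \<bar>y - z\<bar>" if "t \<in> {0..\<tau>}" for t y z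
      using L(2)[of "\<tau> - t" z y] that by (simp add: abs_minus_commute)
  qed
  then obtain q where q: "q 0 = x"
    "\<And>t. t \<in> {0..\<tau>} \<Longrightarrow> (q has_real_derivative - b (\<tau> - t) (q t)) (at t within {0..\<tau>})" by blast
  have "((\<lambda>t. q (\<tau> - t)) has_real_derivative b t (q (\<tau> - t))) (at t within {0..\<tau>})" if t: "t \<in> {0..\<tau>}" for t
  proof -
    have im: "(\<lambda>t. \<tau> - t) ` {0..\<tau>} = {0..\<tau>}"
      by (auto intro!: image_eqI[of _ _ "\<tau> - _"])
    have "((q \<circ> (\<lambda>t. \<tau> - t)) has_real_derivative - b (\<tau> - (\<tau> - t)) (q (\<tau> - t)) * (- 1)) (at t within {0..\<tau>})"
      by (rule DERIV_image_chain) (use t q(2)[of "\<tau> - t"] in \<open>auto simp: im intro!: derivative_eq_intros\<close>)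
    then show ?thesis by (simp add: o_def)
  qed
  then show ?thesis using q(1) by (intro exI[of _ "\<lambda>t. q (\<tau> - t)"]) auto
qed

text \<open>The quantity \<open>(q - p)\<^sup>2 exp (2 L t)\<close> is nondecreasing, so the distance never vanishes, and by continuity
the order of the two trajectories is preserved.\<close>

lemma trajectories_do_not_meet:
  fixes b :: "real \<Rightarrow> real \<Rightarrow> real" and \<tau> L :: real
  assumes L: "\<And>t y z. t \<in> {0..\<tau>} \<Longrightarrow> \<bar>b t y - b t z\<bar> \<le> L * \<bar>y - z\<bar>"
    and p: "\<And>t. t \<in> {0..\<tau>} \<Longrightarrow> (p has_real_derivative b t (p t)) (at t within {0..\<tau>})"
    and q: "\<And>t. t \<in> {0..\<tau>} \<Longrightarrow> (q has_real_derivative b t (q t)) (at t within {0..\<tau>})"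
    and 0: "p 0 < q 0" and t: "t \<in> {0..\<tau>}"
  shows "p t < q t"
proof -
  have cpq: "continuous_on {0..\<tau>} p" "continuous_on {0..\<tau>} q"
    by (rule DERIV_continuous_on[OF p], assumption) (rule DERIV_continuous_on[OF q])
  have ne: "p r \<noteq> q r" if r: "r \<in> {0..\<tau>}" for r
  proof -
    define E where "E s = (q s - p s)\<^sup>2 * exp (2 * L * s)" for s
    have "E 0 \<le> E r"
    proof (cases "r = 0")
      case False
      then have r0: "0 < r" using r by auto
      show ?thesis
      proof (rule DERIV_nonneg_imp_increasing_open[where f = E])
        show "0 \<le> r" using r0 by simp
      next
        show "continuous_on {0..r} E"
          unfolding E_def[abs_def] using r
          by (intro continuous_intros continuous_on_subset[OF cpq(1)] continuous_on_subset[OF cpq(2)]) auto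
      next
        fix s assume s: "0 < s" "s < r"
        then have at: "at s within {0..\<tau>} = at s"
          using r by (intro at_within_interior) auto
        have s': "s \<in> {0..\<tau>}" using s r by auto
        let ?d = "b s (q s) - b s (p s)"
        have "(E has_real_derivative 2 * ((q s - p s) * ?d + L * (q s - p s)\<^sup>2) * exp (2 * L * s)) (at s)"
        proof -
          have d: "(q has_real_derivative b s (q s)) (at s)" "(p has_real_derivative b s (p s)) (at s)"
            using p[OF s'] q[OF s'] unfolding at by blast+
          have "((\<lambda>s. exp (2 * L * s)) has_real_derivative exp (2 * L * s) * (2 * L)) (at s)"
            by (auto intro!: derivative_eq_intros)
          from DERIV_mult[OF DERIV_power[OF DERIV_diff[OF d], of 2] this] show ?thesis
            unfolding E_def[abs_def] by (rule DERIV_cong) (simp add: algebra_simps power2_eq_square)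
        qed
        moreover have "0 \<le> 2 * ((q s - p s) * ?d + L * (q s - p s)\<^sup>2) * exp (2 * L * s)"
        proof -
          have "\<bar>(q s - p s) * ?d\<bar> \<le> \<bar>q s - p s\<bar> * (L * \<bar>q s - p s\<bar>)"
            unfolding abs_mult by (intro mult_left_mono L s') auto
          moreover have "\<bar>q s - p s\<bar> * (L * \<bar>q s - p s\<bar>) = L * (q s - p s)\<^sup>2"
            by (simp add: power2_eq_square mult.left_commute)
          ultimately have "0 \<le> (q s - p s) * ?d + L * (q s - p s)\<^sup>2"
            by linarith
          then show ?thesis by (intro mult_nonneg_nonneg) auto
        qed
        ultimately show "\<exists>y. (E has_real_derivative y) (at s) \<and> y \<ge> 0" by blast
      qed
    qed simp
    moreover have "0 < E 0" using 0 by (simp add: E_def)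
    ultimately show ?thesis by (auto simp: E_def)
  qed
  show ?thesis
  proof (rule ccontr)
    assume "\<not> p t < q t"
    then have "\<exists>r\<ge>0. r \<le> t \<and> q r - p r = 0"
      using t 0 by (intro IVT2' continuous_intros continuous_on_subset[OF cpq(1)] continuous_on_subset[OF cpq(2)]) auto
    then show False using ne t by force
  qed
qed

section \<open>Gaussian test functions\<close>

lemma borel_measurable_cis [measurable (raw)]:
  "f \<in> borel_measurable M \<Longrightarrow> (\<lambda>x. cis (f x)) \<in> borel_measurable M"
  using borel_measurable_continuous_on[of cis f M] by (simp add: continuous_on_cis continuous_on_id)

text \<open>Polynomials times Gaussians, with complex exponents: a class that contains the modulated and the
shifted Gaussians and is closed under differentiation, whence both lie in \<^const>\<open>schwartz\<close>.\<close>

definition poly_gauss :: "complex poly \<Rightarrow> complex \<Rightarrow> complex \<Rightarrow> real \<Rightarrow> complex" where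
  "poly_gauss P \<beta> \<kappa> x = poly P (of_real x) * exp (\<kappa> + \<beta> * of_real x - (of_real x)\<^sup>2 / 2)"

lemma poly_gauss_deriv:
  "(poly_gauss P \<beta> \<kappa> has_vector_derivative poly_gauss (pderiv P + [:\<beta>, -1:] * P) \<beta> \<kappa> x) (at x)"
proof -
  have "((\<lambda>z. poly P z * exp (\<kappa> + \<beta> * z - z\<^sup>2 / 2)) has_field_derivative
      poly (pderiv P + [:\<beta>, -1:] * P) z * exp (\<kappa> + \<beta> * z - z\<^sup>2 / 2)) (at z)" for z :: complex
    by (auto intro!: derivative_eq_intros simp: algebra_simps)
  from has_vector_derivative_real_field[OF this] show ?thesis
    unfolding poly_gauss_def[abs_def] by simp
qed

text \<open>A polynomial is at most a multiple of \<open>exp |x|\<close>, and the Gaussian absorbs any exponential after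
completing the square.\<close>

lemma poly_gauss_bounded: "\<exists>C. \<forall>x. cmod (poly_gauss P \<beta> \<kappa> x) \<le> C"
proof -
  define A where "A = (\<Sum>i\<le>degree P. cmod (coeff P i) * fact i)"
  have A: "cmod (poly P (of_real x)) \<le> A * exp \<bar>x\<bar>" for x :: real
  proof -
    have "cmod (poly P (of_real x)) \<le> (\<Sum>i\<le>degree P. cmod (coeff P i) * \<bar>x\<bar> ^ i)"
      unfolding poly_altdef by (rule order.trans[OF norm_sum]) (simp add: norm_mult norm_power)
    also have "\<dots> \<le> (\<Sum>i\<le>degree P. cmod (coeff P i) * (fact i * exp \<bar>x\<bar>))"
    proof (intro sum_mono mult_left_mono)
      fix i
      have "\<bar>x\<bar> ^ i / fact i \<le> exp \<bar>x\<bar>"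
        using sum_le_suminf[OF summable_exp_generic[of "\<bar>x\<bar>"], of "{i}"]
        by (simp add: exp_def divide_inverse mult.commute)
      then show "\<bar>x\<bar> ^ i \<le> fact i * exp \<bar>x\<bar>"
        by (simp add: field_simps)
    qed simp
    also have "\<dots> = A * exp \<bar>x\<bar>"
      by (simp add: A_def sum_distrib_right mult.assoc)
    finally show ?thesis .
  qed
  have A0: "0 \<le> A" unfolding A_def by (intro sum_nonneg) auto
  have "cmod (poly_gauss P \<beta> \<kappa> x) \<le> A * exp (Re \<kappa> + (\<bar>Re \<beta>\<bar> + 1)\<^sup>2 / 2)" for x
  proof -
    have "0 \<le> (\<bar>x\<bar> - (\<bar>Re \<beta>\<bar> + 1))\<^sup>2" by simp
    then have "\<bar>x\<bar> + \<bar>Re \<beta>\<bar> * \<bar>x\<bar> - (x\<^sup>2 / 2) \<le> (\<bar>Re \<beta>\<bar> + 1)\<^sup>2 / 2"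
      by (simp add: power2_eq_square algebra_simps)
    moreover have "Re \<beta> * x \<le> \<bar>Re \<beta>\<bar> * \<bar>x\<bar>"
      by (metis abs_ge_self abs_mult)
    ultimately have e: "\<bar>x\<bar> + (Re \<kappa> + Re \<beta> * x - (x\<^sup>2 / 2)) \<le> Re \<kappa> + (\<bar>Re \<beta>\<bar> + 1)\<^sup>2 / 2"
      by linarith
    have "cmod (poly_gauss P \<beta> \<kappa> x) = cmod (poly P (of_real x)) * exp (Re \<kappa> + Re \<beta> * x - (x\<^sup>2 / 2))"
      by (simp add: poly_gauss_def norm_mult norm_exp_eq_Re flip: of_real_power)
    also have "\<dots> \<le> A * exp \<bar>x\<bar> * exp (Re \<kappa> + Re \<beta> * x - (x\<^sup>2 / 2))"
      by (intro mult_right_mono A) auto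
    also have "\<dots> \<le> A * exp (Re \<kappa> + (\<bar>Re \<beta>\<bar> + 1)\<^sup>2 / 2)"
      unfolding mult.assoc exp_add[symmetric] using e A0 by (intro mult_left_mono) auto
    finally show ?thesis .
  qed
  then show ?thesis by blast
qed

lemma poly_gauss_schwartz: "poly_gauss P \<beta> \<kappa> \<in> schwartz"
proof -
  let ?D = "\<lambda>f x. vector_derivative f (at x) :: complex"
  define Q where "Q = (\<lambda>P. pderiv P + [:\<beta>, -1:] * P)"
  have D: "?D (poly_gauss P \<beta> \<kappa>) = poly_gauss (Q P) \<beta> \<kappa>" for P
    unfolding Q_def by (intro ext vector_derivative_at poly_gauss_deriv)
  have it: "(?D ^^ j) (poly_gauss P \<beta> \<kappa>) = poly_gauss ((Q ^^ j) P) \<beta> \<kappa>" for j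
    by (induction j) (simp_all add: D)
  have diff: "poly_gauss P \<beta> \<kappa> differentiable (at x)" for P x
    using poly_gauss_deriv[of P \<beta> \<kappa> x] by (auto simp: has_vector_derivative_def differentiable_def)
  have "bounded (range (\<lambda>x. x ^ k *\<^sub>R poly_gauss P \<beta> \<kappa> x))" for k P
  proof -
    have "x ^ k *\<^sub>R poly_gauss P \<beta> \<kappa> x = poly_gauss (monom 1 k * P) \<beta> \<kappa> x" for x
      by (simp add: poly_gauss_def poly_monom scaleR_conv_of_real mult.assoc)
    with poly_gauss_bounded[of "monom 1 k * P" \<beta> \<kappa>] show ?thesis
      by (auto simp: bounded_iff)
  qed
  with diff show ?thesis
    unfolding schwartz_def by (simp add: it)
qed

definition mod_gauss :: "real \<Rightarrow> real \<Rightarrow> complex" where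
  "mod_gauss b x = cis (b * x) * of_real (exp (- (x\<^sup>2 / 2)))"

definition shifted_gauss :: "real \<Rightarrow> real \<Rightarrow> complex" where
  "shifted_gauss b x = of_real (exp (- ((x - b)\<^sup>2 / 2)))"

lemma mod_gauss_schwartz: "mod_gauss b \<in> schwartz"
proof -
  have "mod_gauss b = poly_gauss 1 (\<i> * of_real b) 0"
    by (rule ext) (simp add: mod_gauss_def poly_gauss_def cis_conv_exp exp_of_real[symmetric] mult.assoc
        flip: exp_add)
  then show ?thesis using poly_gauss_schwartz by simp
qed

lemma shifted_gauss_schwartz: "shifted_gauss b \<in> schwartz"
proof -
  have "shifted_gauss b = poly_gauss 1 (of_real b) (of_real (- b\<^sup>2 / 2))"
    by (rule ext) (simp add: shifted_gauss_def poly_gauss_def exp_of_real[symmetric] power2_eq_square algebra_simps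
      diff_divide_distrib add_divide_distrib)
  then show ?thesis using poly_gauss_schwartz by simp
qed

lemma schwartz_deriv:
  assumes "\<phi> \<in> schwartz"
  shows "(\<lambda>x. vector_derivative \<phi> (at x)) \<in> schwartz"
proof -
  let ?D = "\<lambda>f x. vector_derivative f (at x) :: complex"
  have e: "(?D ^^ j) (?D \<phi>) = (?D ^^ Suc j) \<phi>" for j
    by (simp only: funpow_Suc_right o_apply)
  have "(?D ^^ Suc j) \<phi> differentiable (at x)"
    "bounded (range (\<lambda>x. x ^ k *\<^sub>R (?D ^^ Suc j) \<phi> x))" for j k x
    using assms unfolding schwartz_def by blast+
  then show ?thesis
    unfolding schwartz_def mem_Collect_eq e by blast
qed

lemma schwartz_has_deriv:
  assumes "\<phi> \<in> schwartz"
  shows "(\<phi> has_vector_derivative vector_derivative \<phi> (at x)) (at x)"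
proof -
  have "((\<lambda>f x. vector_derivative f (at x)) ^^ 0) \<phi> differentiable (at x)"
    using assms unfolding schwartz_def by blast
  then show ?thesis by (simp add: vector_derivative_works)
qed

lemma schwartz_continuous: "\<phi> \<in> schwartz \<Longrightarrow> continuous_on UNIV \<phi>"
  using schwartz_has_deriv by (meson continuous_at_imp_continuous_on has_vector_derivative_continuous)

lemma schwartz_bounded: "\<phi> \<in> schwartz \<Longrightarrow> bounded (range \<phi>)"
proof -
  assume "\<phi> \<in> schwartz"
  then have "bounded (range (\<lambda>x. x ^ 0 *\<^sub>R ((\<lambda>f x. vector_derivative f (at x)) ^^ 0) \<phi> x))"
    unfolding schwartz_def by blast
  then show ?thesis by simp
qed

lemma integrable_inverse_1_plus: "integrable lborel (\<lambda>x::real. inverse (1 + x\<^sup>2))"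
  using integrable_inverse_1_plus_square by (simp add: set_integrable_def)

lemma schwartz_integrable:
  assumes \<phi>: "\<phi> \<in> schwartz"
  shows "integrable lborel \<phi>"
proof -
  have m: "\<phi> \<in> borel_measurable lborel"
    using schwartz_continuous[OF \<phi>] borel_measurable_continuous_onI by simp
  have "\<forall>k. bounded (range (\<lambda>x. x ^ k *\<^sub>R \<phi> x))"
    using \<phi> unfolding schwartz_def by (auto dest!: spec[of "\<lambda>j. \<forall>k. _ j k" 0])
  then have "bounded (range (\<lambda>x. x ^ 0 *\<^sub>R \<phi> x))" "bounded (range (\<lambda>x. x ^ 2 *\<^sub>R \<phi> x))"
    by blast+
  then obtain C0 C2 where C: "\<And>x. cmod (\<phi> x) \<le> C0" "\<And>x. cmod (x\<^sup>2 *\<^sub>R \<phi> x) \<le> C2"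
    unfolding bounded_iff by auto
  show ?thesis
  proof (rule Bochner_Integration.integrable_bound[OF _ m])
    show "integrable lborel (\<lambda>x::real. (C0 + C2) * inverse (1 + x\<^sup>2))"
      using integrable_inverse_1_plus by simp
    have "cmod (\<phi> x) \<le> (C0 + C2) * inverse (1 + x\<^sup>2)" for x
    proof -
      have "cmod (\<phi> x) * (1 + x\<^sup>2) \<le> C0 + C2"
        using C(1)[of x] C(2)[of x] by (simp add: algebra_simps)
      moreover have "0 < 1 + x\<^sup>2" by (simp add: add_pos_nonneg)
      ultimately show ?thesis by (simp add: field_simps)
    qed
    then show "AE x in lborel. norm (\<phi> x) \<le> norm ((C0 + C2) * inverse (1 + x\<^sup>2))"
      by (intro AE_I2) (auto intro: order.trans[OF _ abs_ge_self])
  qed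
qed

lemma gauss_integral:
  "(LINT x|lborel. cis (t * x) * of_real (exp (- (x\<^sup>2 / 2)))) = of_real (sqrt (2 * pi) * exp (- (t\<^sup>2 / 2)))"
proof -
  have "of_real (exp (- (t\<^sup>2 / 2))) = (LINT x|std_normal_distribution. cis (t * x))"
    using fun_cong[OF char_std_normal_distribution, of t] by (simp add: char_def cis_conv_exp)
  also have "\<dots> = (LINT x|lborel. std_normal_density x *\<^sub>R cis (t * x))"
    by (rule integral_density) measurable
  also have "\<dots> = (LINT x|lborel. (cis (t * x) * of_real (exp (- (x\<^sup>2 / 2)))) / of_real (sqrt (2 * pi)))"
    by (intro Bochner_Integration.integral_cong) (auto simp: std_normal_density_def scaleR_conv_of_real)
  also have "\<dots> = (LINT x|lborel. cis (t * x) * of_real (exp (- (x\<^sup>2 / 2)))) / of_real (sqrt (2 * pi))"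
    by simp
  finally show ?thesis by (simp add: field_simps)
qed

lemma inv_fourier_eq_fourier: "inv_fourier f x = fourier f (- x)"
  by (simp add: inv_fourier_def fourier_def mult.commute)

lemma inv_fourier_mod_gauss: "inv_fourier (mod_gauss b) = shifted_gauss (- b)"
proof
  fix \<xi>
  have "(LINT x|lborel. cis (\<xi> * x) * mod_gauss b x)
      = (LINT x|lborel. cis ((\<xi> + b) * x) * of_real (exp (- (x\<^sup>2 / 2))))"
    by (intro Bochner_Integration.integral_cong) (auto simp: mod_gauss_def cis_mult algebra_simps simp flip: mult.assoc)
  then show "inv_fourier (mod_gauss b) \<xi> = shifted_gauss (- b) \<xi>"
    unfolding inv_fourier_def gauss_integral by (simp add: shifted_gauss_def)
qed

lemma fourier_shifted_gauss: "fourier (shifted_gauss b) = mod_gauss (- b)"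
proof
  fix x
  have "(LINT \<xi>|lborel. cis (- (\<xi> * x)) * shifted_gauss b \<xi>)
      = (LINT \<xi>|lborel. cis (- ((\<xi> + b) * x)) * shifted_gauss b (\<xi> + b))"
    using lborel_integral_real_affine[of 1 "\<lambda>\<xi>. cis (- (\<xi> * x)) * shifted_gauss b \<xi>" b] by (simp add: add.commute)
  also have "\<dots> = (LINT \<xi>|lborel. cis (- (b * x)) * (cis ((- x) * \<xi>) * of_real (exp (- (\<xi>\<^sup>2 / 2)))))"
    by (intro Bochner_Integration.integral_cong)
       (auto simp: shifted_gauss_def cis_mult algebra_simps simp flip: mult.assoc)
  also have "\<dots> = cis (- (b * x)) * of_real (sqrt (2 * pi) * exp (- ((- x)\<^sup>2 / 2)))"
    by (subst integral_mult_right_zero) (simp only: gauss_integral)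
  finally show "fourier (shifted_gauss b) x = mod_gauss (- b) x"
    by (simp add: fourier_def mod_gauss_def)
qed

lemma integrable_cis_mult:
  assumes "integrable lborel g"
  shows "integrable lborel (\<lambda>\<xi>. cis (x * \<xi>) * g \<xi>)" "integrable lborel (\<lambda>\<xi>. cis (- (\<xi> * x)) * g \<xi>)"
proof -
  have [measurable]: "g \<in> borel_measurable lborel" using assms by auto
  show "integrable lborel (\<lambda>\<xi>. cis (x * \<xi>) * g \<xi>)" "integrable lborel (\<lambda>\<xi>. cis (- (\<xi> * x)) * g \<xi>)"
    by (rule Bochner_Integration.integrable_bound[OF assms]; simp add: norm_mult)+
qed

lemma inv_fourier_bound:
  assumes "integrable lborel g"
  shows "cmod (inv_fourier g x) \<le> (LINT \<xi>|lborel. cmod (g \<xi>)) / sqrt (2 * pi)"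
  unfolding inv_fourier_def norm_divide
  using integral_norm_bound[of lborel "\<lambda>\<xi>. cis (x * \<xi>) * g \<xi>"]
  by (auto intro!: divide_right_mono simp: norm_mult)

lemma inv_fourier_continuous:
  assumes g: "integrable lborel g"
  shows "continuous_on UNIV (inv_fourier g)"
  unfolding continuous_on_sequentially o_def
proof (intro allI ballI impI)
  fix r :: "nat \<Rightarrow> real" and x assume r: "(\<forall>n. r n \<in> UNIV) \<and> r \<longlonglongrightarrow> x"
  have [measurable]: "g \<in> borel_measurable lborel" using g by auto
  have "(\<lambda>n. LINT \<xi>|lborel. cis (r n * \<xi>) * g \<xi>) \<longlonglongrightarrow> (LINT \<xi>|lborel. cis (x * \<xi>) * g \<xi>)"
  proof (rule integral_dominated_convergence)
    show "integrable lborel (\<lambda>\<xi>. cmod (g \<xi>))" using g by simp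
    show "AE \<xi> in lborel. (\<lambda>n. cis (r n * \<xi>) * g \<xi>) \<longlonglongrightarrow> cis (x * \<xi>) * g \<xi>"
      using r by (intro AE_I2 tendsto_intros) auto
  qed (auto simp: norm_mult)
  then show "(\<lambda>n. inv_fourier g (r n)) \<longlonglongrightarrow> inv_fourier g x"
    unfolding inv_fourier_def by (intro tendsto_intros) auto
qed

text \<open>Fubini, since the kernel \<open>cis (x \<xi>)\<close> is symmetric and bounded.\<close>

lemma inv_fourier_duality:
  assumes g: "integrable lborel g" and \<phi>: "integrable lborel \<phi>"
  shows "(LINT \<xi>|lborel. g \<xi> * inv_fourier \<phi> \<xi>) = (LINT x|lborel. inv_fourier g x * \<phi> x)"
    and "(LINT \<xi>|lborel. g \<xi> * fourier \<phi> \<xi>) = (LINT x|lborel. fourier g x * \<phi> x)"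
proof -
  have [measurable]: "g \<in> borel_measurable lborel" "\<phi> \<in> borel_measurable lborel"
    using g \<phi> by auto
  have *: "(LINT \<xi>|lborel. g \<xi> * (LINT x|lborel. cis (e * (x * \<xi>)) * \<phi> x))
      = (LINT x|lborel. (LINT \<xi>|lborel. cis (e * (x * \<xi>)) * g \<xi>) * \<phi> x)" for e
  proof -
    have int: "integrable (lborel \<Otimes>\<^sub>M lborel) (\<lambda>(\<xi>, x). cis (e * (x * \<xi>)) * (g \<xi> * \<phi> x))"
      by (rule Bochner_Integration.integrable_bound[OF integrable_pair_mult[OF g \<phi>]]) (auto simp: norm_mult)
    have "(LINT \<xi>|lborel. g \<xi> * (LINT x|lborel. cis (e * (x * \<xi>)) * \<phi> x))
        = (LINT \<xi>|lborel. LINT x|lborel. cis (e * (x * \<xi>)) * (g \<xi> * \<phi> x))"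
      by (simp add: mult.left_commute flip: integral_mult_right_zero)
    also have "\<dots> = (LINT x|lborel. LINT \<xi>|lborel. cis (e * (x * \<xi>)) * (g \<xi> * \<phi> x))"
      using lborel_pair.Fubini_integral[OF int] by simp
    also have "\<dots> = (LINT x|lborel. (LINT \<xi>|lborel. cis (e * (x * \<xi>)) * g \<xi>) * \<phi> x)"
      by (simp add: mult.assoc flip: integral_mult_left_zero)
    finally show ?thesis .
  qed
  from *[of 1] show "(LINT \<xi>|lborel. g \<xi> * inv_fourier \<phi> \<xi>) = (LINT x|lborel. inv_fourier g x * \<phi> x)"
    by (simp add: inv_fourier_def mult.commute)
  from *[of "-1"] show "(LINT \<xi>|lborel. g \<xi> * fourier \<phi> \<xi>) = (LINT x|lborel. fourier g x * \<phi> x)"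
    by (simp add: fourier_def mult.commute)
qed

section \<open>Uniqueness and inversion of the Fourier transform\<close>

text \<open>The positive and the negative part of \<open>r\<close> have the same total mass \<open>m\<close>, as the transform vanishes at \<open>0\<close>.
After division by \<open>m\<close> they are densities of two probability measures with the same characteristic function, which coincide
by Levy's uniqueness theorem.\<close>

lemma real_zero_if_fourier_zero:
  fixes r :: "real \<Rightarrow> real"
  assumes r: "integrable lborel r"
    and z: "\<And>b. (LINT x|lborel. cis (b * x) * of_real (r x)) = 0"
  shows "AE x in lborel. r x = 0"
proof -
  define p where "p x = max 0 (r x)" for x
  define n where "n x = max 0 (- r x)" for x
  have rpn: "r x = p x - n x" "0 \<le> p x" "0 \<le> n x" for x
    by (auto simp: p_def n_def)
  have int: "integrable lborel p" "integrable lborel n"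
    using r unfolding p_def n_def by (auto intro!: integrable_max)
  then have [measurable]: "p \<in> borel_measurable borel" "n \<in> borel_measurable borel"
    by auto
  have eq: "(LINT x|lborel. cis (b * x) * of_real (p x)) = (LINT x|lborel. cis (b * x) * of_real (n x))" for b
  proof -
    have "(LINT x|lborel. cis (b * x) * of_real (p x)) - (LINT x|lborel. cis (b * x) * of_real (n x))
        = (LINT x|lborel. cis (b * x) * of_real (p x) - cis (b * x) * of_real (n x))"
      using int by (intro Bochner_Integration.integral_diff[symmetric] integrable_cis_mult(1) integrable_of_real)
    also have "\<dots> = 0"
      using z[of b] by (simp add: rpn(1) algebra_simps)
    finally show ?thesis by simp
  qed
  define m where "m = (LINT x|lborel. p x)"
  have m: "(LINT x|lborel. n x) = m"
    using eq[of 0] by (simp add: m_def)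
  show ?thesis
  proof (cases "m = 0")
    case True
    then have "AE x in lborel. p x = 0" "AE x in lborel. n x = 0"
      using integral_nonneg_eq_0_iff_AE[OF int(1)] integral_nonneg_eq_0_iff_AE[OF int(2)] rpn m
      by (auto simp: m_def)
    then show ?thesis by eventually_elim (simp add: rpn(1))
  next
    case False
    have m0: "0 < m"
      using False rpn(2) by (simp add: m_def less_le)
    define D where "D f = density lborel (\<lambda>x. ennreal (f x / m))" for f :: "real \<Rightarrow> real"
    have D: "real_distribution (D f)" "char (D f) t = (LINT x|lborel. cis (t * x) * of_real (f x)) / of_real m"
      if f: "integrable lborel f" "\<And>x. 0 \<le> f x" "(LINT x|lborel. f x) = m" for f t
    proof -
      have [measurable]: "f \<in> borel_measurable borel" using f(1) by auto
      have "emeasure (D f) (space (D f)) = (\<integral>\<^sup>+ x. ennreal (f x / m) \<partial>lborel)"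
        by (simp add: D_def emeasure_density)
      also have "\<dots> = ennreal (LINT x|lborel. f x / m)"
        by (rule nn_integral_eq_integral) (use f m0 in auto)
      also have "\<dots> = 1" using f(3) m0 by simp
      finally have "prob_space (D f)" by (rule prob_spaceI)
      then show "real_distribution (D f)"
        unfolding real_distribution_def real_distribution_axioms_def by (simp add: D_def)
      have "char (D f) t = (LINT x|lborel. (f x / m) *\<^sub>R cis (t * x))"
        unfolding char_def D_def cis_conv_exp[symmetric]
        by (rule integral_density) (use f m0 in auto)
      also have "\<dots> = (LINT x|lborel. cis (t * x) * of_real (f x) / of_real m)"
        by (intro Bochner_Integration.integral_cong) (auto simp: scaleR_conv_of_real)
      finally show "char (D f) t = (LINT x|lborel. cis (t * x) * of_real (f x)) / of_real m"
        by simp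
    qed
    have "D p = D n"
    proof (rule Levy_uniqueness)
      show "real_distribution (D p)" "real_distribution (D n)"
        using D(1) int rpn m m_def by auto
      show "char (D p) = char (D n)"
        using D(2) int rpn m m_def eq by (intro ext) simp
    qed
    then have "AE x in lborel. ennreal (p x / m) = ennreal (n x / m)"
      unfolding D_def by (intro sigma_finite_measure.density_unique[OF sigma_finite_lborel]) auto
    then show ?thesis
    proof eventually_elim
      case (elim x)
      then have "p x / m = n x / m"
        using rpn m0 by (simp add: ennreal_inj)
      then show ?case using m0 rpn(1) by simp
    qed
  qed
qed

lemma zero_if_fourier_zero:
  fixes h :: "real \<Rightarrow> complex"
  assumes h: "integrable lborel h" and z: "\<And>b. (LINT x|lborel. cis (b * x) * h x) = 0"
  shows "AE x in lborel. h x = 0"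
proof -
  have c: "(LINT x|lborel. cis (b * x) * cnj (h x)) = 0" for b
  proof -
    have "(LINT x|lborel. cis (b * x) * cnj (h x)) = (LINT x|lborel. cnj (cis (- b * x) * h x))"
      by (simp add: cis_cnj)
    also have "\<dots> = 0"
      using z[of "- b"] by (simp del: complex_cnj_mult)
    finally show ?thesis .
  qed
  have ci: "integrable lborel (\<lambda>x. cnj (h x))" using h by simp
  note i = integrable_cis_mult(1)[OF h] integrable_cis_mult(1)[OF ci]
  have im: "of_real (Im w) = (w - cnj w) / (2 * \<i>)" for w
    by (simp add: complex_eq_iff Re_divide Im_divide power2_eq_square)
  have "AE x in lborel. Re (h x) = 0"
  proof (rule real_zero_if_fourier_zero)
    show "integrable lborel (\<lambda>x. Re (h x))" using h by simp
    fix b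
    have "(LINT x|lborel. cis (b * x) * of_real (Re (h x)))
        = (LINT x|lborel. (cis (b * x) * h x + cis (b * x) * cnj (h x)) / 2)"
      by (intro Bochner_Integration.integral_cong)
         (auto simp: complex_add_cnj simp flip: distrib_left)
    then show "(LINT x|lborel. cis (b * x) * of_real (Re (h x))) = 0"
      using i z c by simp
  qed
  moreover have "AE x in lborel. Im (h x) = 0"
  proof (rule real_zero_if_fourier_zero)
    show "integrable lborel (\<lambda>x. Im (h x))" using h by simp
    fix b
    have "(LINT x|lborel. cis (b * x) * of_real (Im (h x)))
        = (LINT x|lborel. (cis (b * x) * h x - cis (b * x) * cnj (h x)) / (2 * \<i>))"
      by (intro Bochner_Integration.integral_cong)
         (auto simp: im right_diff_distrib diff_divide_distrib mult.left_commute)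
    then show "(LINT x|lborel. cis (b * x) * of_real (Im (h x))) = 0"
      using i z c by simp
  qed
  ultimately show ?thesis
    by eventually_elim (simp add: complex_eq_iff)
qed

text \<open>Testing with the modulated Gaussians \<open>mod_gauss b\<close>, for all \<open>b\<close>, says that the integrable function
\<open>(g - h) exp (- x\<^sup>2 / 2)\<close> has a vanishing Fourier transform.\<close>

lemma has_fourier_unique:
  assumes g: "has_fourier \<Lambda> g" and h: "has_fourier \<Lambda> h"
  shows "AE x in lborel. g x = h x"
proof -
  have m[measurable]: "g \<in> borel_measurable borel" "h \<in> borel_measurable borel"
    using g h by (auto simp: has_fourier_def)
  have i: "integrable lborel (\<lambda>x. g x * mod_gauss b x)" "integrable lborel (\<lambda>x. h x * mod_gauss b x)"
    and e: "(LINT x|lborel. g x * mod_gauss b x) = (LINT x|lborel. h x * mod_gauss b x)" for b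
    using g h mod_gauss_schwartz[of b] unfolding has_fourier_def by metis+
  have "AE x in lborel. (g x - h x) * mod_gauss 0 x = 0"
  proof (rule zero_if_fourier_zero)
    show "integrable lborel (\<lambda>x. (g x - h x) * mod_gauss 0 x)"
      using i[of 0] by (simp add: left_diff_distrib)
    fix b
    have "(LINT x|lborel. cis (b * x) * ((g x - h x) * mod_gauss 0 x))
        = (LINT x|lborel. g x * mod_gauss b x - h x * mod_gauss b x)"
      by (intro Bochner_Integration.integral_cong) (auto simp: mod_gauss_def algebra_simps)
    also have "\<dots> = 0" using i[of b] e[of b] by simp
    finally show "(LINT x|lborel. cis (b * x) * ((g x - h x) * mod_gauss 0 x)) = 0" .
  qed
  then show ?thesis by eventually_elim (simp add: mod_gauss_def)
qed

lemma has_fourier_distr_fourier: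
  assumes "has_fourier \<Lambda> g"
  shows "has_fourier \<Lambda> (distr_fourier \<Lambda>)" "AE x in lborel. distr_fourier \<Lambda> x = g x"
proof -
  show "has_fourier \<Lambda> (distr_fourier \<Lambda>)"
    unfolding distr_fourier_def using someI[of "has_fourier \<Lambda>", OF assms] by simp
  then show "AE x in lborel. distr_fourier \<Lambda> x = g x"
    using assms by (rule has_fourier_unique)
qed

lemma has_fourier_distr_of:
  assumes f: "integrable lborel f"
  shows "has_fourier (distr_of f) (fourier (\<lambda>x. of_real (f x)))"
    and "continuous_on UNIV (fourier (\<lambda>x. complex_of_real (f x)))"
    and "cmod (fourier (\<lambda>x. of_real (f x)) \<xi>) \<le> (LINT x|lborel. \<bar>f x\<bar>) / sqrt (2 * pi)"
proof -
  have cf: "integrable lborel (\<lambda>x. complex_of_real (f x))"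
    using f by (rule integrable_of_real)
  have e: "fourier h \<xi> = inv_fourier h (- \<xi>)" for h \<xi>
    by (simp add: inv_fourier_eq_fourier)
  show c: "continuous_on UNIV (fourier (\<lambda>x. complex_of_real (f x)))"
    unfolding e[abs_def]
    by (intro continuous_on_compose2[OF inv_fourier_continuous[OF cf]] continuous_intros) auto
  have b: "cmod (fourier (\<lambda>x. of_real (f x)) \<xi>) \<le> (LINT x|lborel. \<bar>f x\<bar>) / sqrt (2 * pi)" for \<xi>
    unfolding e using inv_fourier_bound[OF cf] by simp
  then show "cmod (fourier (\<lambda>x. of_real (f x)) \<xi>) \<le> (LINT x|lborel. \<bar>f x\<bar>) / sqrt (2 * pi)" .
  have m[measurable]: "fourier (\<lambda>x. complex_of_real (f x)) \<in> borel_measurable borel"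
    using c by (rule borel_measurable_continuous_onI)
  show "has_fourier (distr_of f) (fourier (\<lambda>x. of_real (f x)))"
    unfolding has_fourier_def
  proof (intro conjI ballI)
    fix \<phi> assume "\<phi> \<in> schwartz"
    then have \<phi>: "integrable lborel \<phi>" by (rule schwartz_integrable)
    then have [measurable]: "\<phi> \<in> borel_measurable borel" by auto
    show "integrable lborel (\<lambda>\<xi>. fourier (\<lambda>x. complex_of_real (f x)) \<xi> * \<phi> \<xi>)"
    proof (rule Bochner_Integration.integrable_bound)
      show "integrable lborel (\<lambda>\<xi>. complex_of_real ((LINT x|lborel. \<bar>f x\<bar>) / sqrt (2 * pi)) * \<phi> \<xi>)"
        using \<phi> by simp
      show "AE \<xi> in lborel. cmod (fourier (\<lambda>x. complex_of_real (f x)) \<xi> * \<phi> \<xi>)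
          \<le> cmod (complex_of_real ((LINT x|lborel. \<bar>f x\<bar>) / sqrt (2 * pi)) * \<phi> \<xi>)"
        unfolding norm_mult norm_of_real
        by (intro AE_I2 mult_right_mono order.trans[OF b abs_ge_self]) auto
    qed measurable
    show "distr_of f (fourier \<phi>) = (LINT \<xi>|lborel. fourier (\<lambda>x. complex_of_real (f x)) \<xi> * \<phi> \<xi>)"
      unfolding distr_of_def by (rule inv_fourier_duality(2)[OF cf \<phi>])
  qed (use m in simp)
qed

lemma continuous_AE_0_imp_0:
  fixes k :: "real \<Rightarrow> complex"
  assumes k: "continuous_on UNIV k" and ae: "AE x in lborel. k x = 0"
  shows "k x = 0"
proof (rule ccontr)
  assume "k x \<noteq> 0"
  have o: "open {y. k y \<noteq> 0}"
    using k by (intro open_Collect_neq) auto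
  with \<open>k x \<noteq> 0\<close> obtain e where e: "0 < e" "ball x e \<subseteq> {y. k y \<noteq> 0}"
    using openE by blast
  have "{y. k y \<noteq> 0} \<in> sets lborel" using o by simp
  then have "emeasure lborel {y. k y \<noteq> 0} = 0"
    using ae by (subst (asm) AE_iff_measurable[OF _ refl]) auto
  then have "emeasure lborel (ball x e) = 0"
    using e(2) \<open>{y. k y \<noteq> 0} \<in> sets lborel\<close> by (metis emeasure_mono le_zero_eq)
  then show False
    using e(1) by (simp add: ball_eq_greaterThanLessThan)
qed

text \<open>Both sides are continuous, so it suffices to compare them almost everywhere, and as in \<open>has_fourier_unique\<close>
it suffices to test with modulated Gaussians. For these, \<open>mod_gauss b\<close> is the Fourier transform of
the Gaussian shifted by \<open>- b\<close>, and \<open>inv_fourier (mod_gauss b)\<close> is that same shifted Gaussian. The distribution \<open>\<Lambda>\<close>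
only has to agree with \<open>f\<close> on this explicit family, whose members are visibly Fourier transforms of Schwartz functions.\<close>

lemma fourier_inversion:
  fixes f :: "real \<Rightarrow> real"
  assumes f: "continuous_on UNIV f" and fi: "integrable lborel (\<lambda>x. f x * exp (- (x\<^sup>2 / 2)))"
    and \<Lambda>: "has_fourier \<Lambda> g" and g: "integrable lborel g"
    and e: "\<And>b. \<Lambda> (mod_gauss b) = distr_of f (mod_gauss b)"
  shows "of_real (f x) = inv_fourier g x"
proof -
  note c = inv_fourier_continuous[OF g]
  have m[measurable]: "f \<in> borel_measurable borel" "inv_fourier g \<in> borel_measurable borel"
    using f c by (auto intro: borel_measurable_continuous_onI)
  define h where "h x = (of_real (f x) - inv_fourier g x) * mod_gauss 0 x" for x
  have mg: "mod_gauss b x = cis (b * x) * mod_gauss 0 x" for b x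
    by (simp add: mod_gauss_def)
  have i1: "integrable lborel (\<lambda>x. of_real (f x) * mod_gauss 0 x)"
    using integrable_of_real[OF fi, where 'a = complex] by (simp add: mod_gauss_def)
  note gi = schwartz_integrable[OF mod_gauss_schwartz]
  have [measurable]: "mod_gauss b \<in> borel_measurable borel" for b using gi[of b] by auto
  have i2: "integrable lborel (\<lambda>x. inv_fourier g x * mod_gauss 0 x)"
  proof (rule Bochner_Integration.integrable_bound)
    show "integrable lborel (\<lambda>x. complex_of_real ((LINT \<xi>|lborel. cmod (g \<xi>)) / sqrt (2 * pi)) * mod_gauss 0 x)"
      using gi by simp
    show "AE x in lborel. cmod (inv_fourier g x * mod_gauss 0 x)
        \<le> cmod (complex_of_real ((LINT \<xi>|lborel. cmod (g \<xi>)) / sqrt (2 * pi)) * mod_gauss 0 x)"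
      unfolding norm_mult norm_of_real
      by (intro AE_I2 mult_right_mono order.trans[OF inv_fourier_bound[OF g] abs_ge_self]) auto
  qed measurable
  have "AE x in lborel. h x = 0"
  proof (rule zero_if_fourier_zero)
    show "integrable lborel h"
      unfolding h_def[abs_def] left_diff_distrib using i1 i2 by simp
    fix b
    have "(LINT x|lborel. cis (b * x) * h x) = (LINT x|lborel. cis (b * x) * (of_real (f x) * mod_gauss 0 x)
        - cis (b * x) * (inv_fourier g x * mod_gauss 0 x))"
      by (intro Bochner_Integration.integral_cong) (auto simp: h_def algebra_simps)
    also have "\<dots> = (LINT x|lborel. cis (b * x) * (of_real (f x) * mod_gauss 0 x))
        - (LINT x|lborel. cis (b * x) * (inv_fourier g x * mod_gauss 0 x))"
      by (intro Bochner_Integration.integral_diff integrable_cis_mult(1) i1 i2)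
    also have "\<dots> = distr_of f (mod_gauss b) - (LINT x|lborel. inv_fourier g x * mod_gauss b x)"
      by (simp add: distr_of_def mg[of b] mult.left_commute)
    also have "(LINT x|lborel. inv_fourier g x * mod_gauss b x) = (LINT \<xi>|lborel. g \<xi> * shifted_gauss (- b) \<xi>)"
      using inv_fourier_duality(1)[OF g gi[of b]] by (simp add: inv_fourier_mod_gauss)
    also have "\<dots> = \<Lambda> (fourier (shifted_gauss (- b)))"
      using \<Lambda> shifted_gauss_schwartz[of "- b"] unfolding has_fourier_def by simp
    also have "\<dots> = distr_of f (mod_gauss b)"
      by (simp add: fourier_shifted_gauss e)
    finally show "(LINT x|lborel. cis (b * x) * h x) = 0" by simp
  qed
  moreover have "continuous_on UNIV h"
    unfolding h_def[abs_def] mod_gauss_def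
    using f c by (intro continuous_intros continuous_on_of_real) auto
  ultimately have "h x = 0" by (intro continuous_AE_0_imp_0)
  then show ?thesis by (simp add: h_def mod_gauss_def)
qed

text \<open>Integrating the candidate derivative over \<open>[a, y]\<close> and exchanging the integrals recovers the increment of
\<open>inv_fourier g\<close>; the candidate is continuous, hence it is the derivative.\<close>

lemma inv_fourier_deriv:
  assumes g: "integrable lborel g" and g': "integrable lborel (\<lambda>\<xi>. of_real \<xi> * g \<xi>)"
  shows "(inv_fourier g has_vector_derivative inv_fourier (\<lambda>\<xi>. \<i> * of_real \<xi> * g \<xi>) x) (at x)"
proof -
  let ?h = "\<lambda>\<xi>. \<i> * of_real \<xi> * g \<xi>"
  have h: "integrable lborel ?h" using g' by (simp add: mult.assoc)
  note c = inv_fourier_continuous[OF h]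
  have [measurable]: "g \<in> borel_measurable borel" using g by auto
  define a where "a = x - 1"
  have E: "inv_fourier g y = inv_fourier g a + integral {a..y} (inv_fourier ?h)" if "a \<le> y" for y
  proof -
    have si: "set_integrable lborel {a..y} (inv_fourier ?h)"
      by (rule borel_integrable_atLeastAtMost') (rule continuous_on_subset[OF c], simp)
    have int: "integrable (lborel \<Otimes>\<^sub>M lborel) (\<lambda>(z, \<xi>). of_real (indicator {a..y} z) * (cis (z * \<xi>) * ?h \<xi>))"
    proof (rule Bochner_Integration.integrable_bound)
      show "integrable (lborel \<Otimes>\<^sub>M lborel) (\<lambda>(z, \<xi>). complex_of_real (indicator {a..y} z) * ?h \<xi>)"
        by (rule integrable_pair_mult) (use h in \<open>auto intro!: integrable_of_real integrable_real_indicator simp: emeasure_lborel_Icc_eq\<close>)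
    qed (auto simp: norm_mult)
    have inner: "(LINT z|lborel. of_real (indicator {a..y} z) * (cis (z * \<xi>) * ?h \<xi>))
        = cis (y * \<xi>) * g \<xi> - cis (a * \<xi>) * g \<xi>" for \<xi>
    proof -
      have d: "((\<lambda>z. cis (z * \<xi>) * g \<xi>) has_vector_derivative cis (z * \<xi>) * ?h \<xi>) (at z within S)" for z S
      proof -
        have "((\<lambda>w. exp (\<i> * w * of_real \<xi>) * g \<xi>) has_field_derivative
            exp (\<i> * w * of_real \<xi>) * ?h \<xi>) (at w)" for w
          by (auto intro!: derivative_eq_intros)
        from has_vector_derivative_real_field[OF this] show ?thesis
          by (simp add: cis_conv_exp mult.assoc)
      qed
      have "(LINT z|lborel. indicator {a..y} z *\<^sub>R (cis (z * \<xi>) * ?h \<xi>))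
          = cis (y * \<xi>) * g \<xi> - cis (a * \<xi>) * g \<xi>"
      proof (rule integral_FTC_atLeastAtMost[OF that])
        show "((\<lambda>z. cis (z * \<xi>) * g \<xi>) has_vector_derivative cis (z * \<xi>) * ?h \<xi>) (at z within {a..y})" for z
          by (rule d)
        show "continuous_on {a..y} (\<lambda>z. cis (z * \<xi>) * ?h \<xi>)"
          by (intro continuous_intros)
      qed
      then show ?thesis by (simp add: scaleR_conv_of_real)
    qed
    have "integral {a..y} (inv_fourier ?h) = (LINT z|lborel. indicator {a..y} z *\<^sub>R inv_fourier ?h z)"
      using set_borel_integral_eq_integral(2)[OF si] by (simp add: set_lebesgue_integral_def)
    also have "\<dots> = (LINT z|lborel. (LINT \<xi>|lborel. of_real (indicator {a..y} z) * (cis (z * \<xi>) * ?h \<xi>))) / of_real (sqrt (2 * pi))"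
      by (simp add: inv_fourier_def scaleR_conv_of_real)
    also have "(LINT z|lborel. (LINT \<xi>|lborel. of_real (indicator {a..y} z) * (cis (z * \<xi>) * ?h \<xi>)))
        = (LINT \<xi>|lborel. (LINT z|lborel. of_real (indicator {a..y} z) * (cis (z * \<xi>) * ?h \<xi>)))"
      using lborel_pair.Fubini_integral[OF int] by simp
    also have "\<dots> = (LINT \<xi>|lborel. cis (y * \<xi>) * g \<xi>) - (LINT \<xi>|lborel. cis (a * \<xi>) * g \<xi>)"
      unfolding inner by (intro Bochner_Integration.integral_diff integrable_cis_mult(1) g)
    finally show ?thesis
      unfolding inv_fourier_def[of g] by (simp add: diff_divide_distrib)
  qed
  have "((\<lambda>y. integral {a..y} (inv_fourier ?h)) has_vector_derivative inv_fourier ?h x) (at x within {a..x+1})"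
    by (rule integral_has_vector_derivative) (auto simp: a_def intro: continuous_on_subset[OF c])
  then have D: "((\<lambda>y. integral {a..y} (inv_fourier ?h)) has_vector_derivative inv_fourier ?h x) (at x)"
    by (subst (asm) at_within_interior) (auto simp: a_def)
  have D': "((\<lambda>y. inv_fourier g a + integral {a..y} (inv_fourier ?h)) has_vector_derivative inv_fourier ?h x) (at x)"
    using has_vector_derivative_add[OF has_vector_derivative_const D] by simp
  show ?thesis
  proof (rule has_vector_derivative_transform_within_open[OF D', of "{a<..}"])
    show "inv_fourier g a + integral {a..y} (inv_fourier ?h) = inv_fourier g y" if "y \<in> {a<..}" for y
      by (rule E[symmetric]) (use that in auto)
  qed (auto simp: a_def)
qed

section \<open>The Plancherel inequality\<close>

lemma gauss_real_integral:
  "integrable lborel (\<lambda>x::real. exp (- (x\<^sup>2 / 2)))" "(LINT x|lborel. exp (- (x\<^sup>2 / 2))) = sqrt (2 * pi)"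
proof -
  show "integrable lborel (\<lambda>x::real. exp (- (x\<^sup>2 / 2)))"
    using integrable_norm[OF schwartz_integrable[OF mod_gauss_schwartz[of 0]]]
    by (simp add: mod_gauss_def)
  have "complex_of_real (LINT x|lborel. exp (- (x\<^sup>2 / 2))) = of_real (sqrt (2 * pi))"
    using gauss_integral[of 0] by (simp flip: integral_complex_of_real)
  then show "(LINT x|lborel. exp (- (x\<^sup>2 / 2))) = sqrt (2 * pi)"
    by (simp only: of_real_eq_iff)
qed

text \<open>With the Gaussian weight \<open>w\<close>, the integral \<open>\<integral> w |F|\<^sup>2\<close> for \<open>F = inv_fourier g\<close> becomes a double integral of
\<open>g \<xi> cnj (g \<eta>) W (\<eta> - \<xi>) / sqrt (2 pi)\<close>, where the Gaussian \<open>W\<close> is an approximate identity of mass \<open>sqrt (2 pi)\<close>. The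
inequality \<open>|g \<xi> g \<eta>| \<le> (|g \<xi>|\<^sup>2 + |g \<eta>|\<^sup>2) / 2\<close> (the Schur test) concludes.\<close>

lemma plancherel_gauss_le:
  assumes g: "integrable lborel g" and g2: "integrable lborel (\<lambda>\<xi>. (cmod (g \<xi>))\<^sup>2)" and a: "a > 0"
  shows "(LINT x|lborel. exp (- ((a * x)\<^sup>2 / 2)) * (cmod (inv_fourier g x))\<^sup>2) \<le> (LINT \<xi>|lborel. (cmod (g \<xi>))\<^sup>2)"
proof -
  define w where "w x = exp (- ((a * x)\<^sup>2 / 2))" for x
  \<comment> \<open>The Fourier transform of \<open>w\<close>, in the unitary normalisation.\<close>
  define W where "W t = exp (- ((t / a)\<^sup>2 / 2)) / a" for t
  define F where "F = inv_fourier g"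
  define k where "k \<xi> = cmod (g \<xi>)" for \<xi>
  have [measurable]: "g \<in> borel_measurable borel" using g by auto
  have cF: "continuous_on UNIV F" unfolding F_def by (rule inv_fourier_continuous[OF g])
  then have mF[measurable]: "F \<in> borel_measurable borel" by (rule borel_measurable_continuous_onI)
  have [measurable]: "(\<lambda>x. cnj (F x)) \<in> borel_measurable borel"
    using cF by (intro borel_measurable_continuous_onI continuous_intros)
  have [measurable]: "w \<in> borel_measurable borel" "W \<in> borel_measurable borel" "k \<in> borel_measurable borel"
    unfolding w_def[abs_def] W_def[abs_def] k_def[abs_def] by measurable
  obtain C where C: "\<And>x. cmod (F x) \<le> C"
    unfolding F_def using inv_fourier_bound[OF g] by blast
  have iw: "integrable lborel w"
    unfolding w_def using lborel_integrable_real_affine[OF gauss_real_integral(1), of a 0] a by simp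
  have iW: "integrable lborel W" "(LINT t|lborel. W t) = sqrt (2 * pi)"
    unfolding W_def
    using lborel_integrable_real_affine[OF gauss_real_integral(1), of "1/a" 0]
      lborel_integral_real_affine[of "1/a" "\<lambda>x::real. exp (- (x\<^sup>2 / 2))" 0] gauss_real_integral(2) a
    by simp_all
  have W0: "0 \<le> W t" "W (- t) = W t" for t using a by (simp_all add: W_def)
  have w0: "0 \<le> w x" for x by (simp add: w_def)
  have wF: "integrable lborel (\<lambda>x. of_real (w x) * h x)"
    if [measurable]: "h \<in> borel_measurable borel" and h: "\<And>x. cmod (h x) \<le> C'" for h C'
  proof (rule Bochner_Integration.integrable_bound)
    show "integrable lborel (\<lambda>x. w x * C')" using iw by simp
    show "AE x in lborel. cmod (complex_of_real (w x) * h x) \<le> norm (w x * C')"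
      by (intro AE_I2) (auto simp: norm_mult abs_mult intro!: mult_left_mono order.trans[OF h])
  qed measurable
  have scal: "(LINT x|lborel. cis (t * x) * of_real (w x)) = of_real (sqrt (2 * pi) * W t)" for t
  proof -
    have "(LINT x|lborel. cis (t * x) * of_real (w x))
        = \<bar>1 / a\<bar> *\<^sub>R (LINT x|lborel. cis (t * (0 + 1 / a * x)) * of_real (w (0 + 1 / a * x)))"
      by (rule lborel_integral_real_affine) (use a in simp)
    also have "\<dots> = (1 / a) *\<^sub>R (LINT x|lborel. cis ((t / a) * x) * of_real (exp (- (x\<^sup>2 / 2))))"
      using a by (simp add: w_def)
    also have "\<dots> = of_real (sqrt (2 * pi) * W t)"
      unfolding gauss_integral by (simp add: W_def scaleR_conv_of_real)
    finally show ?thesis .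
  qed
  have inner: "inv_fourier (\<lambda>x. of_real (w x) * cnj (F x)) \<xi>
      = cnj (LINT \<eta>|lborel. g \<eta> * of_real (W (\<eta> - \<xi>))) / of_real (sqrt (2 * pi))" for \<xi>
  proof -
    let ?\<phi> = "\<lambda>x. of_real (w x) * cis (- (x * \<xi>))"
    have \<phi>: "integrable lborel ?\<phi>"
      by (rule wF[where C' = 1]) auto
    have inv: "inv_fourier ?\<phi> \<eta> = of_real (W (\<eta> - \<xi>))" for \<eta>
    proof -
      have "(LINT x|lborel. cis (\<eta> * x) * ?\<phi> x) = (LINT x|lborel. cis ((\<eta> - \<xi>) * x) * of_real (w x))"
      proof (intro Bochner_Integration.integral_cong refl)
        fix x
        have "cis ((\<eta> - \<xi>) * x) = cis (\<eta> * x) * cis (- (x * \<xi>))"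
          by (simp add: cis_mult algebra_simps)
        then show "cis (\<eta> * x) * ?\<phi> x = cis ((\<eta> - \<xi>) * x) * of_real (w x)"
          by (simp add: mult_ac)
      qed
      then show ?thesis unfolding inv_fourier_def scal by simp
    qed
    have "(LINT x|lborel. cis (\<xi> * x) * (of_real (w x) * cnj (F x))) = (LINT x|lborel. cnj (F x * ?\<phi> x))"
      by (intro Bochner_Integration.integral_cong) (auto simp: cis_cnj mult_ac)
    also have "\<dots> = cnj (LINT x|lborel. F x * ?\<phi> x)"
      by (simp del: complex_cnj_mult)
    also have "(LINT x|lborel. F x * ?\<phi> x) = (LINT \<eta>|lborel. g \<eta> * inv_fourier ?\<phi> \<eta>)"
      unfolding F_def by (rule inv_fourier_duality(1)[OF g \<phi>, symmetric])
    also have "\<dots> = (LINT \<eta>|lborel. g \<eta> * of_real (W (\<eta> - \<xi>)))"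
      unfolding inv ..
    finally show ?thesis by (simp add: inv_fourier_def)
  qed
  have k2: "integrable lborel (\<lambda>\<xi>. (k \<xi>)\<^sup>2)" using g2 by (simp add: k_def)
  have P1: "integrable (lborel \<Otimes>\<^sub>M lborel) (\<lambda>(\<xi>, \<eta>). (k \<xi>)\<^sup>2 * W (\<eta> - \<xi>))"
    using integrable_pair_shift[OF k2 iW(1), of 1] by simp
  have "integrable (lborel \<Otimes>\<^sub>M lborel) (\<lambda>(\<xi>, \<eta>). (k \<eta>)\<^sup>2 * W (\<xi> - \<eta>))"
    using lborel_pair.integrable_product_swap[OF P1] by simp
  moreover have "W (\<xi> - \<eta>) = W (\<eta> - \<xi>)" for \<xi> \<eta>
    using W0(2)[of "\<eta> - \<xi>"] by simp
  ultimately have P2: "integrable (lborel \<Otimes>\<^sub>M lborel) (\<lambda>(\<xi>, \<eta>). (k \<eta>)\<^sup>2 * W (\<eta> - \<xi>))"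
    by simp
  let ?S = "LINT \<xi>|lborel. (k \<xi>)\<^sup>2"
  have S1: "(LINT \<xi>|lborel. LINT \<eta>|lborel. (k \<xi>)\<^sup>2 * W (\<eta> - \<xi>)) = sqrt (2 * pi) * ?S"
    using integrable_translate(4)[OF iW(1)] iW(2) by simp
  have S2: "(LINT \<xi>|lborel. LINT \<eta>|lborel. (k \<eta>)\<^sup>2 * W (\<eta> - \<xi>)) = sqrt (2 * pi) * ?S"
    using integrable_translate(6)[OF iW(1)] iW(2) lborel_pair.Fubini_integral[OF P2] by (simp add: mult.commute)
  have y: "k \<xi> * k \<eta> * W (\<eta> - \<xi>) \<le> ((k \<xi>)\<^sup>2 * W (\<eta> - \<xi>) + (k \<eta>)\<^sup>2 * W (\<eta> - \<xi>)) / 2" for \<xi> \<eta>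
  proof -
    have "0 \<le> (k \<xi> - k \<eta>)\<^sup>2" by simp
    then have "k \<xi> * k \<eta> \<le> ((k \<xi>)\<^sup>2 + (k \<eta>)\<^sup>2) / 2" by (simp add: power2_diff)
    from mult_right_mono[OF this W0(1)[of "\<eta> - \<xi>"]] show ?thesis by (simp add: distrib_right)
  qed
  have k0: "0 \<le> k \<xi>" for \<xi> by (simp add: k_def)
  have P12: "integrable (lborel \<Otimes>\<^sub>M lborel) (\<lambda>(\<xi>, \<eta>). ((k \<xi>)\<^sup>2 * W (\<eta> - \<xi>) + (k \<eta>)\<^sup>2 * W (\<eta> - \<xi>)) / 2)"
    using integrable_divide[OF Bochner_Integration.integrable_add[OF P1 P2], of 2] by (simp add: case_prod_unfold)
  have P3: "integrable (lborel \<Otimes>\<^sub>M lborel) (\<lambda>(\<xi>, \<eta>). k \<xi> * k \<eta> * W (\<eta> - \<xi>))"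
  proof (rule Bochner_Integration.integrable_bound[OF P12])
    have "norm (k \<xi> * k \<eta> * W (\<eta> - \<xi>)) \<le> norm (((k \<xi>)\<^sup>2 * W (\<eta> - \<xi>) + (k \<eta>)\<^sup>2 * W (\<eta> - \<xi>)) / 2)" for \<xi> \<eta>
    proof -
      have "0 \<le> k \<xi> * k \<eta> * W (\<eta> - \<xi>)" by (intro mult_nonneg_nonneg k0 W0)
      with y[of \<xi> \<eta>] show ?thesis unfolding real_norm_def by arith
    qed
    then show "AE p in lborel \<Otimes>\<^sub>M lborel. norm (case p of (\<xi>, \<eta>) \<Rightarrow> k \<xi> * k \<eta> * W (\<eta> - \<xi>))
        \<le> norm (case p of (\<xi>, \<eta>) \<Rightarrow> ((k \<xi>)\<^sup>2 * W (\<eta> - \<xi>) + (k \<eta>)\<^sup>2 * W (\<eta> - \<xi>)) / 2)"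
      unfolding case_prod_unfold by (rule AE_I2)
  qed measurable
  have X: "(LINT \<xi>|lborel. LINT \<eta>|lborel. k \<xi> * k \<eta> * W (\<eta> - \<xi>)) \<le> sqrt (2 * pi) * ?S"
  proof -
    have "(LINT \<xi>|lborel. LINT \<eta>|lborel. k \<xi> * k \<eta> * W (\<eta> - \<xi>))
        \<le> (LINT p|(lborel \<Otimes>\<^sub>M lborel). (case p of (\<xi>, \<eta>) \<Rightarrow> ((k \<xi>)\<^sup>2 * W (\<eta> - \<xi>) + (k \<eta>)\<^sup>2 * W (\<eta> - \<xi>)) / 2))"
      unfolding lborel_pair.integral_fst[OF P3]
      by (rule integral_mono[OF P3 P12], unfold case_prod_unfold, rule y)
    also have "\<dots> = ((LINT p|(lborel \<Otimes>\<^sub>M lborel). (case p of (\<xi>, \<eta>) \<Rightarrow> (k \<xi>)\<^sup>2 * W (\<eta> - \<xi>)))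
        + (LINT p|(lborel \<Otimes>\<^sub>M lborel). (case p of (\<xi>, \<eta>) \<Rightarrow> (k \<eta>)\<^sup>2 * W (\<eta> - \<xi>)))) / 2"
      using Bochner_Integration.integral_add[OF P1 P2] by (simp add: case_prod_unfold)
    also have "\<dots> = sqrt (2 * pi) * ?S"
      using S1 S2 lborel_pair.integral_fst[OF P1] lborel_pair.integral_fst[OF P2] by simp
    finally show ?thesis .
  qed
  have "complex_of_real (LINT x|lborel. w x * (cmod (F x))\<^sup>2) = (LINT x|lborel. F x * (of_real (w x) * cnj (F x)))"
    unfolding integral_complex_of_real[symmetric]
    by (intro Bochner_Integration.integral_cong) (auto simp: complex_norm_square[symmetric] mult_ac simp flip: of_real_power)
  also have "\<dots> = (LINT \<xi>|lborel. g \<xi> * inv_fourier (\<lambda>x. of_real (w x) * cnj (F x)) \<xi>)"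
    unfolding F_def
    by (rule inv_fourier_duality(1)[OF g, symmetric]) (fold F_def, rule wF[where C' = C], use C in auto)
  finally have eq: "complex_of_real (LINT x|lborel. w x * (cmod (F x))\<^sup>2)
      = (LINT \<xi>|lborel. g \<xi> * inv_fourier (\<lambda>x. of_real (w x) * cnj (F x)) \<xi>)" .
  have "\<bar>LINT x|lborel. w x * (cmod (F x))\<^sup>2\<bar>
      \<le> (LINT \<xi>|lborel. cmod (g \<xi> * inv_fourier (\<lambda>x. of_real (w x) * cnj (F x)) \<xi>))"
    unfolding norm_of_real[where 'a = complex, symmetric] eq by (rule integral_norm_bound)
  also have "\<dots> \<le> (LINT \<xi>|lborel. (LINT \<eta>|lborel. k \<xi> * k \<eta> * W (\<eta> - \<xi>)) / sqrt (2 * pi))"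
  proof (rule Bochner_Integration.integral_mono')
    show "integrable lborel (\<lambda>\<xi>. (LINT \<eta>|lborel. k \<xi> * k \<eta> * W (\<eta> - \<xi>)) / sqrt (2 * pi))"
      using lborel_pair.integrable_fst[OF P3] by simp
    fix \<xi>
    have "cmod (LINT \<eta>|lborel. g \<eta> * of_real (W (\<eta> - \<xi>))) \<le> (LINT \<eta>|lborel. k \<eta> * W (\<eta> - \<xi>))"
      by (rule order.trans[OF integral_norm_bound]) (simp add: norm_mult k_def W0)
    then have "cmod (g \<xi>) * cmod (LINT \<eta>|lborel. g \<eta> * of_real (W (\<eta> - \<xi>))) \<le> k \<xi> * (LINT \<eta>|lborel. k \<eta> * W (\<eta> - \<xi>))"
      unfolding k_def by (intro mult_left_mono) auto
    then show "cmod (g \<xi> * inv_fourier (\<lambda>x. of_real (w x) * cnj (F x)) \<xi>)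
        \<le> (LINT \<eta>|lborel. k \<xi> * k \<eta> * W (\<eta> - \<xi>)) / sqrt (2 * pi)"
      unfolding inner norm_mult norm_divide complex_mod_cnj by (simp add: mult.assoc divide_right_mono)
  qed (intro divide_nonneg_nonneg Bochner_Integration.integral_nonneg mult_nonneg_nonneg k0 W0, simp)
  also have "\<dots> = (LINT \<xi>|lborel. LINT \<eta>|lborel. k \<xi> * k \<eta> * W (\<eta> - \<xi>)) / sqrt (2 * pi)"
    by simp
  also have "\<dots> \<le> sqrt (2 * pi) * ?S / sqrt (2 * pi)"
    by (rule divide_right_mono[OF X]) simp
  finally show ?thesis
    by (simp add: w_def F_def k_def)
qed

text \<open>Let the Gaussian weight tend to \<open>1\<close>.\<close>

lemma plancherel_le:
  assumes g: "integrable lborel g" "integrable lborel (\<lambda>\<xi>. (cmod (g \<xi>))\<^sup>2)"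
    and f: "\<And>x. of_real (f x) = inv_fourier g x" and f2: "integrable lborel (\<lambda>x. (f x)\<^sup>2)"
  shows "(LINT x|lborel. (f x)\<^sup>2) \<le> (LINT \<xi>|lborel. (cmod (g \<xi>))\<^sup>2)"
proof (rule LIMSEQ_le_const2)
  let ?w = "\<lambda>n x. exp (- ((1 / (real n + 1) * x)\<^sup>2 / 2))"
  have m: "(\<lambda>x. (f x)\<^sup>2) \<in> borel_measurable lborel" using f2 by auto
  show "(\<lambda>n. LINT x|lborel. ?w n x * (f x)\<^sup>2) \<longlonglongrightarrow> (LINT x|lborel. (f x)\<^sup>2)"
  proof (rule integral_dominated_convergence[where w = "\<lambda>x. (f x)\<^sup>2"])
    show "AE x in lborel. (\<lambda>n. ?w n x * (f x)\<^sup>2) \<longlonglongrightarrow> (f x)\<^sup>2"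
    proof (intro AE_I2)
      fix x
      have "(\<lambda>n. 1 / (real n + 1)) \<longlonglongrightarrow> 0" by real_asymp
      then have "(\<lambda>n. ?w n x) \<longlonglongrightarrow> exp (- ((0 * x)\<^sup>2 / 2))"
        by (intro tendsto_intros) auto
      then have "(\<lambda>n. ?w n x) \<longlonglongrightarrow> 1" by simp
      from tendsto_mult[OF this tendsto_const[of "(f x)\<^sup>2"]] show "(\<lambda>n. ?w n x * (f x)\<^sup>2) \<longlonglongrightarrow> (f x)\<^sup>2"
        by simp
    qed
    show "AE x in lborel. norm (?w n x * (f x)\<^sup>2) \<le> (f x)\<^sup>2" for n
      by (intro AE_I2) (auto simp: abs_mult mult_left_le_one_le)
  qed (use f2 m in auto)
  have sq: "(f x)\<^sup>2 = (cmod (inv_fourier g x))\<^sup>2" for x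
    unfolding f[symmetric] norm_of_real by simp
  then show "\<exists>N. \<forall>n\<ge>N. (LINT x|lborel. ?w n x * (f x)\<^sup>2) \<le> (LINT \<xi>|lborel. (cmod (g \<xi>))\<^sup>2)"
    unfolding sq
    by (intro exI[of _ 0] allI impI plancherel_gauss_le[OF g]) simp
qed

section \<open>Sobolev embedding\<close>

lemma integrable_bracket:
  assumes "\<sigma> > 1 / 2"
  shows "integrable lborel (\<lambda>\<xi>::real. (1 + \<xi>\<^sup>2) powr - \<sigma>)"
proof -
  \<comment> \<open>Away from \<open>[-1, 1]\<close> the bracket is dominated by \<open>|\<xi>| powr (- 2 \<sigma>)\<close>, integrable as \<open>2 \<sigma> > 1\<close>.\<close>
  define h where "h \<xi> = indicator {1..} \<xi> * \<xi> powr (- 2 * \<sigma>)" for \<xi> :: real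
  have "((\<lambda>\<xi>. \<xi> powr (- 2 * \<sigma>)) has_integral - (1 powr (- 2 * \<sigma> + 1)) / (- 2 * \<sigma> + 1)) {1..}"
    by (rule has_integral_powr_to_inf) (use assms in auto)
  then have "(\<lambda>\<xi>::real. \<xi> powr (- 2 * \<sigma>)) absolutely_integrable_on {1..}"
    by (intro nonnegative_absolutely_integrable_1) (auto simp: integrable_on_def)
  then have "integrable lborel h"
    unfolding set_integrable_def h_def by (subst (asm) integrable_completion) auto
  note h = this integrable_translate(7)[OF this]
  show ?thesis
  proof (rule Bochner_Integration.integrable_bound)
    show "integrable lborel (\<lambda>\<xi>. indicator {-1..1} \<xi> + h \<xi> + h (- \<xi>))"
      using h by (auto simp: emeasure_lborel_Icc_eq intro!: Bochner_Integration.integrable_add integrable_real_indicator)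
    have "(1 + \<xi>\<^sup>2) powr - \<sigma> \<le> indicator {-1..1} \<xi> + h \<xi> + h (- \<xi>)" for \<xi>
    proof (cases "\<bar>\<xi>\<bar> \<le> 1")
      case True
      have "(1 + \<xi>\<^sup>2) powr - \<sigma> \<le> 1 powr - \<sigma>"
        by (rule powr_mono2') (use assms in auto)
      moreover have "0 \<le> h \<xi>" "0 \<le> h (- \<xi>)" by (auto simp: h_def)
      ultimately show ?thesis using True by (simp add: indicator_def abs_le_iff)
    next
      case False
      have "(1 + \<xi>\<^sup>2) powr - \<sigma> \<le> (\<bar>\<xi>\<bar> powr 2) powr - \<sigma>"
        by (rule powr_mono2') (use assms False in auto)
      also have "\<dots> = \<bar>\<xi>\<bar> powr (- 2 * \<sigma>)"
        unfolding powr_powr by simp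
      finally show ?thesis using False by (auto simp: h_def indicator_def abs_if split: if_splits)
    qed
    then show "AE \<xi> in lborel. norm ((1 + \<xi>\<^sup>2) powr - \<sigma>) \<le> norm (indicator {-1..1} \<xi> + h \<xi> + h (- \<xi>))"
      by (intro AE_I2) (auto intro: order.trans[OF _ abs_ge_self])
  qed measurable
qed

text \<open>The transform chosen by \<^const>\<open>distr_fourier\<close> agrees almost everywhere with the one provided by
\<^const>\<open>sobolev\<close>, so it inherits the weighted integrability.\<close>

lemma sobolevD:
  assumes "\<Lambda> \<in> sobolev \<sigma>"
  shows "has_fourier \<Lambda> (distr_fourier \<Lambda>)" "distr_fourier \<Lambda> \<in> borel_measurable borel"
    "integrable lborel (\<lambda>\<xi>. (1 + \<xi>\<^sup>2) powr \<sigma> * (cmod (distr_fourier \<Lambda> \<xi>))\<^sup>2)"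
    "(sobolev_norm \<sigma> \<Lambda>)\<^sup>2 = (LINT \<xi>|lborel. (1 + \<xi>\<^sup>2) powr \<sigma> * (cmod (distr_fourier \<Lambda> \<xi>))\<^sup>2)"
    "0 \<le> sobolev_norm \<sigma> \<Lambda>"
proof -
  from assms obtain g where g: "has_fourier \<Lambda> g" "integrable lborel (\<lambda>\<xi>. (1 + \<xi>\<^sup>2) powr \<sigma> * (cmod (g \<xi>))\<^sup>2)"
    unfolding sobolev_def by blast
  show f: "has_fourier \<Lambda> (distr_fourier \<Lambda>)"
    using has_fourier_distr_fourier(1)[OF g(1)] .
  show m[measurable]: "distr_fourier \<Lambda> \<in> borel_measurable borel"
    using f by (simp add: has_fourier_def)
  have [measurable]: "g \<in> borel_measurable borel"
    using g(1) by (simp add: has_fourier_def)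
  have "AE \<xi> in lborel. (1 + \<xi>\<^sup>2) powr \<sigma> * (cmod (distr_fourier \<Lambda> \<xi>))\<^sup>2 = (1 + \<xi>\<^sup>2) powr \<sigma> * (cmod (g \<xi>))\<^sup>2"
    using has_fourier_distr_fourier(2)[OF g(1)] by eventually_elim simp
  then show "integrable lborel (\<lambda>\<xi>. (1 + \<xi>\<^sup>2) powr \<sigma> * (cmod (distr_fourier \<Lambda> \<xi>))\<^sup>2)"
    using g(2) by (subst integrable_cong_AE[where g = "\<lambda>\<xi>. (1 + \<xi>\<^sup>2) powr \<sigma> * (cmod (g \<xi>))\<^sup>2"]) auto
  have n: "0 \<le> (LINT \<xi>|lborel. (1 + \<xi>\<^sup>2) powr \<sigma> * (cmod (distr_fourier \<Lambda> \<xi>))\<^sup>2)"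
    by (intro Bochner_Integration.integral_nonneg) auto
  then show "(sobolev_norm \<sigma> \<Lambda>)\<^sup>2 = (LINT \<xi>|lborel. (1 + \<xi>\<^sup>2) powr \<sigma> * (cmod (distr_fourier \<Lambda> \<xi>))\<^sup>2)"
    unfolding sobolev_norm_def by simp
  show "0 \<le> sobolev_norm \<sigma> \<Lambda>"
    unfolding sobolev_norm_def using n by simp
qed

text \<open>The \<open>L\<^sup>2\<close> norm of \<open>(1 + \<xi>\<^sup>2) powr (- \<sigma> / 2)\<close>, finite for \<open>\<sigma> > 1/2\<close>: the constant in the embedding of \<open>H\<^sup>\<sigma>\<close>
into the bounded functions.\<close>

definition embedding_const :: "real \<Rightarrow> real" where
  "embedding_const \<sigma> = sqrt (LINT \<xi>|lborel. (1 + \<xi>\<^sup>2) powr - \<sigma>)"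

lemma embedding_const_nonneg: "0 \<le> embedding_const \<sigma>"
  unfolding embedding_const_def by (intro real_sqrt_ge_zero Bochner_Integration.integral_nonneg) auto

text \<open>Cauchy-Schwarz for the factors \<open>(1 + \<xi>\<^sup>2) powr (- (\<sigma> - \<tau>) / 2)\<close> and \<open>(1 + \<xi>\<^sup>2) powr (\<sigma> / 2) |g|\<close>. The case \<open>\<tau> = 0\<close>
bounds the function, \<open>\<tau> = 1\<close> its derivative.\<close>

lemma sobolev_weighted_L1:
  assumes \<Lambda>: "\<Lambda> \<in> sobolev \<sigma>" and \<tau>: "\<sigma> - \<tau> > 1 / 2"
  shows "integrable lborel (\<lambda>\<xi>. (1 + \<xi>\<^sup>2) powr (\<tau> / 2) * cmod (distr_fourier \<Lambda> \<xi>))"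
    "(LINT \<xi>|lborel. (1 + \<xi>\<^sup>2) powr (\<tau> / 2) * cmod (distr_fourier \<Lambda> \<xi>)) \<le> embedding_const (\<sigma> - \<tau>) * sobolev_norm \<sigma> \<Lambda>"
proof -
  note D = sobolevD[OF \<Lambda>]
  note [measurable] = D(2)
  let ?a = "\<lambda>\<xi>::real. (1 + \<xi>\<^sup>2) powr (- (\<sigma> - \<tau>) / 2)"
  let ?b = "\<lambda>\<xi>. (1 + \<xi>\<^sup>2) powr (\<sigma> / 2) * cmod (distr_fourier \<Lambda> \<xi>)"
  have pos: "0 < 1 + \<xi>\<^sup>2" for \<xi> :: real by (simp add: add_pos_nonneg)
  have sq: "((1 + \<xi>\<^sup>2) powr (e / 2))\<^sup>2 = (1 + \<xi>\<^sup>2) powr e" for e \<xi> :: real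
    by (simp add: power2_eq_square flip: powr_add)
  have a2: "(?a \<xi>)\<^sup>2 = (1 + \<xi>\<^sup>2) powr - (\<sigma> - \<tau>)" for \<xi> by (rule sq)
  have b2: "(?b \<xi>)\<^sup>2 = (1 + \<xi>\<^sup>2) powr \<sigma> * (cmod (distr_fourier \<Lambda> \<xi>))\<^sup>2" for \<xi>
    unfolding power_mult_distrib sq ..
  have ab: "?a \<xi> * ?b \<xi> = (1 + \<xi>\<^sup>2) powr (\<tau> / 2) * cmod (distr_fourier \<Lambda> \<xi>)" for \<xi>
    using pos[of \<xi>] by (simp add: powr_add[symmetric] diff_divide_distrib flip: mult.assoc)
  have i: "integrable lborel (\<lambda>\<xi>. (?a \<xi>)\<^sup>2)" "integrable lborel (\<lambda>\<xi>. (?b \<xi>)\<^sup>2)"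
    unfolding a2 b2 using integrable_bracket[OF \<tau>] D(3) by auto
  have m: "?a \<in> borel_measurable lborel" "?b \<in> borel_measurable lborel" by measurable
  note L = L2_mult[OF m i]
  show "integrable lborel (\<lambda>\<xi>. (1 + \<xi>\<^sup>2) powr (\<tau> / 2) * cmod (distr_fourier \<Lambda> \<xi>))"
    using L(1) unfolding ab .
  show "(LINT \<xi>|lborel. (1 + \<xi>\<^sup>2) powr (\<tau> / 2) * cmod (distr_fourier \<Lambda> \<xi>)) \<le> embedding_const (\<sigma> - \<tau>) * sobolev_norm \<sigma> \<Lambda>"
    using L(2) unfolding ab a2 b2 embedding_const_def sobolev_norm_def by linarith
qed

lemma sobolev_fourier_L1:
  assumes \<Lambda>: "\<Lambda> \<in> sobolev \<sigma>" and \<sigma>: "\<sigma> > 1 / 2"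
  shows "integrable lborel (distr_fourier \<Lambda>)"
    "(LINT \<xi>|lborel. cmod (distr_fourier \<Lambda> \<xi>)) \<le> embedding_const \<sigma> * sobolev_norm \<sigma> \<Lambda>"
proof -
  have p: "(1 + \<xi>\<^sup>2) powr (0 / 2) = (1 :: real)" for \<xi> :: real
    using add_pos_nonneg[of 1 "\<xi>\<^sup>2"] by simp
  note L = sobolev_weighted_L1[OF \<Lambda>, of 0, unfolded p]
  show "integrable lborel (distr_fourier \<Lambda>)"
    using L(1) \<sigma> sobolevD(2)[OF \<Lambda>] by (simp add: integrable_norm_iff)
  show "(LINT \<xi>|lborel. cmod (distr_fourier \<Lambda> \<xi>)) \<le> embedding_const \<sigma> * sobolev_norm \<sigma> \<Lambda>"
    using L(2) \<sigma> by simp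
qed

lemma sobolev_fourier_L2:
  assumes \<Lambda>: "\<Lambda> \<in> sobolev \<sigma>" and \<sigma>: "\<sigma> \<ge> 0"
  shows "integrable lborel (\<lambda>\<xi>. (cmod (distr_fourier \<Lambda> \<xi>))\<^sup>2)"
    "(LINT \<xi>|lborel. (cmod (distr_fourier \<Lambda> \<xi>))\<^sup>2) \<le> (sobolev_norm \<sigma> \<Lambda>)\<^sup>2"
proof -
  note D = sobolevD[OF \<Lambda>]
  note [measurable] = D(2)
  have le: "(cmod (distr_fourier \<Lambda> \<xi>))\<^sup>2 \<le> (1 + \<xi>\<^sup>2) powr \<sigma> * (cmod (distr_fourier \<Lambda> \<xi>))\<^sup>2" for \<xi>
    using mult_right_mono[OF ge_one_powr_ge_zero[of "1 + \<xi>\<^sup>2" \<sigma>], of "(cmod (distr_fourier \<Lambda> \<xi>))\<^sup>2"] \<sigma> by simp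
  show i: "integrable lborel (\<lambda>\<xi>. (cmod (distr_fourier \<Lambda> \<xi>))\<^sup>2)"
    by (rule Bochner_Integration.integrable_bound[OF D(3)])
       (use le in \<open>auto intro!: AE_I2 intro: order.trans[OF le]\<close>)
  show "(LINT \<xi>|lborel. (cmod (distr_fourier \<Lambda> \<xi>))\<^sup>2) \<le> (sobolev_norm \<sigma> \<Lambda>)\<^sup>2"
    unfolding D(4) by (rule integral_mono[OF i D(3) le])
qed

lemma integrable_gauss_weight:
  fixes f :: "real \<Rightarrow> real"
  assumes f: "continuous_on UNIV f" "integrable lborel (\<lambda>x. (f x)\<^sup>2)"
  shows "integrable lborel (\<lambda>x. f x * exp (- (x\<^sup>2 / 2)))"
proof (rule L2_mult(1))
  have "integrable lborel (\<lambda>x::real. exp (- ((0 + sqrt 2 * x)\<^sup>2 / 2)))"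
    using lborel_integrable_real_affine[OF gauss_real_integral(1), of "sqrt 2" 0] by simp
  moreover have "(exp (- (x\<^sup>2 / 2)))\<^sup>2 = exp (- ((0 + sqrt 2 * x)\<^sup>2 / 2))" for x :: real
    by (simp add: power2_eq_square flip: exp_add)
  ultimately show "integrable lborel (\<lambda>x::real. (exp (- (x\<^sup>2 / 2)))\<^sup>2)" by simp
qed (use f in \<open>auto intro: borel_measurable_continuous_onI\<close>)

text \<open>A distribution in \<open>H\<^sup>\<sigma>\<close>, \<open>\<sigma> > 1/2\<close>, that acts on modulated Gaussians like a continuous square-integrable
function \<open>f\<close> controls \<open>f\<close> uniformly and in \<open>L\<^sup>2\<close>. This is how the norms in the notion of solution, which
belong to distributions, are turned into statements on functions.\<close>

lemma sobolev_representation: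
  fixes f :: "real \<Rightarrow> real"
  assumes \<Lambda>: "\<Lambda> \<in> sobolev \<sigma>" and \<sigma>: "\<sigma> > 1 / 2"
    and f: "continuous_on UNIV f" "integrable lborel (\<lambda>x. (f x)\<^sup>2)"
    and e: "\<And>b. \<Lambda> (mod_gauss b) = distr_of f (mod_gauss b)"
  shows "of_real (f x) = inv_fourier (distr_fourier \<Lambda>) x"
    and "\<bar>f x\<bar> \<le> embedding_const \<sigma> * sobolev_norm \<sigma> \<Lambda>"
    and "(LINT x|lborel. (f x)\<^sup>2) \<le> (sobolev_norm \<sigma> \<Lambda>)\<^sup>2"
proof -
  note L1 = sobolev_fourier_L1[OF \<Lambda> \<sigma>]
  have L2: "integrable lborel (\<lambda>\<xi>. (cmod (distr_fourier \<Lambda> \<xi>))\<^sup>2)"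
    "(LINT \<xi>|lborel. (cmod (distr_fourier \<Lambda> \<xi>))\<^sup>2) \<le> (sobolev_norm \<sigma> \<Lambda>)\<^sup>2"
    using sobolev_fourier_L2[OF \<Lambda>] \<sigma> by auto
  have r: "of_real (f x) = inv_fourier (distr_fourier \<Lambda>) x" for x
    by (rule fourier_inversion[OF f(1) integrable_gauss_weight[OF f] sobolevD(1)[OF \<Lambda>] L1(1) e])
  show "of_real (f x) = inv_fourier (distr_fourier \<Lambda>) x" by (rule r)
  have "\<bar>f x\<bar> = cmod (inv_fourier (distr_fourier \<Lambda>) x)"
    unfolding r[symmetric] by simp
  also have "\<dots> \<le> (LINT \<xi>|lborel. cmod (distr_fourier \<Lambda> \<xi>)) / sqrt (2 * pi)"
    by (rule inv_fourier_bound[OF L1(1)])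
  also have "\<dots> \<le> (LINT \<xi>|lborel. cmod (distr_fourier \<Lambda> \<xi>)) / 1"
    by (rule divide_left_mono) (use pi_ge_two in auto)
  finally show "\<bar>f x\<bar> \<le> embedding_const \<sigma> * sobolev_norm \<sigma> \<Lambda>"
    using L1(2) by simp
  show "(LINT x|lborel. (f x)\<^sup>2) \<le> (sobolev_norm \<sigma> \<Lambda>)\<^sup>2"
    using plancherel_le[OF L1(1) L2(1) r f(2)] L2(2) by linarith
qed

lemma sobolev_embedding_C1:
  fixes f :: "real \<Rightarrow> real"
  assumes \<Lambda>: "\<Lambda> \<in> sobolev \<sigma>" and \<sigma>: "\<sigma> > 3 / 2"
    and f: "continuous_on UNIV f" "integrable lborel (\<lambda>x. (f x)\<^sup>2)"
    and e: "\<And>b. \<Lambda> (mod_gauss b) = distr_of f (mod_gauss b)"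
  shows "(f has_real_derivative deriv f x) (at x)"
    and "continuous_on UNIV (deriv f)"
    and "\<bar>deriv f x\<bar> \<le> embedding_const (\<sigma> - 1) * sobolev_norm \<sigma> \<Lambda>"
proof -
  let ?g = "distr_fourier \<Lambda>"
  have \<sigma>': "\<sigma> > 1 / 2" using \<sigma> by simp
  note [measurable] = sobolevD(2)[OF \<Lambda>]
  note r = sobolev_representation(1)[OF \<Lambda> \<sigma>' f e]
  note g = sobolev_fourier_L1(1)[OF \<Lambda> \<sigma>']
  have w: "integrable lborel (\<lambda>\<xi>. (1 + \<xi>\<^sup>2) powr (1 / 2) * cmod (?g \<xi>))"
    "(LINT \<xi>|lborel. (1 + \<xi>\<^sup>2) powr (1 / 2) * cmod (?g \<xi>)) \<le> embedding_const (\<sigma> - 1) * sobolev_norm \<sigma> \<Lambda>"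
    using sobolev_weighted_L1[OF \<Lambda>, of 1] \<sigma> by auto
  have le: "cmod (of_real \<xi> * ?g \<xi>) \<le> (1 + \<xi>\<^sup>2) powr (1 / 2) * cmod (?g \<xi>)" for \<xi>
  proof -
    have "\<bar>\<xi>\<bar> \<le> sqrt (1 + \<xi>\<^sup>2)" by (rule real_le_rsqrt) simp
    moreover have "sqrt (1 + \<xi>\<^sup>2) = (1 + \<xi>\<^sup>2) powr (1 / 2)"
      by (simp add: powr_half_sqrt)
    ultimately show ?thesis by (simp add: norm_mult mult_right_mono)
  qed
  have i: "integrable lborel (\<lambda>\<xi>. of_real \<xi> * ?g \<xi>)"
    by (rule Bochner_Integration.integrable_bound[OF w(1)])
       (auto intro!: AE_I2 order.trans[OF le] simp: abs_mult)
  let ?h = "\<lambda>\<xi>. \<i> * of_real \<xi> * ?g \<xi>"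
  have h: "integrable lborel ?h" using i by (simp add: mult.assoc)
  have d: "(f has_real_derivative Re (inv_fourier ?h x)) (at x)" for x
  proof -
    have "((\<lambda>x. Re (inv_fourier ?g x)) has_vector_derivative Re (inv_fourier ?h x)) (at x)"
      by (rule bounded_linear.has_vector_derivative[OF bounded_linear_Re inv_fourier_deriv[OF g i]])
    moreover have "Re (inv_fourier ?g x) = f x" for x
      unfolding r[symmetric] by simp
    ultimately show ?thesis
      by (simp add: has_real_derivative_iff_has_vector_derivative)
  qed
  then have de: "deriv f x = Re (inv_fourier ?h x)" for x
    by (rule DERIV_imp_deriv)
  show "(f has_real_derivative deriv f x) (at x)" unfolding de by (rule d)
  show "continuous_on UNIV (deriv f)"
    unfolding de[abs_def] by (intro continuous_intros inv_fourier_continuous[OF h])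
  have "\<bar>deriv f x\<bar> \<le> cmod (inv_fourier ?h x)"
    unfolding de by (rule abs_Re_le_cmod)
  also have "\<dots> \<le> (LINT \<xi>|lborel. cmod (?h \<xi>)) / sqrt (2 * pi)"
    by (rule inv_fourier_bound[OF h])
  also have "\<dots> \<le> (LINT \<xi>|lborel. cmod (?h \<xi>)) / 1"
    by (rule divide_left_mono) (use pi_ge_two in auto)
  also have "\<dots> \<le> (LINT \<xi>|lborel. (1 + \<xi>\<^sup>2) powr (1 / 2) * cmod (?g \<xi>))"
    using integral_mono[OF integrable_norm[OF h] w(1)] le by (simp add: norm_mult)
  finally show "\<bar>deriv f x\<bar> \<le> embedding_const (\<sigma> - 1) * sobolev_norm \<sigma> \<Lambda>"
    using w(2) by simp
qed

lemma sobolev_diff: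
  assumes a: "\<Lambda> \<in> sobolev \<sigma>" and b: "\<Lambda>' \<in> sobolev \<sigma>"
  shows "(\<lambda>\<phi>. \<Lambda> \<phi> - \<Lambda>' \<phi>) \<in> sobolev \<sigma>"
proof -
  from a obtain g where g: "has_fourier \<Lambda> g" "integrable lborel (\<lambda>\<xi>. (1 + \<xi>\<^sup>2) powr \<sigma> * (cmod (g \<xi>))\<^sup>2)"
    unfolding sobolev_def by blast
  from b obtain h where h: "has_fourier \<Lambda>' h" "integrable lborel (\<lambda>\<xi>. (1 + \<xi>\<^sup>2) powr \<sigma> * (cmod (h \<xi>))\<^sup>2)"
    unfolding sobolev_def by blast
  have m[measurable]: "g \<in> borel_measurable borel" "h \<in> borel_measurable borel"
    using g(1) h(1) by (simp_all add: has_fourier_def)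
  have "has_fourier (\<lambda>\<phi>. \<Lambda> \<phi> - \<Lambda>' \<phi>) (\<lambda>\<xi>. g \<xi> - h \<xi>)"
    using g(1) h(1) unfolding has_fourier_def by (auto simp: left_diff_distrib)
  moreover have "integrable lborel (\<lambda>\<xi>. (1 + \<xi>\<^sup>2) powr \<sigma> * (cmod (g \<xi> - h \<xi>))\<^sup>2)"
  proof (rule Bochner_Integration.integrable_bound)
    show "integrable lborel (\<lambda>\<xi>. 2 * ((1 + \<xi>\<^sup>2) powr \<sigma> * (cmod (g \<xi>))\<^sup>2) + 2 * ((1 + \<xi>\<^sup>2) powr \<sigma> * (cmod (h \<xi>))\<^sup>2))"
      using g(2) h(2) by simp
    have "(1 + \<xi>\<^sup>2) powr \<sigma> * (cmod (g \<xi> - h \<xi>))\<^sup>2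
        \<le> 2 * ((1 + \<xi>\<^sup>2) powr \<sigma> * (cmod (g \<xi>))\<^sup>2) + 2 * ((1 + \<xi>\<^sup>2) powr \<sigma> * (cmod (h \<xi>))\<^sup>2)" for \<xi>
    proof -
      have "(cmod (g \<xi> - h \<xi>))\<^sup>2 \<le> (cmod (g \<xi>) + cmod (h \<xi>))\<^sup>2"
        by (intro power_mono norm_triangle_ineq4) auto
      also have "\<dots> \<le> 2 * (cmod (g \<xi>))\<^sup>2 + 2 * (cmod (h \<xi>))\<^sup>2"
        using zero_le_power2[of "cmod (g \<xi>) - cmod (h \<xi>)"] by (simp add: power2_sum power2_diff)
      finally have "(1 + \<xi>\<^sup>2) powr \<sigma> * (cmod (g \<xi> - h \<xi>))\<^sup>2
          \<le> (1 + \<xi>\<^sup>2) powr \<sigma> * (2 * (cmod (g \<xi>))\<^sup>2 + 2 * (cmod (h \<xi>))\<^sup>2)"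
        by (intro mult_left_mono) auto
      then show ?thesis by (simp add: algebra_simps)
    qed
    then show "AE \<xi> in lborel. norm ((1 + \<xi>\<^sup>2) powr \<sigma> * (cmod (g \<xi> - h \<xi>))\<^sup>2)
        \<le> norm (2 * ((1 + \<xi>\<^sup>2) powr \<sigma> * (cmod (g \<xi>))\<^sup>2) + 2 * ((1 + \<xi>\<^sup>2) powr \<sigma> * (cmod (h \<xi>))\<^sup>2))"
      by (intro AE_I2) (auto intro: order.trans[OF _ abs_ge_self])
  qed measurable
  ultimately show ?thesis unfolding sobolev_def by blast
qed

lemma sobolev_divide:
  assumes a: "\<Lambda> \<in> sobolev \<sigma>"
  shows "(\<lambda>\<phi>. \<Lambda> \<phi> / c) \<in> sobolev \<sigma>"
proof -
  from a obtain g where g: "has_fourier \<Lambda> g" "integrable lborel (\<lambda>\<xi>. (1 + \<xi>\<^sup>2) powr \<sigma> * (cmod (g \<xi>))\<^sup>2)"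
    unfolding sobolev_def by blast
  have "has_fourier (\<lambda>\<phi>. \<Lambda> \<phi> / c) (\<lambda>\<xi>. g \<xi> / c)"
    using g(1) unfolding has_fourier_def by auto
  moreover have "integrable lborel (\<lambda>\<xi>. (1 + \<xi>\<^sup>2) powr \<sigma> * (cmod (g \<xi> / c))\<^sup>2)"
    using integrable_divide[OF g(2), of "(cmod c)\<^sup>2"] by (simp add: norm_divide power_divide)
  ultimately show ?thesis unfolding sobolev_def by blast
qed

lemma distr_of_mod_gauss_integrable:
  assumes f: "continuous_on UNIV f" "integrable lborel (\<lambda>x. (f x)\<^sup>2)"
  shows "integrable lborel (\<lambda>x. of_real (f x) * mod_gauss b x)"
proof -
  have [measurable]: "f \<in> borel_measurable borel"
    using f(1) by (rule borel_measurable_continuous_onI)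
  have [measurable]: "mod_gauss b \<in> borel_measurable borel"
    unfolding mod_gauss_def[abs_def] by measurable
  show ?thesis
    by (rule Bochner_Integration.integrable_bound[OF integrable_gauss_weight[OF f]])
       (auto simp: norm_mult mod_gauss_def abs_mult)
qed

section \<open>The operator \<open>(1 - \<partial>\<^sub>x\<^sup>2)\<^sup>-\<^sup>1\<close> and \<open>P(D)\<close>\<close>

text \<open>The convolution with \<open>exp (- |x|) / 2\<close>, that is, \<open>(1 - \<partial>\<^sub>x\<^sup>2)\<^sup>-\<^sup>1 f\<close>; \<open>helm_x\<close> is its derivative.\<close>

definition helm :: "(real \<Rightarrow> real) \<Rightarrow> real \<Rightarrow> real" where
  "helm f x = (rexp 1 f x + lexp 1 f x) / 2"

definition helm_x :: "(real \<Rightarrow> real) \<Rightarrow> real \<Rightarrow> real" where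
  "helm_x f x = (rexp 1 f x - lexp 1 f x) / 2"

lemma helm_deriv:
  assumes "continuous_on UNIV f" "\<And>x. \<bar>f x\<bar> \<le> B"
  shows "(helm f has_real_derivative helm_x f x) (at x)"
    "(helm_x f has_real_derivative helm f x - f x) (at x)"
proof -
  note L = lexp_deriv[OF zero_less_one assms, of x] and R = rexp_deriv[OF zero_less_one assms, of x]
  show "(helm f has_real_derivative helm_x f x) (at x)"
    unfolding helm_def[abs_def]
    by (rule DERIV_cong[OF DERIV_cdivide[OF DERIV_add[OF R L]]]) (simp add: helm_x_def)
  show "(helm_x f has_real_derivative helm f x - f x) (at x)"
    unfolding helm_x_def[abs_def]
    by (rule DERIV_cong[OF DERIV_cdivide[OF DERIV_diff[OF R L]]]) (simp add: helm_def field_simps)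
qed

lemma helm_continuous:
  assumes "continuous_on UNIV f" "\<And>x. \<bar>f x\<bar> \<le> B"
  shows "continuous_on UNIV (helm f)" "continuous_on UNIV (helm_x f)"
  using lexp_rexp_continuous[OF zero_less_one assms] unfolding helm_def[abs_def] helm_x_def[abs_def]
  by (auto intro!: continuous_intros)

lemma helm_integrable:
  assumes "integrable lborel f"
  shows "integrable lborel (helm f)" "integrable lborel (helm_x f)"
  using lexp_L1(1)[OF zero_less_one assms] rexp_L1(1)[OF zero_less_one assms]
  unfolding helm_def[abs_def] helm_x_def[abs_def] by auto

lemma helm_x_bound:
  assumes "integrable lborel f"
  shows "\<bar>helm_x f x\<bar> \<le> (LINT y|lborel. \<bar>f y\<bar>) / 2"
  using rexp_lexp_diff_le_L1[OF zero_less_one assms, of x] by (simp add: helm_x_def)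

lemma integrable_square_of_bounded:
  fixes h :: "real \<Rightarrow> real"
  assumes h: "integrable lborel h" and b: "\<And>x. \<bar>h x\<bar> \<le> B"
  shows "integrable lborel (\<lambda>x. (h x)\<^sup>2)"
proof (rule Bochner_Integration.integrable_bound)
  show "integrable lborel (\<lambda>x. B * \<bar>h x\<bar>)" using h by simp
  show "(\<lambda>x. (h x)\<^sup>2) \<in> borel_measurable lborel"
    using h by (intro borel_measurable_power) auto
  have "(h x)\<^sup>2 \<le> B * \<bar>h x\<bar>" for x
    using mult_right_mono[OF b[of x], of "\<bar>h x\<bar>"] by (simp add: power2_eq_square flip: abs_mult)
  then show "AE x in lborel. norm ((h x)\<^sup>2) \<le> norm (B * \<bar>h x\<bar>)"
    by (intro AE_I2) (metis abs_ge_self abs_of_nonneg order_trans real_norm_def zero_le_power2)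
qed

text \<open>Integration by parts: the derivative of \<open>p x cis (- x \<xi>)\<close> has integral \<open>0\<close>.\<close>

lemma fourier_derivative:
  fixes p p' :: "real \<Rightarrow> real"
  assumes d: "\<And>x. (p has_real_derivative p' x) (at x)"
    and c: "continuous_on UNIV p'" and p: "integrable lborel p" and p': "integrable lborel p'"
  shows "fourier (\<lambda>x. of_real (p' x)) \<xi> = \<i> * of_real \<xi> * fourier (\<lambda>x. of_real (p x)) \<xi>"
proof -
  have cp: "continuous_on UNIV p"
    using d by (intro DERIV_continuous_on) (auto intro: has_field_derivative_at_within)
  let ?e = "\<lambda>x. cis (- (x * \<xi>))"
  have de: "((\<lambda>x. ?e x * of_real (p x)) has_vector_derivative
      ?e x * of_real (p' x) - \<i> * of_real \<xi> * (?e x * of_real (p x))) (at x)" for x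
  proof -
    have "((\<lambda>w. exp (- (\<i> * of_real \<xi> * w))) has_field_derivative - (\<i> * of_real \<xi>) * exp (- (\<i> * of_real \<xi> * of_real x)))
        (at (of_real x))"
      by (auto intro!: derivative_eq_intros)
    from has_vector_derivative_real_field[OF this]
    have e: "(?e has_vector_derivative - (\<i> * of_real \<xi>) * ?e x) (at x)"
      by (simp add: cis_conv_exp mult_ac)
    have "((\<lambda>x. complex_of_real (p x)) has_vector_derivative of_real (p' x)) (at x)"
      using d[of x] by (intro has_vector_derivative_of_real) (simp add: has_real_derivative_iff_has_vector_derivative)
    from has_vector_derivative_mult[OF e this] show ?thesis
      by (simp add: mult_ac add.commute)
  qed
  note i = integrable_cis_mult(2)[OF integrable_of_real[OF p, where 'a = complex], of \<xi>]
    integrable_cis_mult(2)[OF integrable_of_real[OF p', where 'a = complex], of \<xi>]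
  have "(LINT x|lborel. ?e x * of_real (p' x) - \<i> * of_real \<xi> * (?e x * of_real (p x))) = 0"
  proof (rule integral_derivative_eq_0[OF de])
    show "continuous_on UNIV (\<lambda>x. ?e x * of_real (p' x) - \<i> * of_real \<xi> * (?e x * of_real (p x)))"
      by (intro continuous_intros c cp)
  qed (use i in auto)
  then show ?thesis
    using i by (simp add: fourier_def)
qed

lemma fourier_helm:
  assumes f: "continuous_on UNIV f" "\<And>x. \<bar>f x\<bar> \<le> B" and fi: "integrable lborel f"
  shows "fourier (\<lambda>x. of_real (helm f x)) \<xi> = of_real (1 / (1 + \<xi>\<^sup>2)) * fourier (\<lambda>x. of_real (f x)) \<xi>"
proof -
  note d = helm_deriv[OF f] and c = helm_continuous[OF f] and i = helm_integrable[OF fi]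
  let ?F = "\<lambda>h. fourier (\<lambda>x. complex_of_real (h x)) \<xi>"
  have 1: "?F (helm_x f) = \<i> * of_real \<xi> * ?F (helm f)"
    by (rule fourier_derivative[OF d(1) c(2) i])
  have 2: "?F (\<lambda>x. helm f x - f x) = \<i> * of_real \<xi> * ?F (helm_x f)"
    by (rule fourier_derivative[OF d(2) _ i(2)]) (use i fi c f in \<open>auto intro!: continuous_intros\<close>)
  have "?F (\<lambda>x. helm f x - f x) = ?F (helm f) - ?F f"
    using integrable_cis_mult(2)[OF integrable_of_real[OF i(1), where 'a = complex], of \<xi>]
      integrable_cis_mult(2)[OF integrable_of_real[OF fi, where 'a = complex], of \<xi>]
    by (simp add: fourier_def right_diff_distrib diff_divide_distrib)
  moreover have "\<i> * of_real \<xi> * (\<i> * of_real \<xi> * X) = - (of_real (\<xi>\<^sup>2) * X)" for X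
  proof -
    have "\<i> * of_real \<xi> * (\<i> * of_real \<xi> * X) = (\<i> * \<i>) * (of_real (\<xi> * \<xi>) * X)"
      by (simp only: of_real_mult mult_ac)
    then show ?thesis by (simp add: power2_eq_square)
  qed
  ultimately have "?F (helm f) - ?F f = - (of_real (\<xi>\<^sup>2) * ?F (helm f))"
    using 1 2 by metis
  then have A: "?F f = of_real (1 + \<xi>\<^sup>2) * ?F (helm f)"
    by (simp add: algebra_simps)
  have B: "of_real (1 / (1 + \<xi>\<^sup>2)) * (of_real (1 + \<xi>\<^sup>2) * X) = X" for X :: complex
    using add_pos_nonneg[of 1 "\<xi>\<^sup>2"]
    unfolding mult.assoc[symmetric] of_real_mult[symmetric] by simp
  show ?thesis unfolding A B ..
qed

text \<open>The multiplier \<open>1 / (1 + \<xi>\<^sup>2)\<close> applied to the transform of \<open>f\<close> is the transform of \<open>p = helm f\<close>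
(\<open>fourier_helm\<close>) and is integrable, so \<open>p\<close> is its inverse transform; it remains to
move the derivative from the test function to \<open>p\<close>.\<close>

lemma P_D_distr_of:
  assumes f: "continuous_on UNIV f" "\<And>x. \<bar>f x\<bar> \<le> B" and fi: "integrable lborel f" and \<phi>: "\<phi> \<in> schwartz"
  shows "P_D (distr_of f) \<phi> = - distr_of (helm_x f) \<phi>"
proof -
  note d = helm_deriv[OF f] and c = helm_continuous[OF f] and i = helm_integrable[OF fi]
  let ?\<phi>' = "\<lambda>x. vector_derivative \<phi> (at x)"
  let ?p = "fourier (\<lambda>x. complex_of_real (helm f x))"
  note Fp = has_fourier_distr_of[OF i(1)]
  note Ff = has_fourier_distr_of[OF fi]
  have \<phi>': "?\<phi>' \<in> schwartz" by (rule schwartz_deriv[OF \<phi>])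
  note bmc = borel_measurable_continuous_onI
  note [measurable] = bmc[OF c(1)] bmc[OF c(2)] bmc[OF Ff(2)] bmc[OF schwartz_continuous[OF \<phi>]]
    bmc[OF schwartz_continuous[OF \<phi>']] bmc[OF inv_fourier_continuous[OF schwartz_integrable[OF \<phi>']]]
  have ip: "integrable lborel ?p"
  proof (rule Bochner_Integration.integrable_bound)
    show "integrable lborel (\<lambda>\<xi>::real. inverse (1 + \<xi>\<^sup>2) * ((LINT x|lborel. \<bar>f x\<bar>) / sqrt (2 * pi)))"
      using integrable_inverse_1_plus by simp
    show "?p \<in> borel_measurable lborel"
      using Fp(2) by (simp add: borel_measurable_continuous_onI)
    have "cmod (?p \<xi>) \<le> inverse (1 + \<xi>\<^sup>2) * ((LINT x|lborel. \<bar>f x\<bar>) / sqrt (2 * pi))" for \<xi>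
      unfolding fourier_helm[OF f fi] norm_mult norm_of_real
      using Ff(3)[of \<xi>] by (intro mult_mono) (auto simp: inverse_eq_divide)
    then show "AE \<xi> in lborel. norm (?p \<xi>) \<le> norm (inverse (1 + \<xi>\<^sup>2) * ((LINT x|lborel. \<bar>f x\<bar>) / sqrt (2 * pi)))"
      by (intro AE_I2) (metis abs_ge_self order_trans real_norm_def)
  qed
  have gi: "integrable lborel (\<lambda>x. helm f x * exp (- (x\<^sup>2 / 2)))"
    by (rule Bochner_Integration.integrable_bound[OF i(1)]) (auto simp: abs_mult mult_right_le_one_le)
  have inv: "of_real (helm f x) = inv_fourier ?p x" for x
    by (rule fourier_inversion[OF c(1) gi Fp(1) ip]) simp
  have "P_D (distr_of f) \<phi> = fourier_multiplier (\<lambda>\<xi>. complex_of_real (1 / (1 + \<xi>\<^sup>2))) (distr_of f) ?\<phi>'"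
    by (simp add: P_D_def distr_deriv_def)
  also have "\<dots> = (LINT \<xi>|lborel. ?p \<xi> * inv_fourier ?\<phi>' \<xi>)"
    unfolding fourier_multiplier_def
  proof (rule integral_cong_AE)
    have [measurable]: "distr_fourier (distr_of f) \<in> borel_measurable borel"
      using has_fourier_distr_fourier(1)[OF Ff(1)] by (simp add: has_fourier_def)
    show "(\<lambda>\<xi>. complex_of_real (1 / (1 + \<xi>\<^sup>2)) * distr_fourier (distr_of f) \<xi> * inv_fourier ?\<phi>' \<xi>) \<in> borel_measurable lborel"
      by measurable
    show "(\<lambda>\<xi>. ?p \<xi> * inv_fourier ?\<phi>' \<xi>) \<in> borel_measurable lborel"
      using ip by measurable
    show "AE \<xi> in lborel. complex_of_real (1 / (1 + \<xi>\<^sup>2)) * distr_fourier (distr_of f) \<xi> * inv_fourier ?\<phi>' \<xi>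
        = ?p \<xi> * inv_fourier ?\<phi>' \<xi>"
      using has_fourier_distr_fourier(2)[OF Ff(1)] by eventually_elim (simp add: fourier_helm[OF f fi])
  qed
  also have "\<dots> = (LINT x|lborel. of_real (helm f x) * ?\<phi>' x)"
    using inv_fourier_duality(1)[OF ip schwartz_integrable[OF \<phi>']] unfolding inv[symmetric] .
  also have "\<dots> = - (LINT x|lborel. of_real (helm_x f x) * \<phi> x)"
  proof -
    have bd: "integrable lborel (\<lambda>x. complex_of_real (h x) * \<psi> x)"
      if h: "integrable lborel h" and \<psi>: "\<psi> \<in> schwartz" for h \<psi>
    proof -
      obtain C where C: "\<And>x. norm (\<psi> x) \<le> C"
        using schwartz_bounded[OF \<psi>] by (auto simp: bounded_iff)
      have [measurable]: "h \<in> borel_measurable borel" "\<psi> \<in> borel_measurable borel"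
        using h schwartz_continuous[OF \<psi>] by (auto intro: borel_measurable_continuous_onI)
      show ?thesis
      proof (rule Bochner_Integration.integrable_bound)
        show "integrable lborel (\<lambda>x. h x * C)" using h by simp
        show "AE x in lborel. cmod (complex_of_real (h x) * \<psi> x) \<le> norm (h x * C)"
          unfolding norm_mult norm_of_real real_norm_def abs_mult
          by (intro AE_I2 mult_left_mono order.trans[OF C abs_ge_self]) auto
      qed measurable
    qed
    have D: "((\<lambda>x. complex_of_real (helm f x) * \<phi> x) has_vector_derivative
        of_real (helm f x) * ?\<phi>' x + of_real (helm_x f x) * \<phi> x) (at x)" for x
    proof -
      have "((\<lambda>x. complex_of_real (helm f x)) has_vector_derivative of_real (helm_x f x)) (at x)"
        using d(1)[of x] by (intro has_vector_derivative_of_real) (simp add: has_real_derivative_iff_has_vector_derivative)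
      from has_vector_derivative_mult[OF this schwartz_has_deriv[OF \<phi>]] show ?thesis .
    qed
    have "(LINT x|lborel. of_real (helm f x) * ?\<phi>' x + of_real (helm_x f x) * \<phi> x) = 0"
    proof (rule integral_derivative_eq_0[OF D])
      show "continuous_on UNIV (\<lambda>x. of_real (helm f x) * ?\<phi>' x + of_real (helm_x f x) * \<phi> x)"
        by (intro continuous_intros c schwartz_continuous \<phi> \<phi>')
    qed (use bd i \<phi> \<phi>' in auto)
    then show ?thesis
      using bd[OF i(1) \<phi>'] bd[OF i(2) \<phi>] by (simp add: add_eq_0_iff)
  qed
  finally show ?thesis by (simp add: distr_of_def)
qed

section \<open>Time regularity of solutions\<close>

text \<open>The value of \<open>u\<^sub>t = - u u\<^sub>x - p\<^sub>x\<close> for \<open>u = v\<close> and \<open>\<rho> = \<eta>\<close>.\<close>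

definition dp2_velocity :: "real \<Rightarrow> (real \<Rightarrow> real) \<Rightarrow> (real \<Rightarrow> real) \<Rightarrow> real \<Rightarrow> real" where
  "dp2_velocity c v \<eta> x = - (v x * deriv v x) - helm_x (\<lambda>y. 3 / 2 * (v y)\<^sup>2 + c / 2 * (\<eta> y)\<^sup>2) x"

lemma sobolev_fun_bounded:
  assumes "f \<in> sobolev_fun \<sigma>" "\<sigma> > 1 / 2"
  shows "continuous_on UNIV f" "integrable lborel (\<lambda>x. (f x)\<^sup>2)"
    "\<bar>f x\<bar> \<le> embedding_const \<sigma> * sobolev_norm \<sigma> (distr_of f)"
  using assms sobolev_representation(2)[of "distr_of f" \<sigma> f x]
  by (auto simp: sobolev_fun_def)

lemma sobolev_fun_C1:
  assumes "f \<in> sobolev_fun \<sigma>" "\<sigma> > 3 / 2"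
  shows "(f has_real_derivative deriv f x) (at x)" "continuous_on UNIV (deriv f)"
    "\<bar>deriv f x\<bar> \<le> embedding_const (\<sigma> - 1) * sobolev_norm \<sigma> (distr_of f)"
proof -
  have f: "distr_of f \<in> sobolev \<sigma>" "continuous_on UNIV f" "integrable lborel (\<lambda>x. (f x)\<^sup>2)"
    using assms(1) by (auto simp: sobolev_fun_def)
  note S = sobolev_embedding_C1[OF f(1) assms(2) f(2,3) refl]
  show "(f has_real_derivative deriv f x) (at x)" "continuous_on UNIV (deriv f)"
    "\<bar>deriv f x\<bar> \<le> embedding_const (\<sigma> - 1) * sobolev_norm \<sigma> (distr_of f)"
    by (rule S)+
qed

lemma dp2_flux:
  fixes v \<eta> :: "real \<Rightarrow> real" and c :: real
  assumes v: "continuous_on UNIV v" "integrable lborel (\<lambda>x. (v x)\<^sup>2)" "\<And>x. \<bar>v x\<bar> \<le> B"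
    and \<eta>: "continuous_on UNIV \<eta>" "integrable lborel (\<lambda>x. (\<eta> x)\<^sup>2)" "\<And>x. \<bar>\<eta> x\<bar> \<le> R"
  shows "continuous_on UNIV (\<lambda>y. 3 / 2 * (v y)\<^sup>2 + c / 2 * (\<eta> y)\<^sup>2)"
    "integrable lborel (\<lambda>y. 3 / 2 * (v y)\<^sup>2 + c / 2 * (\<eta> y)\<^sup>2)"
    "\<bar>3 / 2 * (v x)\<^sup>2 + c / 2 * (\<eta> x)\<^sup>2\<bar> \<le> 3 / 2 * B\<^sup>2 + \<bar>c\<bar> / 2 * R\<^sup>2"
proof -
  show "continuous_on UNIV (\<lambda>y. 3 / 2 * (v y)\<^sup>2 + c / 2 * (\<eta> y)\<^sup>2)"
    by (intro continuous_intros v \<eta>)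
  show "integrable lborel (\<lambda>y. 3 / 2 * (v y)\<^sup>2 + c / 2 * (\<eta> y)\<^sup>2)"
    using v \<eta> by simp
  have "(v x)\<^sup>2 \<le> B\<^sup>2" "(\<eta> x)\<^sup>2 \<le> R\<^sup>2"
    using power_mono[OF v(3)[of x], of 2] power_mono[OF \<eta>(3)[of x], of 2] by simp_all
  moreover from this have "\<bar>c / 2 * (\<eta> x)\<^sup>2\<bar> \<le> \<bar>c\<bar> / 2 * R\<^sup>2"
    by (auto simp: abs_mult intro!: mult_left_mono divide_right_mono)
  ultimately show "\<bar>3 / 2 * (v x)\<^sup>2 + c / 2 * (\<eta> x)\<^sup>2\<bar> \<le> 3 / 2 * B\<^sup>2 + \<bar>c\<bar> / 2 * R\<^sup>2"
    using abs_triangle_ineq[of "3 / 2 * (v x)\<^sup>2" "c / 2 * (\<eta> x)\<^sup>2"] by simp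
qed

lemma dp2_velocity_regular:
  assumes v: "v \<in> sobolev_fun s" and \<eta>: "\<eta> \<in> sobolev_fun (s - 1)" and s: "s > 3 / 2"
  shows "continuous_on UNIV (dp2_velocity c v \<eta>)"
    "integrable lborel (\<lambda>x. (dp2_velocity c v \<eta> x)\<^sup>2)"
proof -
  have "s > 1 / 2" "s - 1 > 1 / 2" using s by auto
  note V = sobolev_fun_bounded[OF v this(1)] and V' = sobolev_fun_C1[OF v s]
    and R = sobolev_fun_bounded[OF \<eta> this(2)]
  let ?f = "\<lambda>y. 3 / 2 * (v y)\<^sup>2 + c / 2 * (\<eta> y)\<^sup>2"
  note F = dp2_flux[OF V R, where c = c]
  have cu: "continuous_on UNIV (\<lambda>x. v x * deriv v x)"
    by (intro continuous_intros V V')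
  have ch: "continuous_on UNIV (helm_x ?f)"
    by (rule helm_continuous(2)[OF F(1,3)])
  show c: "continuous_on UNIV (dp2_velocity c v \<eta>)"
    unfolding dp2_velocity_def[abs_def] by (intro continuous_intros cu ch)
  let ?L = "embedding_const (s - 1) * sobolev_norm s (distr_of v)"
  have L0: "0 \<le> ?L" using V'(3)[of 0] by linarith
  have u2: "integrable lborel (\<lambda>x. (v x * deriv v x)\<^sup>2)"
  proof (rule Bochner_Integration.integrable_bound)
    show "integrable lborel (\<lambda>x. ?L\<^sup>2 * (v x)\<^sup>2)" using V by simp
    show "(\<lambda>x. (v x * deriv v x)\<^sup>2) \<in> borel_measurable lborel"
      using borel_measurable_continuous_onI[OF cu] by simp
    have "(v x * deriv v x)\<^sup>2 \<le> ?L\<^sup>2 * (v x)\<^sup>2" for x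
      using power_mono[OF V'(3)[of x], of 2] by (simp add: power_mult_distrib mult.commute mult_left_mono)
    then show "AE x in lborel. norm ((v x * deriv v x)\<^sup>2) \<le> norm (?L\<^sup>2 * (v x)\<^sup>2)"
      by (intro AE_I2) (simp add: abs_mult)
  qed
  have h2: "integrable lborel (\<lambda>x. (helm_x ?f x)\<^sup>2)"
    by (rule integrable_square_of_bounded[OF helm_integrable(2)[OF F(2)] helm_x_bound[OF F(2)]])
  show "integrable lborel (\<lambda>x. (dp2_velocity c v \<eta> x)\<^sup>2)"
  proof (rule Bochner_Integration.integrable_bound)
    show "integrable lborel (\<lambda>x. 2 * (v x * deriv v x)\<^sup>2 + 2 * (helm_x ?f x)\<^sup>2)"
      using u2 h2 by simp
    show "(\<lambda>x. (dp2_velocity c v \<eta> x)\<^sup>2) \<in> borel_measurable lborel"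
      using borel_measurable_continuous_onI[OF c] by simp
    have "(- a - b)\<^sup>2 \<le> 2 * a\<^sup>2 + 2 * b\<^sup>2" for a b :: real
      using zero_le_power2[of "a - b"] by (simp add: power2_eq_square algebra_simps)
    then have "(dp2_velocity c v \<eta> x)\<^sup>2 \<le> 2 * (v x * deriv v x)\<^sup>2 + 2 * (helm_x ?f x)\<^sup>2" for x
      unfolding dp2_velocity_def .
    then show "AE x in lborel. norm ((dp2_velocity c v \<eta> x)\<^sup>2) \<le> norm (2 * (v x * deriv v x)\<^sup>2 + 2 * (helm_x ?f x)\<^sup>2)"
      by (intro AE_I2) simp
  qed
qed

lemma integrable_square_diff:
  fixes f g :: "real \<Rightarrow> real"
  assumes f: "continuous_on UNIV f" "integrable lborel (\<lambda>x. (f x)\<^sup>2)"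
    and g: "continuous_on UNIV g" "integrable lborel (\<lambda>x. (g x)\<^sup>2)"
  shows "integrable lborel (\<lambda>x. (f x - g x)\<^sup>2)"
proof (rule Bochner_Integration.integrable_bound)
  show "integrable lborel (\<lambda>x. 2 * (f x)\<^sup>2 + 2 * (g x)\<^sup>2)" using f g by simp
  have "continuous_on UNIV (\<lambda>x. (f x - g x)\<^sup>2)" by (intro continuous_intros f g)
  then show "(\<lambda>x. (f x - g x)\<^sup>2) \<in> borel_measurable lborel"
    using borel_measurable_continuous_onI by simp
  have "(a - b)\<^sup>2 \<le> 2 * a\<^sup>2 + 2 * b\<^sup>2" for a b :: real
    using zero_le_power2[of "a + b"] by (simp add: power2_eq_square algebra_simps)
  then show "AE x in lborel. norm ((f x - g x)\<^sup>2) \<le> norm (2 * (f x)\<^sup>2 + 2 * (g x)\<^sup>2)"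
    by (intro AE_I2) simp
qed

lemma distr_of_diff:
  assumes f: "continuous_on UNIV f" "integrable lborel (\<lambda>x. (f x)\<^sup>2)"
    and g: "continuous_on UNIV g" "integrable lborel (\<lambda>x. (g x)\<^sup>2)"
  shows "distr_of (\<lambda>x. f x - g x) (mod_gauss b) = distr_of f (mod_gauss b) - distr_of g (mod_gauss b)"
  unfolding distr_of_def
  using distr_of_mod_gauss_integrable[OF f, of b] distr_of_mod_gauss_integrable[OF g, of b]
  by (simp add: left_diff_distrib)

lemma distr_of_divide:
  "distr_of (\<lambda>x. f x / k) \<phi> = distr_of f \<phi> / complex_of_real k"
  unfolding distr_of_def by (simp flip: integral_divide_zero)

lemma dp2_solution_deriv_continuous_in_time:
  assumes s: "s > 3 / 2" and sol: "dp2_solution c s u0 \<rho>0 T u \<rho>" and t: "t \<in> time_interval T"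
  shows "\<exists>e. (e \<longlongrightarrow> 0) (at t within time_interval T) \<and>
    (\<forall>r\<in>time_interval T. \<forall>x. \<bar>deriv (u r) x - deriv (u t) x\<bar> \<le> e r)"
proof (intro exI conjI ballI allI)
  let ?N = "\<lambda>r. sobolev_norm s (\<lambda>\<phi>. distr_of (u r) \<phi> - distr_of (u t) \<phi>)"
  have "(?N \<longlongrightarrow> 0) (at t within time_interval T)"
    using sol t unfolding dp2_solution_def sobolev_C0_def by blast
  then show "((\<lambda>r. embedding_const (s - 1) * ?N r) \<longlongrightarrow> 0) (at t within time_interval T)"
    by (rule tendsto_mult_right_zero)
  fix r x assume r: "r \<in> time_interval T"
  have m: "u r \<in> sobolev_fun s" "u t \<in> sobolev_fun s"
    using sol t r unfolding dp2_solution_def by blast+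
  have m': "continuous_on UNIV (u r)" "integrable lborel (\<lambda>x. (u r x)\<^sup>2)" "distr_of (u r) \<in> sobolev s"
    "continuous_on UNIV (u t)" "integrable lborel (\<lambda>x. (u t x)\<^sup>2)" "distr_of (u t) \<in> sobolev s"
    using m by (simp_all add: sobolev_fun_def)
  have c: "continuous_on UNIV (\<lambda>x. u r x - u t x)"
    by (intro continuous_intros m')
  have "\<bar>deriv (\<lambda>x. u r x - u t x) x\<bar> \<le> embedding_const (s - 1) * ?N r"
    by (rule sobolev_embedding_C1(3)[OF sobolev_diff[OF m'(3,6)] s c integrable_square_diff[OF m'(1,2,4,5)]])
       (rule distr_of_diff[OF m'(1,2,4,5), symmetric])
  moreover have "deriv (\<lambda>x. u r x - u t x) x = deriv (u r) x - deriv (u t) x"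
    by (intro DERIV_imp_deriv DERIV_diff sobolev_fun_C1(1)[OF m(1) s] sobolev_fun_C1(1)[OF m(2) s])
  ultimately show "\<bar>deriv (u r) x - deriv (u t) x\<bar> \<le> embedding_const (s - 1) * ?N r" by simp
qed

text \<open>The equation identifies the distribution \<open>u\<^sub>t\<close> with the function \<^const>\<open>dp2_velocity\<close> on Gaussians. Hence the
distribution whose norm in \<open>H\<^bsup>s-1\<^esup>\<close> tends to \<open>0\<close> is represented by the difference quotient minus the
velocity, and the embedding applies because \<open>s - 1 > 1/2\<close>. A single function \<open>e\<close> bounds both the
uniform and the \<open>L\<^sup>2\<close> distance.\<close>

lemma dp2_solution_time_derivative:
  assumes s: "s > 3 / 2" and sol: "dp2_solution c s u0 \<rho>0 T u \<rho>" and t: "t \<in> time_interval T"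
  shows "\<exists>e. (e \<longlongrightarrow> 0) (at t within time_interval T) \<and>
    (\<forall>r\<in>time_interval T. r \<noteq> t \<longrightarrow>
      (\<forall>x. \<bar>(u r x - u t x) / (r - t) - dp2_velocity c (u t) (\<rho> t) x\<bar> \<le> e r) \<and>
      integrable lborel (\<lambda>x. ((u r x - u t x) / (r - t) - dp2_velocity c (u t) (\<rho> t) x)\<^sup>2) \<and>
      sqrt (LINT x|lborel. ((u r x - u t x) / (r - t) - dp2_velocity c (u t) (\<rho> t) x)\<^sup>2) \<le> e r)"
proof -
  let ?I = "time_interval T"
  from sol obtain ut where C1: "sobolev_C1 (s - 1) ?I (\<lambda>t. distr_of (u t)) ut"
    and pde: "\<And>t. t \<in> ?I \<Longrightarrow> distr_eq (\<lambda>\<phi>. ut t \<phi> + distr_of (\<lambda>x. u t x * deriv (u t) x) \<phi>)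
             (P_D (distr_of (\<lambda>x. 3 / 2 * (u t x)\<^sup>2 + c / 2 * (\<rho> t x)\<^sup>2)))"
    unfolding dp2_solution_def by blast
  have mem: "u r \<in> sobolev_fun s" "\<rho> r \<in> sobolev_fun (s - 1)" if "r \<in> ?I" for r
    using sol that unfolding dp2_solution_def by blast+
  have s1: "s > 1 / 2" "s - 1 > 1 / 2" using s by auto
  let ?H = "dp2_velocity c (u t) (\<rho> t)"
  note Hreg = dp2_velocity_regular[OF mem[OF t] s, where c = c]
  note U = sobolev_fun_bounded[OF mem(1)[OF t] s1(1)] and U' = sobolev_fun_C1[OF mem(1)[OF t] s]
    and R = sobolev_fun_bounded[OF mem(2)[OF t] s1(2)]
  let ?f = "\<lambda>y. 3 / 2 * (u t y)\<^sup>2 + c / 2 * (\<rho> t y)\<^sup>2"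
  note F = dp2_flux[OF U R, where c = c]
  have utH: "ut t (mod_gauss b) = distr_of ?H (mod_gauss b)" for b
  proof -
    have ii: "integrable lborel (\<lambda>x. complex_of_real (g x) * mod_gauss b x)"
      if "continuous_on UNIV g" "\<And>x. \<bar>g x\<bar> \<le> B" for g B
    proof -
      have [measurable]: "g \<in> borel_measurable borel"
        using that(1) by (rule borel_measurable_continuous_onI)
      have gi: "integrable lborel (mod_gauss b)"
        by (rule schwartz_integrable[OF mod_gauss_schwartz])
      then have [measurable]: "mod_gauss b \<in> borel_measurable borel" by auto
      show ?thesis
      proof (rule Bochner_Integration.integrable_bound)
        show "integrable lborel (\<lambda>x. complex_of_real B * mod_gauss b x)" using gi by simp
        show "AE x in lborel. norm (complex_of_real (g x) * mod_gauss b x) \<le> norm (complex_of_real B * mod_gauss b x)"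
          unfolding norm_mult norm_of_real
          by (intro AE_I2 mult_right_mono order.trans[OF that(2) abs_ge_self]) auto
      qed measurable
    qed
    have cu: "continuous_on UNIV (\<lambda>x. u t x * deriv (u t) x)"
      by (intro continuous_intros U U')
    have bu: "\<bar>u t x * deriv (u t) x\<bar> \<le> (embedding_const s * sobolev_norm s (distr_of (u t))) *
        (embedding_const (s - 1) * sobolev_norm s (distr_of (u t)))" for x
      unfolding abs_mult by (intro mult_mono U(3) U'(3) order.trans[OF abs_ge_zero U(3)]) auto
    note i1 = ii[OF cu bu] and i2 = ii[OF helm_continuous(2)[OF F(1,3)] helm_x_bound[OF F(2)]]
    have "ut t (mod_gauss b) + distr_of (\<lambda>x. u t x * deriv (u t) x) (mod_gauss b)
        = P_D (distr_of ?f) (mod_gauss b)"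
      using pde[OF t] mod_gauss_schwartz[of b] unfolding distr_eq_def by simp
    also have "\<dots> = - distr_of (helm_x ?f) (mod_gauss b)"
      by (rule P_D_distr_of[OF F(1,3,2) mod_gauss_schwartz])
    finally have "ut t (mod_gauss b) = - distr_of (helm_x ?f) (mod_gauss b) - distr_of (\<lambda>x. u t x * deriv (u t) x) (mod_gauss b)"
      by (rule add_implies_diff)
    also have "\<dots> = distr_of ?H (mod_gauss b)"
    proof -
      have "distr_of ?H (mod_gauss b) = (LINT x|lborel. - (complex_of_real (u t x * deriv (u t) x) * mod_gauss b x)
          - complex_of_real (helm_x ?f x) * mod_gauss b x)"
        unfolding distr_of_def dp2_velocity_def
        by (intro Bochner_Integration.integral_cong) (auto simp: algebra_simps)
      also have "\<dots> = - distr_of (\<lambda>x. u t x * deriv (u t) x) (mod_gauss b) - distr_of (helm_x ?f) (mod_gauss b)"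
        unfolding distr_of_def using i1 i2 by simp
      finally show ?thesis by simp
    qed
    finally show ?thesis .
  qed
  let ?\<Lambda> = "\<lambda>r \<phi>. (distr_of (u r) \<phi> - distr_of (u t) \<phi>) / complex_of_real (r - t) - ut t \<phi>"
  let ?N = "\<lambda>r. sobolev_norm (s - 1) (?\<Lambda> r)"
  let ?C = "embedding_const (s - 1) + 1"
  have N: "(?N \<longlongrightarrow> 0) (at t within ?I)"
    using C1 t unfolding sobolev_C1_def by blast
  have sob: "distr_of (u r) \<in> sobolev (s - 1)" "ut r \<in> sobolev (s - 1)" if "r \<in> ?I" for r
    using C1 that unfolding sobolev_C1_def sobolev_C0_def by blast+
  show ?thesis
  proof (intro exI conjI ballI allI impI)
    show "((\<lambda>r. ?C * ?N r) \<longlongrightarrow> 0) (at t within ?I)"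
      by (rule tendsto_mult_right_zero[OF N])
    fix r assume r: "r \<in> ?I" and rt: "r \<noteq> t"
    note Ur = sobolev_fun_bounded[OF mem(1)[OF r] s1(1)]
    let ?d = "\<lambda>x. (u r x - u t x) / (r - t)"
    have d: "continuous_on UNIV ?d" "integrable lborel (\<lambda>x. (?d x)\<^sup>2)"
      using integrable_square_diff[OF Ur(1,2) U(1,2)] rt
      by (auto intro!: continuous_intros Ur U simp: power_divide)
    have g: "continuous_on UNIV (\<lambda>x. ?d x - ?H x)" "integrable lborel (\<lambda>x. (?d x - ?H x)\<^sup>2)"
      using integrable_square_diff[OF d Hreg] by (auto intro!: continuous_on_diff d Hreg)
    have \<Lambda>: "?\<Lambda> r \<in> sobolev (s - 1)"
      by (intro sobolev_diff sobolev_divide sob r t)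
    have e: "?\<Lambda> r (mod_gauss b) = distr_of (\<lambda>x. ?d x - ?H x) (mod_gauss b)" for b
      unfolding distr_of_diff[OF d Hreg] distr_of_divide distr_of_diff[OF Ur(1,2) U(1,2)] utH ..
    note rep = sobolev_representation[OF \<Lambda> s1(2) g e]
    have N0: "0 \<le> ?N r" by (rule sobolevD(5)[OF \<Lambda>])
    show "\<bar>?d x - ?H x\<bar> \<le> ?C * ?N r" for x
      using rep(2)[of x] N0 by (simp add: distrib_right)
    show "integrable lborel (\<lambda>x. (?d x - ?H x)\<^sup>2)" by (rule g(2))
    have "sqrt (LINT x|lborel. (?d x - ?H x)\<^sup>2) \<le> ?N r"
      by (rule real_le_lsqrt) (use rep(3) N0 in auto)
    also have "\<dots> \<le> ?C * ?N r"
      using N0 embedding_const_nonneg[of "s - 1"] by (simp add: distrib_right)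
    finally show "sqrt (LINT x|lborel. (?d x - ?H x)\<^sup>2) \<le> ?C * ?N r" .
  qed
qed

section \<open>Inner products and the operator \<open>(4 - \<partial>\<^sub>x\<^sup>2)\<^sup>-\<^sup>1\<close>\<close>

text \<open>The counterpart of \<open>lexp_adjoint\<close> for two square-integrable functions; the product kernel is now dominated
by \<open>a\<^sup>2 + b\<^sup>2\<close>.\<close>

lemma lexp_adjoint_L2:
  assumes k: "\<kappa> > 0" and [measurable]: "f \<in> borel_measurable borel" "n \<in> borel_measurable borel"
    and f2: "integrable lborel (\<lambda>x. (f x)\<^sup>2)" and n2: "integrable lborel (\<lambda>x. (n x)\<^sup>2)"
  shows "(LINT x|lborel. lexp \<kappa> f x * n x) = (LINT x|lborel. f x * rexp \<kappa> n x)"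
proof -
  let ?k = "\<lambda>z. indicator {0..} z * exp (- (\<kappa> * z)) :: real"
  have young: "\<bar>a * b\<bar> \<le> a\<^sup>2 + b\<^sup>2" for a b :: real
  proof -
    have "0 \<le> (\<bar>a\<bar> - \<bar>b\<bar>)\<^sup>2" by simp
    then have "2 * \<bar>a * b\<bar> \<le> a\<^sup>2 + b\<^sup>2"
      by (simp add: power2_diff abs_mult)
    then show ?thesis using abs_ge_zero[of "a * b"] by linarith
  qed
  have dom: "integrable (lborel \<Otimes>\<^sub>M lborel) (\<lambda>(z, x). ?k z * (a (x - \<sigma> * z) * b x))"
    if [measurable]: "a \<in> borel_measurable borel" "b \<in> borel_measurable borel"
      and a: "integrable lborel (\<lambda>x. (a x)\<^sup>2)" and b: "integrable lborel (\<lambda>x. (b x)\<^sup>2)"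
    for a b :: "real \<Rightarrow> real" and \<sigma>
  proof (rule Bochner_Integration.integrable_bound)
    show "integrable (lborel \<Otimes>\<^sub>M lborel) (\<lambda>p. (case p of (z, x) \<Rightarrow> ?k z * (a (x - \<sigma> * z))\<^sup>2)
        + (case p of (z, x) \<Rightarrow> ?k z * (b x)\<^sup>2))"
      by (rule Bochner_Integration.integrable_add[OF integrable_pair_shift[OF exp_kernel(1)[OF k] a]
            integrable_pair_mult[OF exp_kernel(1)[OF k] b]])
    have "norm (?k z * (a (x - \<sigma> * z) * b x)) \<le> norm (?k z * (a (x - \<sigma> * z))\<^sup>2 + ?k z * (b x)\<^sup>2)" for z x
    proof -
      have "norm (?k z * (a (x - \<sigma> * z) * b x)) = ?k z * \<bar>a (x - \<sigma> * z) * b x\<bar>"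
        by (simp add: abs_mult)
      also have "\<dots> \<le> ?k z * ((a (x - \<sigma> * z))\<^sup>2 + (b x)\<^sup>2)"
        by (intro mult_left_mono young) simp
      also have "\<dots> \<le> norm (?k z * (a (x - \<sigma> * z))\<^sup>2 + ?k z * (b x)\<^sup>2)"
        by (simp add: distrib_left)
      finally show ?thesis .
    qed
    then show "AE p in lborel \<Otimes>\<^sub>M lborel. norm (case p of (z, x) \<Rightarrow> ?k z * (a (x - \<sigma> * z) * b x))
        \<le> norm ((case p of (z, x) \<Rightarrow> ?k z * (a (x - \<sigma> * z))\<^sup>2) + (case p of (z, x) \<Rightarrow> ?k z * (b x)\<^sup>2))"
      unfolding case_prod_unfold by (intro AE_I2)
  qed measurable
  have int1: "integrable (lborel \<Otimes>\<^sub>M lborel) (\<lambda>(z, x). ?k z * (f (x - z) * n x))"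
    using dom[of f n 1] f2 n2 by simp
  have int2: "integrable (lborel \<Otimes>\<^sub>M lborel) (\<lambda>(z, x). ?k z * (n (x + z) * f x))"
    using dom[of n f "-1"] f2 n2 by simp
  have l: "lexp \<kappa> f x * n x = (LINT z|lborel. ?k z * (f (x - z) * n x))" for x
    unfolding lexp_def by (simp add: mult.assoc flip: integral_mult_left_zero)
  have r: "f x * rexp \<kappa> n x = (LINT z|lborel. ?k z * (n (x + z) * f x))" for x
    unfolding rexp_eq by (subst mult.commute) (simp add: mult.assoc flip: integral_mult_left_zero)
  have s: "(LINT x|lborel. ?k z * (f (x - z) * n x)) = (LINT x|lborel. ?k z * (n (x + z) * f x))" for z
    using lborel_integral_real_affine[of 1 "\<lambda>x. ?k z * (f (x - z) * n x)" z] by (simp add: add.commute mult.commute)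
  show ?thesis
    unfolding l r
    by (simp only: lborel_pair.Fubini_integral[OF int1] lborel_pair.Fubini_integral[OF int2] s)
qed

lemma rexp_adjoint:
  assumes k: "\<kappa> > 0" and f: "integrable lborel f"
    and [measurable]: "n \<in> borel_measurable borel" and b: "\<And>x. \<bar>n x\<bar> \<le> B"
  shows "integrable lborel (\<lambda>x. rexp \<kappa> f x * n x)" "integrable lborel (\<lambda>x. f x * lexp \<kappa> n x)"
    "(LINT x|lborel. rexp \<kappa> f x * n x) = (LINT x|lborel. f x * lexp \<kappa> n x)"
proof -
  have m: "(\<lambda>x. n (- x)) \<in> borel_measurable borel" by measurable
  note A = lexp_adjoint[OF k integrable_translate(7)[OF f] m b]
  have 1: "lexp \<kappa> (\<lambda>x. f (- x)) (- x) * n (- (- x)) = rexp \<kappa> f x * n x" for x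
    by (simp add: rexp_def)
  have 2: "f (- (- x)) * rexp \<kappa> (\<lambda>x. n (- x)) (- x) = f x * lexp \<kappa> n x" for x
    by (simp add: rexp_def)
  show "integrable lborel (\<lambda>x. rexp \<kappa> f x * n x)" "integrable lborel (\<lambda>x. f x * lexp \<kappa> n x)"
    using integrable_translate(7)[OF A(1)] integrable_translate(7)[OF A(2)] unfolding 1 2 .
  show "(LINT x|lborel. rexp \<kappa> f x * n x) = (LINT x|lborel. f x * lexp \<kappa> n x)"
    using integrable_translate(8)[OF A(1)] integrable_translate(8)[OF A(2)] A(3) unfolding 1 2 by simp
qed

text \<open>The class of functions on which the spatial operators act: it contains \<open>u\<close>, \<open>\<rho>\<close> and \<open>u\<^sub>t\<close> at each fixed
time and is stable under linear combinations and exponential averages.\<close>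

definition tame :: "(real \<Rightarrow> real) \<Rightarrow> bool" where
  "tame w \<longleftrightarrow> continuous_on UNIV w \<and> bounded (range w) \<and> integrable lborel (\<lambda>x. (w x)\<^sup>2)"

lemma tameD:
  assumes "tame w"
  shows "continuous_on UNIV w" "w \<in> borel_measurable borel" "integrable lborel (\<lambda>x. (w x)\<^sup>2)"
    "\<exists>B. \<forall>x. \<bar>w x\<bar> \<le> B"
  using assms borel_measurable_continuous_onI[of w] unfolding tame_def by (auto simp: bounded_iff)

lemma tameI:
  assumes "continuous_on UNIV w" "\<And>x. \<bar>w x\<bar> \<le> B" "integrable lborel (\<lambda>x. (w x)\<^sup>2)"
  shows "tame w"
  using assms unfolding tame_def by (auto simp: bounded_iff)

definition L2ip :: "(real \<Rightarrow> real) \<Rightarrow> (real \<Rightarrow> real) \<Rightarrow> real" where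
  "L2ip a b = (LINT x|lborel. a x * b x)"

lemma tame_mult:
  assumes "tame a" "tame b"
  shows "integrable lborel (\<lambda>x. a x * b x)" "\<bar>L2ip a b\<bar> \<le> L2_norm a * L2_norm b"
  using L2_mult[of a lborel b] tameD[OF assms(1)] tameD[OF assms(2)]
  by (simp_all add: L2_norm_def L2ip_def)

lemma tame_diff:
  assumes a: "tame a" and b: "tame b"
  shows "tame (\<lambda>x. a x - k * b x)"
proof -
  obtain A B where AB: "\<And>x. \<bar>a x\<bar> \<le> A" "\<And>x. \<bar>b x\<bar> \<le> B"
    using tameD(4)[OF a] tameD(4)[OF b] by blast
  show ?thesis
  proof (rule tameI)
    show "continuous_on UNIV (\<lambda>x. a x - k * b x)"
      by (intro continuous_intros tameD(1) a b)
    show "\<bar>a x - k * b x\<bar> \<le> A + \<bar>k\<bar> * B" for x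
      using AB(1)[of x] mult_left_mono[OF AB(2)[of x], of "\<bar>k\<bar>"] abs_triangle_ineq4[of "a x" "k * b x"]
      by (simp add: abs_mult)
    show "integrable lborel (\<lambda>x. (a x - k * b x)\<^sup>2)"
      by (rule integrable_square_diff)
         (use tameD[OF a] tameD[OF b] in \<open>auto intro!: continuous_intros simp: power_mult_distrib\<close>)
  qed
qed

lemma tame_lexp_rexp:
  assumes w: "tame w" and k: "\<kappa> > 0"
  shows "tame (lexp \<kappa> w)" "L2_norm (lexp \<kappa> w) \<le> L2_norm w / \<kappa>"
    "tame (rexp \<kappa> w)" "L2_norm (rexp \<kappa> w) \<le> L2_norm w / \<kappa>"
proof -
  obtain B where B: "\<And>x. \<bar>w x\<bar> \<le> B" using tameD(4)[OF w] by blast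
  note L = lexp_L2[OF k tameD(1)[OF w] B tameD(3)[OF w]] and R = rexp_L2[OF k tameD(1)[OF w] B tameD(3)[OF w]]
  have q: "sqrt (X / \<kappa>\<^sup>2) = sqrt X / \<kappa>" for X
    using k by (simp add: real_sqrt_divide)
  show "tame (lexp \<kappa> w)" "tame (rexp \<kappa> w)"
    using lexp_rexp_continuous[OF k tameD(1)[OF w] B] lexp_bound[OF k tameD(2)[OF w] B]
      rexp_bound[OF k tameD(2)[OF w] B] L(1) R(1) by (auto intro!: tameI)
  show "L2_norm (lexp \<kappa> w) \<le> L2_norm w / \<kappa>" "L2_norm (rexp \<kappa> w) \<le> L2_norm w / \<kappa>"
    using real_sqrt_le_mono[OF L(2)] real_sqrt_le_mono[OF R(2)] unfolding L2_norm_def q by auto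
qed

lemma lexp_rexp_linear:
  assumes k: "\<kappa> > 0" and a: "tame a" and b: "tame b"
  shows "lexp \<kappa> (\<lambda>x. a x - r * b x) x = lexp \<kappa> a x - r * lexp \<kappa> b x"
    "rexp \<kappa> (\<lambda>x. a x - r * b x) x = rexp \<kappa> a x - r * rexp \<kappa> b x"
proof -
  have L: "lexp \<kappa> (\<lambda>x. a x - r * b x) x = lexp \<kappa> a x - r * lexp \<kappa> b x"
    if [measurable]: "a \<in> borel_measurable borel" "b \<in> borel_measurable borel"
      and AB: "\<And>x. \<bar>a x\<bar> \<le> A" "\<And>x. \<bar>b x\<bar> \<le> B" for a b x A B
  proof -
    note i = lexp_integrable[OF k that(1) AB(1), of x] lexp_integrable[OF k that(2) AB(2), of x]
    have "lexp \<kappa> (\<lambda>x. a x - r * b x) x = (LINT z|lborel. indicator {0..} z * exp (- (\<kappa> * z)) * a (x - z)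
        - r * (indicator {0..} z * exp (- (\<kappa> * z)) * b (x - z)))"
      unfolding lexp_def by (intro Bochner_Integration.integral_cong) (auto simp: algebra_simps)
    then show ?thesis using i unfolding lexp_def by simp
  qed
  obtain A B where AB: "\<And>x. \<bar>a x\<bar> \<le> A" "\<And>x. \<bar>b x\<bar> \<le> B"
    using tameD(4)[OF a] tameD(4)[OF b] by blast
  note m[measurable] = tameD(2)[OF a] tameD(2)[OF b]
  show "lexp \<kappa> (\<lambda>x. a x - r * b x) x = lexp \<kappa> a x - r * lexp \<kappa> b x"
    by (rule L[OF m AB])
  show "rexp \<kappa> (\<lambda>x. a x - r * b x) x = rexp \<kappa> a x - r * rexp \<kappa> b x"
    unfolding rexp_def by (rule L[where A = A and B = B]) (use AB in auto)
qed

text \<open>The product rule. With \<open>k = r - t\<close>, \<open>a r = a t + k (a' + A)\<close> and \<open>b r = b t + k (b' + B)\<close>, where \<open>A\<close> and \<open>B\<close> are small in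
\<open>L\<^sup>2\<close>, expand the product and estimate each inner product by Cauchy-Schwarz.\<close>

lemma L2ip_has_derivative:
  assumes t: "t \<in> I" and ab: "\<And>r. r \<in> I \<Longrightarrow> tame (a r)" "\<And>r. r \<in> I \<Longrightarrow> tame (b r)"
    and ab': "tame a'" "tame b'" and e: "(e \<longlongrightarrow> 0) (at t within I)"
    and ea: "\<And>r. r \<in> I \<Longrightarrow> r \<noteq> t \<Longrightarrow> L2_norm (\<lambda>x. (a r x - a t x) / (r - t) - a' x) \<le> e r"
    and eb: "\<And>r. r \<in> I \<Longrightarrow> r \<noteq> t \<Longrightarrow> L2_norm (\<lambda>x. (b r x - b t x) / (r - t) - b' x) \<le> e r"
  shows "((\<lambda>r. L2ip (a r) (b r)) has_real_derivative L2ip a' (b t) + L2ip (a t) b') (at t within I)"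
proof -
  have n0: "0 \<le> L2_norm w" for w by (simp add: L2_norm_def)
  let ?E = "\<lambda>r. e r * L2_norm (b t) + L2_norm (a t) * e r + \<bar>r - t\<bar> * (L2_norm a' + e r) * (L2_norm b' + e r)"
  have "((\<lambda>r. ?E r) \<longlongrightarrow> 0 * L2_norm (b t) + L2_norm (a t) * 0 + \<bar>t - t\<bar> * (L2_norm a' + 0) * (L2_norm b' + 0)) (at t within I)"
    by (intro tendsto_intros e)
  then have E0: "(?E \<longlongrightarrow> 0) (at t within I)" by simp
  have est: "\<bar>(L2ip (a r) (b r) - L2ip (a t) (b t)) / (r - t) - (L2ip a' (b t) + L2ip (a t) b')\<bar> \<le> ?E r"
    if r: "r \<in> I" "r \<noteq> t" for r
  proof -
    let ?k = "r - t"
    have k: "?k \<noteq> 0" using r by simp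
    define A where "A x = (a r x - a t x) / ?k - a' x" for x
    define B where "B x = (b r x - b t x) / ?k - b' x" for x
    have tameA: "tame A"
    proof -
      have "tame (\<lambda>x. (1 / ?k * a r x - 1 / ?k * a t x) - 1 * a' x)"
      proof (rule tame_diff[OF _ ab'(1)])
        have "tame (\<lambda>x. - (- 1 / ?k) * a r x)"
          using tame_diff[OF tame_diff[OF ab(1)[OF r(1)] ab(1)[OF r(1)], of 1] ab(1)[OF r(1)], of "- 1 / ?k"] by simp
        then show "tame (\<lambda>x. 1 / ?k * a r x - 1 / ?k * a t x)"
          by (intro tame_diff ab(1) t) simp
      qed
      then show ?thesis unfolding A_def by (simp add: diff_divide_distrib)
    qed
    have tameB: "tame B"
    proof -
      have "tame (\<lambda>x. (1 / ?k * b r x - 1 / ?k * b t x) - 1 * b' x)"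
      proof (rule tame_diff[OF _ ab'(2)])
        have "tame (\<lambda>x. - (- 1 / ?k) * b r x)"
          using tame_diff[OF tame_diff[OF ab(2)[OF r(1)] ab(2)[OF r(1)], of 1] ab(2)[OF r(1)], of "- 1 / ?k"] by simp
        then show "tame (\<lambda>x. 1 / ?k * b r x - 1 / ?k * b t x)"
          by (intro tame_diff ab(2) t) simp
      qed
      then show ?thesis unfolding B_def by (simp add: diff_divide_distrib)
    qed
    have eA: "L2_norm A \<le> e r" and eB: "L2_norm B \<le> e r"
      using ea[OF r] eb[OF r] by (simp_all add: A_def[abs_def] B_def[abs_def])
    have ar: "a r x = a t x + ?k * (a' x + A x)" and br: "b r x = b t x + ?k * (b' x + B x)" for x
      using k by (simp_all add: A_def B_def)
    have prod: "a r x * b r x = a t x * b t x + ?k * (a' x * b t x) + ?k * (A x * b t x) + ?k * (a t x * b' x)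
        + ?k * (a t x * B x) + ?k\<^sup>2 * (a' x * b' x) + ?k\<^sup>2 * (a' x * B x) + ?k\<^sup>2 * (A x * b' x) + ?k\<^sup>2 * (A x * B x)" for x
      unfolding ar br by (simp add: algebra_simps power2_eq_square)
    note T = ab(1)[OF t] ab(2)[OF t] ab' tameA tameB
    note i = tame_mult(1)[OF T(1) T(2)] tame_mult(1)[OF T(3) T(2)] tame_mult(1)[OF T(5) T(2)]
      tame_mult(1)[OF T(1) T(4)] tame_mult(1)[OF T(1) T(6)] tame_mult(1)[OF T(3) T(4)]
      tame_mult(1)[OF T(3) T(6)] tame_mult(1)[OF T(5) T(4)] tame_mult(1)[OF T(5) T(6)]
    have "L2ip (a r) (b r) = L2ip (a t) (b t) + ?k * L2ip a' (b t) + ?k * L2ip A (b t) + ?k * L2ip (a t) b'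
        + ?k * L2ip (a t) B + ?k\<^sup>2 * L2ip a' b' + ?k\<^sup>2 * L2ip a' B + ?k\<^sup>2 * L2ip A b' + ?k\<^sup>2 * L2ip A B"
      unfolding L2ip_def prod using i by simp
    then have eq: "(L2ip (a r) (b r) - L2ip (a t) (b t)) / ?k - (L2ip a' (b t) + L2ip (a t) b')
        = L2ip A (b t) + L2ip (a t) B + ?k * (L2ip a' b' + L2ip a' B + L2ip A b' + L2ip A B)"
      using k by (simp add: field_simps power2_eq_square)
    have 1: "\<bar>L2ip A (b t)\<bar> \<le> e r * L2_norm (b t)"
      using tame_mult(2)[OF T(5,2)] mult_right_mono[OF eA n0[of "b t"]] by linarith
    have 2: "\<bar>L2ip (a t) B\<bar> \<le> L2_norm (a t) * e r"
      using tame_mult(2)[OF T(1,6)] mult_left_mono[OF eB n0[of "a t"]] by linarith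
    have 3: "\<bar>L2ip a' b' + L2ip a' B + L2ip A b' + L2ip A B\<bar> \<le> (L2_norm a' + e r) * (L2_norm b' + e r)"
    proof -
      have e0: "0 \<le> e r" using eA n0[of A] by linarith
      have "\<bar>L2ip a' b' + L2ip a' B + L2ip A b' + L2ip A B\<bar>
          \<le> L2_norm a' * L2_norm b' + L2_norm a' * L2_norm B + L2_norm A * L2_norm b' + L2_norm A * L2_norm B"
        using tame_mult(2)[OF T(3,4)] tame_mult(2)[OF T(3,6)] tame_mult(2)[OF T(5,4)] tame_mult(2)[OF T(5,6)]
        by linarith
      also have "\<dots> = (L2_norm a' + L2_norm A) * (L2_norm b' + L2_norm B)"
        by (simp add: algebra_simps)
      also have "\<dots> \<le> (L2_norm a' + e r) * (L2_norm b' + e r)"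
        using eA eB e0 n0 by (intro mult_mono add_mono) auto
      finally show ?thesis .
    qed
    have "\<bar>?k * (L2ip a' b' + L2ip a' B + L2ip A b' + L2ip A B)\<bar> \<le> \<bar>?k\<bar> * (L2_norm a' + e r) * (L2_norm b' + e r)"
      using mult_left_mono[OF 3, of "\<bar>?k\<bar>"] by (simp add: abs_mult mult.assoc)
    with 1 2 show ?thesis unfolding eq by linarith
  qed
  have "((\<lambda>r. (L2ip (a r) (b r) - L2ip (a t) (b t)) / (r - t) - (L2ip a' (b t) + L2ip (a t) b')) \<longlongrightarrow> 0) (at t within I)"
    by (rule Lim_null_comparison[OF _ E0]) (auto simp: eventually_at_filter est)
  then show ?thesis
    unfolding has_field_derivative_iff by (rule Lim_null[THEN iffD2])
qed

text \<open>The convolution with \<open>exp (- 2 |x|) / 4\<close>, that is, \<open>(4 - \<partial>\<^sub>x\<^sup>2)\<^sup>-\<^sup>1 w\<close>; \<open>helm4_x\<close> is its derivative.\<close>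

definition helm4 :: "(real \<Rightarrow> real) \<Rightarrow> real \<Rightarrow> real" where
  "helm4 w x = (rexp 2 w x + lexp 2 w x) / 4"

definition helm4_x :: "(real \<Rightarrow> real) \<Rightarrow> real \<Rightarrow> real" where
  "helm4_x w x = (rexp 2 w x - lexp 2 w x) / 2"

lemma tame_cmult: "tame a \<Longrightarrow> tame (\<lambda>x. k * a x)"
  using tame_diff[OF tame_diff[of a a 1], of a "- k"] by simp

lemma tame_helm4:
  assumes w: "tame w"
  shows "tame (helm4 w)" "tame (helm4_x w)"
proof -
  note T = tame_lexp_rexp(1,3)[OF w, of 2, simplified]
  have e: "helm4 w = (\<lambda>x. 1 / 4 * rexp 2 w x - (- 1 / 4) * lexp 2 w x)"
    "helm4_x w = (\<lambda>x. 1 / 2 * rexp 2 w x - (1 / 2) * lexp 2 w x)"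
    by (auto simp: helm4_def helm4_x_def)
  show "tame (helm4 w)" "tame (helm4_x w)"
    unfolding e by (rule tame_diff[OF tame_cmult[OF T(2)] T(1)])+
qed

lemma helm4_deriv:
  assumes w: "tame w"
  shows "(helm4 w has_real_derivative helm4_x w x) (at x)"
    "(helm4_x w has_real_derivative 4 * helm4 w x - w x) (at x)"
proof -
  obtain B where B: "\<And>x. \<bar>w x\<bar> \<le> B" using tameD(4)[OF w] by blast
  note L = lexp_deriv[OF zero_less_numeral tameD(1)[OF w] B, where x = x]
    and R = rexp_deriv[OF zero_less_numeral tameD(1)[OF w] B, where x = x]
  show "(helm4 w has_real_derivative helm4_x w x) (at x)"
    unfolding helm4_def[abs_def]
    by (rule DERIV_cong[OF DERIV_cdivide[OF DERIV_add[OF R L]]]) (simp add: helm4_x_def)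
  show "(helm4_x w has_real_derivative 4 * helm4 w x - w x) (at x)"
    unfolding helm4_x_def[abs_def]
    by (rule DERIV_cong[OF DERIV_cdivide[OF DERIV_diff[OF R L]]]) (simp add: helm4_def field_simps)
qed

text \<open>From \<open>w = 4 h - h''\<close> for \<open>h = helm4 w\<close>, integration by parts gives \<open>\<integral> w h = \<integral> h'\<^sup>2 + 4 \<integral> h\<^sup>2\<close>. The upper bounds
reflect that the kernel has mass \<open>1/4\<close>.\<close>

lemma helm4_inner_bounds:
  assumes w: "tame w"
  shows "4 * (L2_norm (helm4 w))\<^sup>2 \<le> L2ip w (helm4 w)" "L2ip w (helm4 w) \<le> (L2_norm w)\<^sup>2 / 4"
    "L2_norm (helm4 w) \<le> L2_norm w / 4"
proof -
  note T = tame_helm4[OF w] and d = helm4_deriv[OF w]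
  have ddv: "((\<lambda>x. helm4 w x * helm4_x w x) has_vector_derivative
      (helm4_x w x)\<^sup>2 + helm4 w x * (4 * helm4 w x - w x)) (at x)" for x
    using DERIV_mult[OF d, of x]
    by (simp add: has_real_derivative_iff_has_vector_derivative power2_eq_square algebra_simps)
  note i = tameD(3)[OF T(1)] tameD(3)[OF T(2)] tame_mult(1)[OF T] tame_mult(1)[OF w T(1)]
  have e: "(helm4_x w x)\<^sup>2 + helm4 w x * (4 * helm4 w x - w x)
      = (helm4_x w x)\<^sup>2 + 4 * (helm4 w x)\<^sup>2 - w x * helm4 w x" for x
    by (simp add: power2_eq_square algebra_simps)
  have "(LINT x|lborel. (helm4_x w x)\<^sup>2 + helm4 w x * (4 * helm4 w x - w x)) = 0"
  proof (rule integral_derivative_eq_0[OF ddv])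
    show "continuous_on UNIV (\<lambda>x. (helm4_x w x)\<^sup>2 + helm4 w x * (4 * helm4 w x - w x))"
      by (intro continuous_intros tameD(1) T w)
    show "integrable lborel (\<lambda>x. (helm4_x w x)\<^sup>2 + helm4 w x * (4 * helm4 w x - w x))"
      unfolding e using i by auto
  qed (rule i(3))
  then have "L2ip w (helm4 w) = (LINT x|lborel. (helm4_x w x)\<^sup>2) + 4 * (LINT x|lborel. (helm4 w x)\<^sup>2)"
    unfolding e L2ip_def using i by simp
  then show lower: "4 * (L2_norm (helm4 w))\<^sup>2 \<le> L2ip w (helm4 w)"
    by (simp add: L2_norm_def)
  show "L2_norm (helm4 w) \<le> L2_norm w / 4"
  proof (rule ccontr)
    assume a: "\<not> L2_norm (helm4 w) \<le> L2_norm w / 4"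
    have "0 \<le> L2_norm w" by (simp add: L2_norm_def)
    with a have p: "0 < L2_norm (helm4 w)" by linarith
    have "4 * (L2_norm (helm4 w))\<^sup>2 \<le> L2_norm w * L2_norm (helm4 w)"
      using lower tame_mult(2)[OF w T(1)] by linarith
    with p have "4 * L2_norm (helm4 w) \<le> L2_norm w"
      by (simp add: power2_eq_square)
    with a show False by simp
  qed
  note R = tame_lexp_rexp[OF w zero_less_numeral[of "num.Bit0 num.One"]]
  have n0: "0 \<le> L2_norm w" by (simp add: L2_norm_def)
  have j: "integrable lborel (\<lambda>x. w x * rexp 2 w x)" "integrable lborel (\<lambda>x. w x * lexp 2 w x)"
    by (rule tame_mult(1)[OF w R(3)], rule tame_mult(1)[OF w R(1)])
  have "L2ip w (helm4 w) = (LINT x|lborel. (w x * rexp 2 w x + w x * lexp 2 w x) / 4)"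
    unfolding L2ip_def helm4_def by (intro Bochner_Integration.integral_cong) (auto simp: algebra_simps)
  also have "\<dots> = (L2ip w (rexp 2 w) + L2ip w (lexp 2 w)) / 4"
    unfolding L2ip_def using j by simp
  also have "\<dots> \<le> (L2_norm w * (L2_norm w / 2) + L2_norm w * (L2_norm w / 2)) / 4"
  proof (rule divide_right_mono[OF add_mono])
    show "L2ip w (rexp 2 w) \<le> L2_norm w * (L2_norm w / 2)"
      by (rule order.trans[OF abs_ge_self order.trans[OF tame_mult(2)[OF w R(3)] mult_left_mono[OF R(4) n0]]])
    show "L2ip w (lexp 2 w) \<le> L2_norm w * (L2_norm w / 2)"
      by (rule order.trans[OF abs_ge_self order.trans[OF tame_mult(2)[OF w R(1)] mult_left_mono[OF R(2) n0]]])
  qed simp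
  finally show "L2ip w (helm4 w) \<le> (L2_norm w)\<^sup>2 / 4"
    by (simp add: power2_eq_square)
qed

lemma helm4_symmetric:
  assumes a: "tame a" and b: "tame b"
  shows "L2ip a (helm4 b) = L2ip (helm4 a) b"
proof -
  note A = tame_lexp_rexp(1,3)[OF a, of 2, simplified] and B = tame_lexp_rexp(1,3)[OF b, of 2, simplified]
  have "L2ip a (helm4 b) = (L2ip a (rexp 2 b) + L2ip a (lexp 2 b)) / 4"
  proof -
    have "L2ip a (helm4 b) = (LINT x|lborel. (a x * rexp 2 b x + a x * lexp 2 b x) / 4)"
      unfolding L2ip_def helm4_def by (intro Bochner_Integration.integral_cong) (auto simp: algebra_simps)
    then show ?thesis unfolding L2ip_def using tame_mult(1)[OF a B(1)] tame_mult(1)[OF a B(2)] by simp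
  qed
  moreover have "L2ip (helm4 a) b = (L2ip (rexp 2 a) b + L2ip (lexp 2 a) b) / 4"
  proof -
    have "L2ip (helm4 a) b = (LINT x|lborel. (rexp 2 a x * b x + lexp 2 a x * b x) / 4)"
      unfolding L2ip_def helm4_def by (intro Bochner_Integration.integral_cong) (auto simp: algebra_simps)
    then show ?thesis unfolding L2ip_def using tame_mult(1)[OF A(1) b] tame_mult(1)[OF A(2) b] by simp
  qed
  moreover have "L2ip (lexp 2 a) b = L2ip a (rexp 2 b)"
    unfolding L2ip_def by (rule lexp_adjoint_L2) (use tameD[OF a] tameD[OF b] in auto)
  moreover have "L2ip (lexp 2 b) a = L2ip b (rexp 2 a)"
    unfolding L2ip_def by (rule lexp_adjoint_L2) (use tameD[OF a] tameD[OF b] in auto)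
  moreover have "L2ip x y = L2ip y x" for x y
    by (simp add: L2ip_def mult.commute)
  ultimately show ?thesis by simp
qed

section \<open>The energy identity\<close>

lemma helm4_linear:
  assumes a: "tame a" and b: "tame b"
  shows "helm4 (\<lambda>x. a x - r * b x) x = helm4 a x - r * helm4 b x"
  using lexp_rexp_linear[OF zero_less_numeral a b, of "num.Bit0 num.One" r x]
  by (simp add: helm4_def field_simps)

lemma helm4_diff_quotient:
  assumes a: "tame a" and b: "tame b" and h: "tame h"
  shows "helm4 (\<lambda>x. (a x - b x) / k - h x) x = (helm4 a x - helm4 b x) / k - helm4 h x"
    and "tame (\<lambda>x. (a x - b x) / k - h x)"
proof -
  have ab: "tame (\<lambda>x. a x - 1 * b x)" by (rule tame_diff[OF a b])
  have abk: "tame (\<lambda>x. (1 / k) * (a x - 1 * b x))" by (rule tame_cmult[OF ab])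
  have e: "(\<lambda>x. (a x - b x) / k - h x) = (\<lambda>x. (1 / k) * (a x - 1 * b x) - 1 * h x)"
    by auto
  show "tame (\<lambda>x. (a x - b x) / k - h x)" unfolding e by (rule tame_diff[OF abk h])
  have "helm4 (\<lambda>x. (1 / k) * (a x - 1 * b x)) x = (1 / k) * helm4 (\<lambda>x. a x - 1 * b x) x"
  proof -
    have "helm4 (\<lambda>x. (a x - 1 * b x) - (1 - 1 / k) * (a x - 1 * b x)) x
        = helm4 (\<lambda>x. a x - 1 * b x) x - (1 - 1 / k) * helm4 (\<lambda>x. a x - 1 * b x) x"
      by (rule helm4_linear[OF ab ab])
    moreover have "(\<lambda>x. (a x - 1 * b x) - (1 - 1 / k) * (a x - 1 * b x)) = (\<lambda>x. (1 / k) * (a x - 1 * b x))"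
      by (rule ext) (simp add: algebra_simps)
    ultimately show ?thesis by (simp add: algebra_simps)
  qed
  then show "helm4 (\<lambda>x. (a x - b x) / k - h x) x = (helm4 a x - helm4 b x) / k - helm4 h x"
    unfolding e helm4_linear[OF abk h] by (simp only: helm4_linear[OF a b]) simp
qed

lemma integrable_mult_bounded:
  fixes a b :: "real \<Rightarrow> real"
  assumes a: "integrable lborel a" and [measurable]: "b \<in> borel_measurable borel" and B: "\<And>x. \<bar>b x\<bar> \<le> B"
  shows "integrable lborel (\<lambda>x. a x * b x)"
proof (rule Bochner_Integration.integrable_bound)
  have [measurable]: "a \<in> borel_measurable borel" using a by auto
  show "integrable lborel (\<lambda>x. a x * B)" using a by simp
  show "(\<lambda>x. a x * b x) \<in> borel_measurable lborel" by measurable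
  show "AE x in lborel. norm (a x * b x) \<le> norm (a x * B)"
    unfolding real_norm_def abs_mult
    by (intro AE_I2 mult_left_mono order.trans[OF B abs_ge_self]) auto
qed

text \<open>With \<open>h = helm4 v\<close> one has \<open>n := v - 3 h = h - h''\<close>, so that \<open>h - h'\<close> and \<open>h + h'\<close> are the left and right
exponential averages of \<open>n\<close>, i.e. \<open>(1 - \<partial>\<^sub>x\<^sup>2)\<^sup>-\<^sup>1 n = h\<close>. Therefore \<open>- \<integral> p\<^sub>x n = \<integral> f h'\<close>, whose contribution
\<open>3/2 \<integral> v\<^sup>2 h'\<close> cancels against \<open>- \<integral> v v' n = 3 \<integral> v v' h = - 3/2 \<integral> v\<^sup>2 h'\<close>. Only the part with \<open>\<eta>\<close> survives.\<close>

lemma energy_flux: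
  assumes v: "tame v" and dv: "\<And>x. (v has_real_derivative deriv v x) (at x)"
    and cv: "continuous_on UNIV (deriv v)" and L: "\<And>x. \<bar>deriv v x\<bar> \<le> L" and \<eta>: "tame \<eta>"
  shows "tame (dp2_velocity c v \<eta>)"
    and "2 * L2ip (dp2_velocity c v \<eta>) (\<lambda>x. v x - 3 * helm4 v x) = c * (LINT x|lborel. (\<eta> x)\<^sup>2 * helm4_x v x)"
proof -
  obtain B C where B: "\<And>x. \<bar>v x\<bar> \<le> B" and C: "\<And>x. \<bar>\<eta> x\<bar> \<le> C"
    using tameD(4)[OF v] tameD(4)[OF \<eta>] by blast
  let ?f = "\<lambda>y. 3 / 2 * (v y)\<^sup>2 + c / 2 * (\<eta> y)\<^sup>2"
  let ?n = "\<lambda>x. v x - 3 * helm4 v x"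
  let ?vv = "\<lambda>x. v x * deriv v x"
  note F = dp2_flux[OF tameD(1,3)[OF v] B tameD(1,3)[OF \<eta>] C, where c = c]
  note T4 = tame_helm4[OF v] and d4 = helm4_deriv[OF v]
  have n: "tame ?n" by (rule tame_diff[OF v T4(1)])
  obtain N where N: "\<And>x. \<bar>?n x\<bar> \<le> N" using tameD(4)[OF n] by blast
  obtain X where X: "\<And>x. \<bar>helm4_x v x\<bar> \<le> X" using tameD(4)[OF T4(2)] by blast
  obtain Y where Y: "\<And>x. \<bar>helm4 v x\<bar> \<le> Y" using tameD(4)[OF T4(1)] by blast
  have vv: "tame ?vv"
  proof (rule tameI)
    show "continuous_on UNIV ?vv" by (intro continuous_intros tameD(1)[OF v] cv)
    show "\<bar>?vv x\<bar> \<le> B * L" for x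
      unfolding abs_mult by (intro mult_mono B L order.trans[OF abs_ge_zero B]) auto
    have m': "(\<lambda>x. (deriv v x)\<^sup>2) \<in> borel_measurable borel"
      using borel_measurable_continuous_onI[OF cv] by simp
    have "\<bar>(deriv v x)\<^sup>2\<bar> \<le> L\<^sup>2" for x
      using power_mono[OF L[of x], of 2] by simp
    from integrable_mult_bounded[OF tameD(3)[OF v] m' this] show "integrable lborel (\<lambda>x. (?vv x)\<^sup>2)"
      by (simp add: power_mult_distrib)
  qed
  have hx: "tame (helm_x ?f)"
    by (rule tameI[OF helm_continuous(2)[OF F(1,3)] helm_x_bound[OF F(2)]
          integrable_square_of_bounded[OF helm_integrable(2)[OF F(2)] helm_x_bound[OF F(2)]]])
  have Heq: "dp2_velocity c v \<eta> = (\<lambda>x. (- 1) * ?vv x - 1 * helm_x ?f x)"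
    by (auto simp: dp2_velocity_def)
  show "tame (dp2_velocity c v \<eta>)"
    unfolding Heq by (rule tame_diff[OF tame_cmult[OF vv] hx])
  have Rn: "rexp 1 ?n x = helm4 v x + helm4_x v x" for x
  proof (rule rexp_unique[OF zero_less_one tameD(1)[OF n] N])
    show "((\<lambda>x. helm4 v x + helm4_x v x) has_real_derivative 1 * (helm4 v x + helm4_x v x) - ?n x) (at x)" for x
      by (rule DERIV_cong[OF DERIV_add[OF d4]]) simp
    show "\<bar>helm4 v x + helm4_x v x\<bar> \<le> Y + X" for x
      using X[of x] Y[of x] by linarith
  qed
  have Ln: "lexp 1 ?n x = helm4 v x - helm4_x v x" for x
  proof (rule lexp_unique[OF zero_less_one tameD(1)[OF n] N])
    show "((\<lambda>x. helm4 v x - helm4_x v x) has_real_derivative ?n x - 1 * (helm4 v x - helm4_x v x)) (at x)" for x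
      by (rule DERIV_cong[OF DERIV_diff[OF d4]]) simp
    show "\<bar>helm4 v x - helm4_x v x\<bar> \<le> Y + X" for x
      using X[of x] Y[of x] by linarith
  qed
  note A = lexp_adjoint[OF zero_less_one F(2) tameD(2)[OF n] N] rexp_adjoint[OF zero_less_one F(2) tameD(2)[OF n] N]
  have fx: "integrable lborel (\<lambda>x. ?f x * helm4_x v x)"
    by (rule integrable_mult_bounded[OF F(2) tameD(2)[OF T4(2)] X])
  have 1: "L2ip (helm_x ?f) ?n = - (LINT x|lborel. ?f x * helm4_x v x)"
  proof -
    have "L2ip (helm_x ?f) ?n = (LINT x|lborel. (rexp 1 ?f x * ?n x - lexp 1 ?f x * ?n x) / 2)"
      unfolding L2ip_def helm_x_def by (intro Bochner_Integration.integral_cong) (auto simp: algebra_simps)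
    also have "\<dots> = ((LINT x|lborel. ?f x * lexp 1 ?n x) - (LINT x|lborel. ?f x * rexp 1 ?n x)) / 2"
      using A(1,4) unfolding A(3)[symmetric] A(6)[symmetric] by simp
    also have "\<dots> = (LINT x|lborel. (?f x * lexp 1 ?n x - ?f x * rexp 1 ?n x)) / 2"
      using A(2,5) by simp
    also have "\<dots> = (LINT x|lborel. (- 2) * (?f x * helm4_x v x)) / 2"
    proof -
      have "y * (h - k) - y * (h + k) = (- 2) * (y * k)" for y h k :: real
        by (simp add: algebra_simps)
      then show ?thesis unfolding Rn Ln by (simp only:)
    qed
    also have "\<dots> = - (LINT x|lborel. ?f x * helm4_x v x)"
      by simp
    finally show ?thesis .
  qed
  have v2dv: "integrable lborel (\<lambda>x. (v x)\<^sup>2 * deriv v x)"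
    by (rule integrable_mult_bounded[OF tameD(3)[OF v] borel_measurable_continuous_onI[OF cv] L])
  have 2: "(LINT x|lborel. (v x)\<^sup>2 * deriv v x) = 0"
  proof (rule integral_derivative_eq_0)
    show "((\<lambda>x. (v x)\<^sup>2 * v x / 3) has_vector_derivative (v x)\<^sup>2 * deriv v x) (at x)" for x
      unfolding has_real_derivative_iff_has_vector_derivative[symmetric]
      by (rule DERIV_cong[OF DERIV_cdivide[OF DERIV_mult[OF DERIV_power[OF dv] dv]]])
         (simp add: power2_eq_square field_simps)
    show "continuous_on UNIV (\<lambda>x. (v x)\<^sup>2 * deriv v x)"
      by (intro continuous_intros tameD(1)[OF v] cv)
    show "integrable lborel (\<lambda>x. (v x)\<^sup>2 * v x / 3)"
      using integrable_mult_bounded[OF tameD(3)[OF v] tameD(2)[OF v] B] by simp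
  qed (rule v2dv)
  have v2h: "integrable lborel (\<lambda>x. (v x)\<^sup>2 * helm4_x v x)"
    by (rule integrable_mult_bounded[OF tameD(3)[OF v] tameD(2)[OF T4(2)] X])
  have vvh: "integrable lborel (\<lambda>x. ?vv x * helm4 v x)"
    by (rule tame_mult(1)[OF vv T4(1)])
  have 3: "(LINT x|lborel. 2 * (?vv x * helm4 v x) + (v x)\<^sup>2 * helm4_x v x) = 0"
  proof (rule integral_derivative_eq_0)
    show "((\<lambda>x. (v x)\<^sup>2 * helm4 v x) has_vector_derivative 2 * (?vv x * helm4 v x) + (v x)\<^sup>2 * helm4_x v x) (at x)" for x
      unfolding has_real_derivative_iff_has_vector_derivative[symmetric]
      by (rule DERIV_cong[OF DERIV_mult[OF DERIV_power[OF dv] d4(1)]])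
         (simp add: algebra_simps)
    show "continuous_on UNIV (\<lambda>x. 2 * (?vv x * helm4 v x) + (v x)\<^sup>2 * helm4_x v x)"
      by (intro continuous_intros tameD(1) v vv T4 cv)
    show "integrable lborel (\<lambda>x. (v x)\<^sup>2 * helm4 v x)"
      by (rule integrable_mult_bounded[OF tameD(3)[OF v] tameD(2)[OF T4(1)] Y])
  qed (use vvh v2h in simp)
  have 4: "L2ip ?vv ?n = 3 / 2 * (LINT x|lborel. (v x)\<^sup>2 * helm4_x v x)"
  proof -
    have "L2ip ?vv ?n = (LINT x|lborel. (v x)\<^sup>2 * deriv v x - 3 * (?vv x * helm4 v x))"
      unfolding L2ip_def by (intro Bochner_Integration.integral_cong) (auto simp: algebra_simps power2_eq_square)
    also have "\<dots> = - 3 * (LINT x|lborel. ?vv x * helm4 v x)"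
      using v2dv vvh 2 by simp
    finally show ?thesis using 3 vvh v2h by simp
  qed
  have e2: "integrable lborel (\<lambda>x. (\<eta> x)\<^sup>2 * helm4_x v x)"
    by (rule integrable_mult_bounded[OF tameD(3)[OF \<eta>] tameD(2)[OF T4(2)] X])
  have 5: "(LINT x|lborel. ?f x * helm4_x v x)
      = 3 / 2 * (LINT x|lborel. (v x)\<^sup>2 * helm4_x v x) + c / 2 * (LINT x|lborel. (\<eta> x)\<^sup>2 * helm4_x v x)"
  proof -
    have "(LINT x|lborel. ?f x * helm4_x v x)
        = (LINT x|lborel. 3 / 2 * ((v x)\<^sup>2 * helm4_x v x) + c / 2 * ((\<eta> x)\<^sup>2 * helm4_x v x))"
      by (intro Bochner_Integration.integral_cong) (auto simp: algebra_simps)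
    then show ?thesis using v2h e2 by simp
  qed
  have "L2ip (dp2_velocity c v \<eta>) ?n = (LINT x|lborel. - (?vv x * ?n x) - helm_x ?f x * ?n x)"
    unfolding L2ip_def Heq by (intro Bochner_Integration.integral_cong) (auto simp: algebra_simps)
  also have "\<dots> = - L2ip ?vv ?n - L2ip (helm_x ?f) ?n"
    unfolding L2ip_def using tame_mult(1)[OF vv n] tame_mult(1)[OF hx n] by simp
  finally show "2 * L2ip (dp2_velocity c v \<eta>) ?n = c * (LINT x|lborel. (\<eta> x)\<^sup>2 * helm4_x v x)"
    unfolding 1 4 5 by simp
qed

text \<open>The pointwise bound \<open>R\<^sup>2 |h'| \<le> \<parallel>v\<parallel>\<^sup>2 / 2 + R\<^sup>4 / 16\<close> for \<open>h = helm4 v\<close> is integrated against \<open>\<eta>\<^sup>2 / R\<^sup>2\<close>; the case \<open>R = 0\<close>,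
where \<open>\<eta>\<close> vanishes almost everywhere, is separate.\<close>

lemma energy_flux_bound:
  assumes v: "tame v" and \<eta>: "tame \<eta>" and R: "0 \<le> R" "(LINT x|lborel. (\<eta> x)\<^sup>2) \<le> R\<^sup>2"
  shows "\<bar>LINT x|lborel. (\<eta> x)\<^sup>2 * helm4_x v x\<bar> \<le> (L2_norm v)\<^sup>2 / 2 + R ^ 4 / 16"
proof -
  note T4 = tame_helm4[OF v]
  obtain X where X: "\<And>x. \<bar>helm4_x v x\<bar> \<le> X" using tameD(4)[OF T4(2)] by blast
  let ?I = "LINT x|lborel. (\<eta> x)\<^sup>2 * \<bar>helm4_x v x\<bar>"
  let ?K = "(L2_norm v)\<^sup>2 / 2 + R ^ 4 / 16"
  have K0: "0 \<le> ?K" by simp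
  have abs: "\<bar>LINT x|lborel. (\<eta> x)\<^sup>2 * helm4_x v x\<bar> \<le> ?I"
    using integral_norm_bound[of lborel "\<lambda>x. (\<eta> x)\<^sup>2 * helm4_x v x"] by (simp add: abs_mult)
  have le: "?I \<le> S * (LINT x|lborel. (\<eta> x)\<^sup>2)" if S: "\<And>x. \<bar>helm4_x v x\<bar> \<le> S" for S
  proof -
    have "?I \<le> (LINT x|lborel. S * (\<eta> x)\<^sup>2)"
    proof (rule Bochner_Integration.integral_mono')
      show "integrable lborel (\<lambda>x. S * (\<eta> x)\<^sup>2)" using tameD(3)[OF \<eta>] by simp
      show "(\<eta> x)\<^sup>2 * \<bar>helm4_x v x\<bar> \<le> S * (\<eta> x)\<^sup>2" for x
        using mult_right_mono[OF S[of x], of "(\<eta> x)\<^sup>2"] by (simp add: mult.commute)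
      show "0 \<le> S * (\<eta> x)\<^sup>2" for x
        using order.trans[OF abs_ge_zero S] by simp
    qed
    then show ?thesis by simp
  qed
  show ?thesis
  proof (cases "R = 0")
    case True
    then have "X * (LINT x|lborel. (\<eta> x)\<^sup>2) \<le> 0"
      using R(2) order.trans[OF abs_ge_zero X] by (intro mult_nonneg_nonpos) auto
    with le[OF X] abs K0 show ?thesis by linarith
  next
    case False
    then have R2: "0 < R\<^sup>2" using R by simp
    have "\<bar>helm4_x v x\<bar> \<le> ?K / R\<^sup>2" for x
      using rexp_lexp_diff_le_L2[OF tameD(2)[OF v] tameD(3)[OF v], of "R\<^sup>2" x] R2
      by (simp add: helm4_x_def L2_norm_def pos_le_divide_eq mult.commute flip: power_mult)
    from le[OF this] have "?I \<le> ?K / R\<^sup>2 * (LINT x|lborel. (\<eta> x)\<^sup>2)" .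
    also have "\<dots> \<le> ?K / R\<^sup>2 * R\<^sup>2"
      using R K0 by (intro mult_left_mono) auto
    also have "\<dots> = ?K" using R2 by simp
    finally show ?thesis using abs by linarith
  qed
qed

section \<open>A priori bounds on a time strip\<close>

text \<open>A solution restricted to a compact time interval, stated with functions only. Here \<open>L\<close> bounds the
slope of \<open>u\<close>, \<open>R\<close> both norms of \<open>\<rho>\<close>, and \<open>evolution\<close> is the first equation.\<close>

locale dp2_strip =
  fixes c R L \<tau> :: real and u \<rho> :: "real \<Rightarrow> real \<Rightarrow> real"
  assumes \<tau>: "0 < \<tau>" and L: "0 < L" and R: "0 \<le> R"
    and u_tame: "\<And>t. t \<in> {0..\<tau>} \<Longrightarrow> tame (u t)"
    and u_deriv: "\<And>t x. t \<in> {0..\<tau>} \<Longrightarrow> (u t has_real_derivative deriv (u t) x) (at x)"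
    and ux_cont: "\<And>t. t \<in> {0..\<tau>} \<Longrightarrow> continuous_on UNIV (deriv (u t))"
    and ux_bound: "\<And>t x. t \<in> {0..\<tau>} \<Longrightarrow> \<bar>deriv (u t) x\<bar> \<le> L"
    and \<rho>_tame: "\<And>t. t \<in> {0..\<tau>} \<Longrightarrow> tame (\<rho> t)"
    and \<rho>_sup: "\<And>t x. t \<in> {0..\<tau>} \<Longrightarrow> \<bar>\<rho> t x\<bar> \<le> R"
    and \<rho>_L2: "\<And>t. t \<in> {0..\<tau>} \<Longrightarrow> (LINT x|lborel. (\<rho> t x)\<^sup>2) \<le> R\<^sup>2"
    and evolution: "\<And>t. t \<in> {0..\<tau>} \<Longrightarrow> \<exists>e. (e \<longlongrightarrow> 0) (at t within {0..\<tau>}) \<and>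
      (\<forall>r\<in>{0..\<tau>}. r \<noteq> t \<longrightarrow>
        (\<forall>x. \<bar>(u r x - u t x) / (r - t) - dp2_velocity c (u t) (\<rho> t) x\<bar> \<le> e r) \<and>
        L2_norm (\<lambda>x. (u r x - u t x) / (r - t) - dp2_velocity c (u t) (\<rho> t) x) \<le> e r)"
begin

abbreviation flux :: "real \<Rightarrow> real \<Rightarrow> real" where
  "flux t \<equiv> \<lambda>y. 3 / 2 * (u t y)\<^sup>2 + c / 2 * (\<rho> t y)\<^sup>2"

abbreviation velocity :: "real \<Rightarrow> real \<Rightarrow> real" where
  "velocity t \<equiv> dp2_velocity c (u t) (\<rho> t)"

lemma flux_regular:
  assumes t: "t \<in> {0..\<tau>}"
  shows "continuous_on UNIV (flux t)" "integrable lborel (flux t)" "\<exists>B. \<forall>x. \<bar>flux t x\<bar> \<le> B"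
proof -
  obtain B where B: "\<And>x. \<bar>u t x\<bar> \<le> B" using tameD(4)[OF u_tame[OF t]] by blast
  note F = dp2_flux[OF tameD(1,3)[OF u_tame[OF t]] B tameD(1,3)[OF \<rho>_tame[OF t]] \<rho>_sup[OF t], where c = c]
  show "continuous_on UNIV (flux t)" "integrable lborel (flux t)" by (rule F(1), rule F(2))
  show "\<exists>B. \<forall>x. \<bar>flux t x\<bar> \<le> B" using F(3) by blast
qed

lemma velocity_tame: "t \<in> {0..\<tau>} \<Longrightarrow> tame (velocity t)"
  by (rule energy_flux(1)[OF u_tame u_deriv ux_cont ux_bound \<rho>_tame])

lemma u_lipschitz:
  assumes t: "t \<in> {0..\<tau>}"
  shows "\<bar>u t y - u t z\<bar> \<le> L * \<bar>y - z\<bar>"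
  using field_differentiable_bound[of UNIV "u t" "deriv (u t)" L y z] u_deriv[OF t] ux_bound[OF t]
  by (simp add: has_field_derivative_at_within)

text \<open>Split the difference quotient into \<open>(u r (q r) - u t (q r)) / (r - t)\<close>, which converges because the time
derivative is attained uniformly in space, and a term to which the spatial chain rule applies. The
transport terms \<open>u u\<^sub>x\<close> cancel.\<close>

lemma along_trajectory:
  assumes S: "S \<subseteq> {0..\<tau>}" and t: "t \<in> S"
    and q: "(q has_real_derivative u t (q t)) (at t within S)"
  shows "((\<lambda>r. u r (q r)) has_real_derivative - helm_x (flux t) (q t)) (at t within S)"
proof -
  have tI: "t \<in> {0..\<tau>}" using S t by blast
  from evolution[OF tI] obtain e where e: "(e \<longlongrightarrow> 0) (at t within {0..\<tau>})"
    and le: "\<And>r x. r \<in> {0..\<tau>} \<Longrightarrow> r \<noteq> t \<Longrightarrow> \<bar>(u r x - u t x) / (r - t) - velocity t x\<bar> \<le> e r"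
    by blast
  have eS: "(e \<longlongrightarrow> 0) (at t within S)"
    by (rule tendsto_within_subset[OF e S])
  have "((\<lambda>r. (u r (q r) - u t (q r)) / (r - t) - velocity t (q r)) \<longlongrightarrow> 0) (at t within S)"
    by (rule Lim_null_comparison[OF _ eS]) (use le S in \<open>auto simp: eventually_at_filter intro!: always_eventually\<close>)
  moreover have "((\<lambda>r. velocity t (q r)) \<longlongrightarrow> velocity t (q t)) (at t within S)"
  proof (rule isCont_tendsto_compose[where g = "velocity t"])
    show "isCont (velocity t) (q t)"
      using tameD(1)[OF velocity_tame[OF tI]] by (simp add: continuous_on_eq_continuous_at)
    show "(q \<longlongrightarrow> q t) (at t within S)"
      using DERIV_continuous[OF q] by (simp add: continuous_within)
  qed
  ultimately have 1: "((\<lambda>r. (u r (q r) - u t (q r)) / (r - t)) \<longlongrightarrow> velocity t (q t)) (at t within S)"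
    using tendsto_add by fastforce
  have 2: "((\<lambda>r. (u t (q r) - u t (q t)) / (r - t)) \<longlongrightarrow> deriv (u t) (q t) * u t (q t)) (at t within S)"
    using DERIV_chain2[OF u_deriv[OF tI] q] unfolding has_field_derivative_iff .
  have "((\<lambda>r. (u r (q r) - u t (q t)) / (r - t)) \<longlongrightarrow> velocity t (q t) + deriv (u t) (q t) * u t (q t)) (at t within S)"
    using tendsto_add[OF 1 2] by (simp flip: add_divide_distrib)
  then show ?thesis
    unfolding has_field_derivative_iff by (simp add: dp2_velocity_def)
qed

lemma u_continuous_in_time: "continuous_on {0..\<tau>} (\<lambda>t. u t y)"
  unfolding continuous_on_eq_continuous_within
proof
  fix t assume t: "t \<in> {0..\<tau>}"
  from evolution[OF t] obtain e where e: "(e \<longlongrightarrow> 0) (at t within {0..\<tau>})"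
    and le: "\<And>r x. r \<in> {0..\<tau>} \<Longrightarrow> r \<noteq> t \<Longrightarrow> \<bar>(u r x - u t x) / (r - t) - velocity t x\<bar> \<le> e r"
    by blast
  have "((\<lambda>r. (u r y - u t y) / (r - t) - velocity t y) \<longlongrightarrow> 0) (at t within {0..\<tau>})"
    by (rule Lim_null_comparison[OF _ e]) (use le in \<open>auto simp: eventually_at_filter\<close>)
  then have "((\<lambda>r. (u r y - u t y) / (r - t)) \<longlongrightarrow> velocity t y) (at t within {0..\<tau>})"
    by (rule Lim_null[THEN iffD2])
  then have "((\<lambda>r. u r y) has_real_derivative velocity t y) (at t within {0..\<tau>})"
    by (simp add: has_field_derivative_iff)
  then show "continuous (at t within {0..\<tau>}) (\<lambda>r. u r y)"
    by (rule DERIV_continuous)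
qed

definition energy :: "real \<Rightarrow> real" where
  "energy t = L2ip (u t) (\<lambda>x. u t x - 3 * helm4 (u t) x)"

lemma energy_eq:
  assumes t: "t \<in> {0..\<tau>}"
  shows "energy t = L2ip (u t) (u t) - 3 * L2ip (u t) (helm4 (u t))"
proof -
  note w = u_tame[OF t]
  have "energy t = (LINT x|lborel. u t x * u t x - 3 * (u t x * helm4 (u t) x))"
    unfolding energy_def L2ip_def by (intro Bochner_Integration.integral_cong) (auto simp: algebra_simps)
  then show ?thesis
    unfolding L2ip_def using tame_mult(1)[OF w w] tame_mult(1)[OF w tame_helm4(1)[OF w]] by simp
qed

lemma energy_bounds:
  assumes t: "t \<in> {0..\<tau>}"
  shows "(L2_norm (u t))\<^sup>2 \<le> 4 * energy t" "energy t \<le> (L2_norm (u t))\<^sup>2"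
proof -
  have s: "L2ip (u t) (u t) = (L2_norm (u t))\<^sup>2"
    by (simp add: L2ip_def L2_norm_def power2_eq_square[symmetric])
  have "0 \<le> L2ip (u t) (helm4 (u t))"
    using helm4_inner_bounds(1)[OF u_tame[OF t]] zero_le_power2[of "L2_norm (helm4 (u t))"] by linarith
  with helm4_inner_bounds(2)[OF u_tame[OF t]]
  show "(L2_norm (u t))\<^sup>2 \<le> 4 * energy t" "energy t \<le> (L2_norm (u t))\<^sup>2"
    unfolding energy_eq[OF t] s by simp_all
qed

lemma energy_deriv:
  assumes t: "t \<in> {0..\<tau>}"
  shows "(energy has_real_derivative c * (LINT x|lborel. (\<rho> t x)\<^sup>2 * helm4_x (u t) x)) (at t within {0..\<tau>})"
proof -
  let ?I = "{0..\<tau>}" and ?H = "velocity t"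
  from evolution[OF t] obtain e where e: "(e \<longlongrightarrow> 0) (at t within ?I)"
    and le: "\<And>r. r \<in> ?I \<Longrightarrow> r \<noteq> t \<Longrightarrow> L2_norm (\<lambda>x. (u r x - u t x) / (r - t) - ?H x) \<le> e r"
    by blast
  note w = u_tame[OF t] and H = velocity_tame[OF t]
  have le4: "L2_norm (\<lambda>x. (helm4 (u r) x - helm4 (u t) x) / (r - t) - helm4 ?H x) \<le> e r"
    if r: "r \<in> ?I" "r \<noteq> t" for r
  proof -
    have "L2_norm (\<lambda>x. (helm4 (u r) x - helm4 (u t) x) / (r - t) - helm4 ?H x)
        \<le> L2_norm (\<lambda>x. (u r x - u t x) / (r - t) - ?H x) / 4"
      using helm4_inner_bounds(3)[OF helm4_diff_quotient(2)[OF u_tame[OF r(1)] w H, of "r - t"]]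
      unfolding helm4_diff_quotient(1)[OF u_tame[OF r(1)] w H, abs_def] .
    moreover have "0 \<le> L2_norm (\<lambda>x. (u r x - u t x) / (r - t) - ?H x)" by (simp add: L2_norm_def)
    ultimately show ?thesis using le[OF r] by linarith
  qed
  have 1: "((\<lambda>r. L2ip (u r) (u r)) has_real_derivative L2ip ?H (u t) + L2ip (u t) ?H) (at t within ?I)"
    by (rule L2ip_has_derivative[OF t u_tame u_tame H H e le le])
  have 2: "((\<lambda>r. L2ip (u r) (helm4 (u r))) has_real_derivative L2ip ?H (helm4 (u t)) + L2ip (u t) (helm4 ?H)) (at t within ?I)"
    by (rule L2ip_has_derivative[OF t u_tame tame_helm4(1)[OF u_tame] H tame_helm4(1)[OF H] e le le4])
  have comm: "L2ip a b = L2ip b a" for a b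
    by (simp add: L2ip_def mult.commute)
  have sym: "L2ip (u t) (helm4 ?H) = L2ip ?H (helm4 (u t))"
    using helm4_symmetric[OF w H] comm by metis
  have 3: "2 * L2ip ?H (\<lambda>x. u t x - 3 * helm4 (u t) x) = 2 * L2ip ?H (u t) - 6 * L2ip ?H (helm4 (u t))"
  proof -
    have "L2ip ?H (\<lambda>x. u t x - 3 * helm4 (u t) x) = (LINT x|lborel. ?H x * u t x - 3 * (?H x * helm4 (u t) x))"
      unfolding L2ip_def by (intro Bochner_Integration.integral_cong) (auto simp: algebra_simps)
    then show ?thesis
      unfolding L2ip_def using tame_mult(1)[OF H w] tame_mult(1)[OF H tame_helm4(1)[OF w]] by simp
  qed
  have "((\<lambda>r. L2ip (u r) (u r) - 3 * L2ip (u r) (helm4 (u r))) has_real_derivative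
      2 * L2ip ?H (\<lambda>x. u t x - 3 * helm4 (u t) x)) (at t within ?I)"
    by (rule DERIV_cong[OF DERIV_diff[OF 1 DERIV_cmult[OF 2, of 3]]])
       (simp add: 3 sym comm[of "u t" ?H])
  then have "(energy has_real_derivative 2 * L2ip ?H (\<lambda>x. u t x - 3 * helm4 (u t) x)) (at t within ?I)"
    by (rule has_field_derivative_transform_within[OF _ zero_less_one t]) (simp add: energy_eq)
  then show ?thesis
    unfolding energy_flux(2)[OF w u_deriv[OF t] ux_cont[OF t] ux_bound[OF t] \<rho>_tame[OF t]] .
qed

text \<open>Gronwall's inequality for \<open>E' \<le> |c| (2 E + R\<^sup>4 / 16)\<close>.\<close>

lemma energy_growth:
  assumes t: "t \<in> {0..\<tau>}"
  shows "energy t \<le> exp (2 * \<bar>c\<bar> * t) * (energy 0 + \<bar>c\<bar> * t * R ^ 4 / 16)"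
proof -
  define g where "g r = energy r * exp (- (2 * \<bar>c\<bar> * r)) - \<bar>c\<bar> * r * R ^ 4 / 16" for r
  have ec: "continuous_on {0..\<tau>} energy"
    by (rule DERIV_continuous_on[OF energy_deriv])
  have "g t \<le> g 0"
  proof (rule DERIV_nonpos_imp_decreasing_open[of 0 t g])
    show "0 \<le> t" using t by simp
    show "continuous_on {0..t} g"
      unfolding g_def[abs_def] using t by (intro continuous_intros continuous_on_subset[OF ec]) auto
    fix r assume r: "0 < r" "r < t"
    then have rI: "r \<in> {0..\<tau>}" using t by auto
    have at: "at r within {0..\<tau>} = at r"
      using r t by (intro at_within_interior) auto
    let ?X = "LINT x|lborel. (\<rho> r x)\<^sup>2 * helm4_x (u r) x"
    have ed: "(energy has_real_derivative c * ?X) (at r)"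
      using energy_deriv[OF rI] unfolding at .
    have xd: "((\<lambda>r. exp (- (2 * \<bar>c\<bar> * r))) has_real_derivative exp (- (2 * \<bar>c\<bar> * r)) * (- (2 * \<bar>c\<bar>))) (at r)"
      by (auto intro!: derivative_eq_intros)
    have ld: "((\<lambda>r. \<bar>c\<bar> * r * R ^ 4 / 16) has_real_derivative \<bar>c\<bar> * R ^ 4 / 16) (at r)"
      by (auto intro!: derivative_eq_intros)
    have gd: "(g has_real_derivative exp (- (2 * \<bar>c\<bar> * r)) * (c * ?X - 2 * \<bar>c\<bar> * energy r) - \<bar>c\<bar> * R ^ 4 / 16) (at r)"
      unfolding g_def[abs_def]
      by (rule DERIV_cong[OF DERIV_diff[OF DERIV_mult[OF ed xd] ld]]) (simp add: algebra_simps)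
    have "c * ?X \<le> \<bar>c\<bar> * \<bar>?X\<bar>"
      by (metis abs_ge_self abs_mult)
    also have "\<dots> \<le> \<bar>c\<bar> * ((L2_norm (u r))\<^sup>2 / 2 + R ^ 4 / 16)"
      by (intro mult_left_mono energy_flux_bound u_tame \<rho>_tame R \<rho>_L2 rI) simp
    also have "\<dots> \<le> \<bar>c\<bar> * (2 * energy r + R ^ 4 / 16)"
      using energy_bounds(1)[OF rI] by (intro mult_left_mono) auto
    finally have "c * ?X - 2 * \<bar>c\<bar> * energy r \<le> \<bar>c\<bar> * R ^ 4 / 16"
      by (simp add: algebra_simps)
    then have "exp (- (2 * \<bar>c\<bar> * r)) * (c * ?X - 2 * \<bar>c\<bar> * energy r) \<le> exp (- (2 * \<bar>c\<bar> * r)) * (\<bar>c\<bar> * R ^ 4 / 16)"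
      by (intro mult_left_mono) auto
    also have "\<dots> \<le> 1 * (\<bar>c\<bar> * R ^ 4 / 16)"
      using r by (intro mult_right_mono) auto
    finally show "\<exists>y. (g has_real_derivative y) (at r) \<and> y \<le> 0"
      using gd by (intro exI conjI) auto
  qed
  then have "energy t * exp (- (2 * \<bar>c\<bar> * t)) \<le> energy 0 + \<bar>c\<bar> * t * R ^ 4 / 16"
    by (simp add: g_def)
  then have "exp (2 * \<bar>c\<bar> * t) * (energy t * exp (- (2 * \<bar>c\<bar> * t))) \<le> exp (2 * \<bar>c\<bar> * t) * (energy 0 + \<bar>c\<bar> * t * R ^ 4 / 16)"
    by (intro mult_left_mono) auto
  moreover have "exp (2 * \<bar>c\<bar> * t) * (energy t * exp (- (2 * \<bar>c\<bar> * t))) = energy t"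
    unfolding mult.left_commute[of _ "energy t"] by (simp flip: exp_add)
  ultimately show ?thesis by simp
qed

lemma u_L2_bound:
  assumes t: "t \<in> {0..\<tau>}" and T: "\<tau> \<le> T"
  shows "(L2_norm (u t))\<^sup>2 \<le> exp (2 * \<bar>c\<bar> * T) * (4 * (L2_norm (u 0))\<^sup>2 + \<bar>c\<bar> * T * R ^ 4 / 4)"
proof -
  have 0: "0 \<in> {0..\<tau>}" using \<tau> by simp
  have "(L2_norm (u t))\<^sup>2 \<le> 4 * (exp (2 * \<bar>c\<bar> * t) * (energy 0 + \<bar>c\<bar> * t * R ^ 4 / 16))"
    using energy_bounds(1)[OF t] energy_growth[OF t] by linarith
  also have "\<dots> = exp (2 * \<bar>c\<bar> * t) * (4 * energy 0 + \<bar>c\<bar> * t * R ^ 4 / 4)"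
    by (simp add: algebra_simps)
  also have "\<dots> \<le> exp (2 * \<bar>c\<bar> * t) * (4 * (L2_norm (u 0))\<^sup>2 + \<bar>c\<bar> * T * R ^ 4 / 4)"
    using energy_bounds(2)[OF 0] t T
    by (intro mult_left_mono add_mono divide_right_mono mult_right_mono) auto
  also have "\<dots> \<le> exp (2 * \<bar>c\<bar> * T) * (4 * (L2_norm (u 0))\<^sup>2 + \<bar>c\<bar> * T * R ^ 4 / 4)"
    using t T \<tau> by (intro mult_right_mono add_nonneg_nonneg) (auto intro!: mult_left_mono)
  finally show ?thesis .
qed

lemma helm_x_flux_bound:
  assumes t: "t \<in> {0..\<tau>}" and Y: "(L2_norm (u t))\<^sup>2 \<le> Y"
  shows "\<bar>helm_x (flux t) x\<bar> \<le> 3 / 4 * Y + \<bar>c\<bar> / 4 * R\<^sup>2"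
proof -
  note i = tameD(3)[OF u_tame[OF t]] tameD(3)[OF \<rho>_tame[OF t]]
  have "(LINT y|lborel. \<bar>flux t y\<bar>) \<le> (LINT y|lborel. 3 / 2 * (u t y)\<^sup>2 + \<bar>c\<bar> / 2 * (\<rho> t y)\<^sup>2)"
  proof (rule integral_mono)
    show "integrable lborel (\<lambda>y. \<bar>flux t y\<bar>)" using flux_regular(2)[OF t] by simp
    show "integrable lborel (\<lambda>y. 3 / 2 * (u t y)\<^sup>2 + \<bar>c\<bar> / 2 * (\<rho> t y)\<^sup>2)" using i by simp
    show "\<bar>flux t y\<bar> \<le> 3 / 2 * (u t y)\<^sup>2 + \<bar>c\<bar> / 2 * (\<rho> t y)\<^sup>2" for y
      using abs_triangle_ineq[of "3 / 2 * (u t y)\<^sup>2" "c / 2 * (\<rho> t y)\<^sup>2"] by (simp add: abs_mult)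
  qed
  also have "\<dots> = 3 / 2 * (LINT y|lborel. (u t y)\<^sup>2) + \<bar>c\<bar> / 2 * (LINT y|lborel. (\<rho> t y)\<^sup>2)"
    using i by simp
  also have "\<dots> \<le> 3 / 2 * Y + \<bar>c\<bar> / 2 * R\<^sup>2"
    using Y by (intro add_mono mult_left_mono \<rho>_L2 t) (auto simp: L2_norm_def)
  finally show ?thesis
    using helm_x_bound[OF flux_regular(2)[OF t], of x] by linarith
qed

text \<open>Every point \<open>(t, x)\<close> is reached by a trajectory that starts at time \<open>0\<close>, and along it \<open>u\<close> changes at the
bounded rate \<open>- p\<^sub>x\<close>.\<close>

lemma u_sup_bound:
  assumes t: "t \<in> {0..\<tau>}" and Y: "\<And>r. r \<in> {0..\<tau>} \<Longrightarrow> (L2_norm (u r))\<^sup>2 \<le> Y"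
    and S: "\<And>y. \<bar>u 0 y\<bar> \<le> S"
  shows "\<bar>u t x\<bar> \<le> S + t * (3 / 4 * Y + \<bar>c\<bar> / 4 * R\<^sup>2)"
proof -
  have sub: "{0..t} \<subseteq> {0..\<tau>}" using t by auto
  have "\<exists>q. q t = x \<and> (\<forall>r\<in>{0..t}. (q has_real_derivative u r (q r)) (at r within {0..t}))"
  proof (rule ode_exists_through[OF _ _ L])
    show "0 \<le> t" using t by simp
    show "continuous_on {0..t} (\<lambda>r. u r y)" for y
      by (rule continuous_on_subset[OF u_continuous_in_time sub])
    show "\<bar>u r y - u r z\<bar> \<le> L * \<bar>y - z\<bar>" if "r \<in> {0..t}" for r y z
      using that sub by (intro u_lipschitz) auto
  qed
  then obtain q where q: "q t = x" "\<And>r. r \<in> {0..t} \<Longrightarrow> (q has_real_derivative u r (q r)) (at r within {0..t})"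
    by blast
  have "norm (u t (q t) - u 0 (q 0)) \<le> (3 / 4 * Y + \<bar>c\<bar> / 4 * R\<^sup>2) * norm (t - 0)"
  proof (rule field_differentiable_bound[of "{0..t}" "\<lambda>r. u r (q r)" "\<lambda>r. - helm_x (flux r) (q r)"])
    show "((\<lambda>r. u r (q r)) has_real_derivative - helm_x (flux r) (q r)) (at r within {0..t})" if "r \<in> {0..t}" for r
      by (rule along_trajectory[OF sub that q(2)[OF that]])
    show "norm (- helm_x (flux r) (q r)) \<le> 3 / 4 * Y + \<bar>c\<bar> / 4 * R\<^sup>2" if "r \<in> {0..t}" for r
    proof -
      have rI: "r \<in> {0..\<tau>}" using that sub by blast
      show ?thesis using helm_x_flux_bound[OF rI Y[OF rI], of "q r"] by simp
    qed
  qed (use t in auto)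
  then show ?thesis
    using S[of "q 0"] t q(1) by (simp add: mult.commute)
qed

section \<open>Collision of trajectories\<close>

text \<open>Two trajectories \<open>p < q\<close> start at \<open>x0\<close> and at a point \<open>x1\<close> close to it. Their distance \<open>D\<close> satisfies \<open>D' = U\<close>
and \<open>U' \<le> K\<^sup>2 D\<close>. Factoring \<open>\<partial>\<^sub>t\<^sup>2 - K\<^sup>2 = (\<partial>\<^sub>t + K) (\<partial>\<^sub>t - K)\<close>, first \<open>z = (U - K D) exp (K t)\<close> and then
\<open>W = D exp (- K t) + z(0) / (2 K) exp (- 2 K t)\<close> are nonincreasing. The initial slope and the length of the time
interval make \<open>D\<close> nonpositive at the end, although trajectories never meet.\<close>

lemma no_steep_slope:
  assumes K: "0 < K" and B: "\<And>t x. t \<in> {0..\<tau>} \<Longrightarrow> \<bar>u t x\<bar> \<le> B" and KB: "3 / 2 * B\<^sup>2 + \<bar>c\<bar> / 2 * R\<^sup>2 \<le> K\<^sup>2"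
    and \<epsilon>: "0 < \<epsilon>" and slope: "deriv (u 0) x0 < - (1 + \<epsilon>) * K" and long: "exp (- (2 * K * \<tau>)) \<le> \<epsilon> / (2 + \<epsilon>)"
  shows False
proof -
  let ?I = "{0..\<tau>}"
  have 0: "0 \<in> ?I" using \<tau> by simp
  obtain x1 where x1: "x0 < x1" "u 0 x1 - u 0 x0 < - (1 + \<epsilon>) * K * (x1 - x0)"
  proof -
    have "((\<lambda>y. (u 0 y - u 0 x0) / (y - x0)) \<longlongrightarrow> deriv (u 0) x0) (at x0)"
      using u_deriv[OF 0, of x0] unfolding has_field_derivative_iff .
    from order_tendstoD(2)[OF this slope] obtain d where d: "0 < d"
      "\<And>y. y \<noteq> x0 \<Longrightarrow> dist y x0 < d \<Longrightarrow> (u 0 y - u 0 x0) / (y - x0) < - (1 + \<epsilon>) * K"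
      unfolding eventually_at by auto
    have "(u 0 (x0 + d / 2) - u 0 x0) / (x0 + d / 2 - x0) < - (1 + \<epsilon>) * K"
      by (rule d(2)) (use d(1) in \<open>auto simp: dist_real_def\<close>)
    then show ?thesis
      by (intro that[of "x0 + d / 2"]) (use d(1) in \<open>auto simp: pos_divide_less_eq\<close>)
  qed
  have traj: "\<exists>q. q 0 = x \<and> (\<forall>t\<in>?I. (q has_real_derivative u t (q t)) (at t within ?I))" for x
    by (rule ode_exists[OF less_imp_le[OF \<tau>] u_continuous_in_time L u_lipschitz])
  obtain p where p: "p 0 = x0" "\<And>t. t \<in> ?I \<Longrightarrow> (p has_real_derivative u t (p t)) (at t within ?I)"
    using traj[of x0] by blast
  obtain q where q: "q 0 = x1" "\<And>t. t \<in> ?I \<Longrightarrow> (q has_real_derivative u t (q t)) (at t within ?I)"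
    using traj[of x1] by blast
  have pq: "p t < q t" if "t \<in> ?I" for t
    by (rule trajectories_do_not_meet[OF u_lipschitz p(2) q(2) _ that]) (use p(1) q(1) x1(1) in auto)
  define D where "D t = q t - p t" for t
  define U where "U t = u t (q t) - u t (p t)" for t
  have D': "(D has_real_derivative U t) (at t within ?I)" if "t \<in> ?I" for t
    unfolding D_def[abs_def] U_def by (rule DERIV_diff[OF q(2)[OF that] p(2)[OF that]])
  have U': "(U has_real_derivative helm_x (flux t) (p t) - helm_x (flux t) (q t)) (at t within ?I)" if "t \<in> ?I" for t
    unfolding U_def[abs_def]
    by (rule DERIV_cong[OF DERIV_diff[OF along_trajectory[OF order_refl that q(2)[OF that]]
          along_trajectory[OF order_refl that p(2)[OF that]]]]) simp
  have U'_le: "helm_x (flux t) (p t) - helm_x (flux t) (q t) \<le> K\<^sup>2 * D t" if t: "t \<in> ?I" for t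
  proof -
    obtain F where F: "\<And>x. \<bar>flux t x\<bar> \<le> F" using flux_regular(3)[OF t] by blast
    note c1 = flux_regular(1)[OF t]
    have m: "flux t \<in> borel_measurable borel" by (rule borel_measurable_continuous_onI[OF c1])
    have sq: "(u t x)\<^sup>2 \<le> B\<^sup>2" "(\<rho> t x)\<^sup>2 \<le> R\<^sup>2" for x
      using power_mono[OF B[OF t, of x], of 2] power_mono[OF \<rho>_sup[OF t, of x], of 2] by simp_all
    \<comment> \<open>Only one of the two bounds on the part with \<open>\<rho>\<close> is active, depending on the sign of \<open>c\<close>; together they
      cost \<open>|c| / 2 R\<^sup>2\<close> in \<open>f - p\<close>.\<close>
    have up: "flux t x \<le> 3 / 2 * B\<^sup>2 + max 0 c / 2 * R\<^sup>2" for x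
    proof -
      have "c / 2 * (\<rho> t x)\<^sup>2 \<le> max 0 c / 2 * (\<rho> t x)\<^sup>2"
        by (intro mult_right_mono) auto
      also have "\<dots> \<le> max 0 c / 2 * R\<^sup>2"
        by (intro mult_left_mono sq) auto
      finally show ?thesis using sq(1)[of x] by linarith
    qed
    have low: "min 0 c / 2 * R\<^sup>2 \<le> flux t x" for x
    proof -
      have "min 0 c / 2 * R\<^sup>2 \<le> min 0 c / 2 * (\<rho> t x)\<^sup>2"
        by (intro mult_left_mono_neg sq) auto
      also have "\<dots> \<le> c / 2 * (\<rho> t x)\<^sup>2"
        by (intro mult_right_mono) auto
      finally show ?thesis using zero_le_power2[of "u t x"] by linarith
    qed
    have lowh: "min 0 c / 2 * R\<^sup>2 \<le> helm (flux t) x" for x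
      using lexp_ge[OF zero_less_one m F low, of x] rexp_ge[OF zero_less_one m F low, of x]
      by (simp add: helm_def)
    have eq: "max 0 c / 2 * R\<^sup>2 - min 0 c / 2 * R\<^sup>2 = \<bar>c\<bar> / 2 * R\<^sup>2"
      by (simp add: max_def min_def abs_if)
    have "0 \<le> h - f + k" if "m \<le> h" "m' - m = a" "f \<le> b + m'" "b + a \<le> k" for a b f h k m m' :: real
      using that by linarith
    from this[OF lowh eq up KB] have ge: "0 \<le> helm (flux t) x - flux t x + K\<^sup>2" for x .
    have "helm_x (flux t) (p t) + K\<^sup>2 * p t \<le> helm_x (flux t) (q t) + K\<^sup>2 * q t"
    proof (rule DERIV_nonneg_imp_nondecreasing[where f = "\<lambda>x. helm_x (flux t) x + K\<^sup>2 * x"])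
      show "p t \<le> q t" using pq[OF t] by simp
      fix x
      have "((\<lambda>x. helm_x (flux t) x + K\<^sup>2 * x) has_real_derivative helm (flux t) x - flux t x + K\<^sup>2 * 1) (at x)"
        by (intro DERIV_add DERIV_cmult DERIV_ident helm_deriv(2)[OF c1 F])
      with ge[of x] show "\<exists>y. ((\<lambda>x. helm_x (flux t) x + K\<^sup>2 * x) has_real_derivative y) (at x) \<and> 0 \<le> y"
        by auto
    qed
    then show ?thesis by (simp add: D_def algebra_simps)
  qed
  have cD: "continuous_on ?I D" and cU: "continuous_on ?I U"
    by (rule DERIV_continuous_on[OF D'], assumption) (rule DERIV_continuous_on[OF U'])
  define z where "z t = (U t - K * D t) * exp (K * t)" for t
  have z: "z t \<le> z 0" if t: "t \<in> ?I" for t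
  proof (rule DERIV_nonpos_imp_decreasing_open[of 0 t z])
    show "0 \<le> t" using t by simp
    show "continuous_on {0..t} z"
      unfolding z_def[abs_def] using t
      by (intro continuous_intros continuous_on_subset[OF cD] continuous_on_subset[OF cU]) auto
    fix r assume r: "0 < r" "r < t"
    then have rI: "r \<in> ?I" using t by auto
    have at: "at r within ?I = at r" using r t by (intro at_within_interior) auto
    have e: "((\<lambda>r. exp (K * r)) has_real_derivative exp (K * r) * K) (at r)"
      by (auto intro!: derivative_eq_intros)
    note d = D'[OF rI, unfolded at] U'[OF rI, unfolded at]
    have "(z has_real_derivative (helm_x (flux r) (p r) - helm_x (flux r) (q r) - K\<^sup>2 * D r) * exp (K * r)) (at r)"
      unfolding z_def[abs_def]
      by (rule DERIV_cong[OF DERIV_mult[OF DERIV_diff[OF d(2) DERIV_cmult[OF d(1)]] e]])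
         (simp add: algebra_simps power2_eq_square)
    moreover have "(helm_x (flux r) (p r) - helm_x (flux r) (q r) - K\<^sup>2 * D r) * exp (K * r) \<le> 0"
      using U'_le[OF rI] by (intro mult_nonpos_nonneg) auto
    ultimately show "\<exists>y. (z has_real_derivative y) (at r) \<and> y \<le> 0" by blast
  qed
  define W where "W t = D t * exp (- (K * t)) + z 0 / (2 * K) * exp (- (2 * K * t))" for t
  have "W \<tau> \<le> W 0"
  proof (rule DERIV_nonpos_imp_decreasing_open[of 0 \<tau> W])
    show "0 \<le> \<tau>" using \<tau> by simp
    show "continuous_on {0..\<tau>} W"
      unfolding W_def[abs_def] by (intro continuous_intros cD)
    fix r assume r: "0 < r" "r < \<tau>"
    then have rI: "r \<in> ?I" by auto
    have at: "at r within ?I = at r" using r by (intro at_within_interior) auto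
    have e: "((\<lambda>r. exp (- (K * r))) has_real_derivative exp (- (K * r)) * (- K)) (at r)"
      "((\<lambda>r. exp (- (2 * K * r))) has_real_derivative exp (- (2 * K * r)) * (- (2 * K))) (at r)"
      by (auto intro!: derivative_eq_intros)
    have ee: "exp (- (K * r)) = exp (- (2 * K * r)) * exp (K * r)"
      by (simp flip: exp_add)
    have "(W has_real_derivative exp (- (2 * K * r)) * (z r - z 0)) (at r)"
      unfolding W_def[abs_def]
      by (rule DERIV_cong[OF DERIV_add[OF DERIV_mult[OF D'[OF rI, unfolded at] e(1)] DERIV_cmult[OF e(2)]]])
         (use K in \<open>simp add: z_def[of r] ee field_simps\<close>)
    moreover have "exp (- (2 * K * r)) * (z r - z 0) \<le> 0"
      using z[OF rI] by (intro mult_nonneg_nonpos) auto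
    ultimately show "\<exists>y. (W has_real_derivative y) (at r) \<and> y \<le> 0" by blast
  qed
  then have W: "D \<tau> * exp (- (K * \<tau>)) \<le> D 0 + z 0 / (2 * K) * (1 - exp (- (2 * K * \<tau>)))"
    by (simp add: W_def algebra_simps)
  have D0: "0 < D 0" using pq[OF 0] by (simp add: D_def)
  have "z 0 = U 0 - K * D 0" by (simp add: z_def)
  also have "\<dots> < - (1 + \<epsilon>) * K * D 0 - K * D 0"
    using x1(2) by (simp add: U_def D_def p(1) q(1))
  also have "\<dots> = - ((2 + \<epsilon>) / 2 * D 0) * (2 * K)"
    by (simp add: field_simps)
  finally have "z 0 < - ((2 + \<epsilon>) / 2 * D 0) * (2 * K)" .
  then have z0: "z 0 / (2 * K) < - ((2 + \<epsilon>) / 2 * D 0)"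
    using K by (simp add: pos_divide_less_eq)
  have w: "2 / (2 + \<epsilon>) \<le> 1 - exp (- (2 * K * \<tau>))"
  proof -
    have "2 / (2 + \<epsilon>) = 1 - \<epsilon> / (2 + \<epsilon>)" using \<epsilon> by (simp add: field_simps)
    with long show ?thesis by linarith
  qed
  have "z 0 / (2 * K) * (1 - exp (- (2 * K * \<tau>))) \<le> - ((2 + \<epsilon>) / 2 * D 0) * (2 / (2 + \<epsilon>))"
  proof -
    have wpos: "0 \<le> 1 - exp (- (2 * K * \<tau>))"
      using K \<tau> by simp
    have "z 0 / (2 * K) * (1 - exp (- (2 * K * \<tau>))) \<le> - ((2 + \<epsilon>) / 2 * D 0) * (1 - exp (- (2 * K * \<tau>)))"
      using z0 wpos by (intro mult_right_mono) auto
    also have "\<dots> \<le> - ((2 + \<epsilon>) / 2 * D 0) * (2 / (2 + \<epsilon>))"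
      using w D0 \<epsilon> by (intro mult_left_mono_neg) auto
    finally show ?thesis .
  qed
  also have "\<dots> = - D 0" using \<epsilon> by (simp add: field_simps)
  finally have "D \<tau> * exp (- (K * \<tau>)) \<le> 0" using W by linarith
  moreover have "0 < D \<tau> * exp (- (K * \<tau>))"
    using pq[of \<tau>] \<tau> by (intro mult_pos_pos) (auto simp: D_def)
  ultimately show False by linarith
qed

end

section \<open>Blow-up\<close>

text \<open>A bound that holds almost everywhere holds everywhere for a continuous function. That the essential supremum is
finite has to be checked, as \<^const>\<open>Linf_norm\<close> sends infinite values to \<open>0\<close>.\<close>

lemma abs_le_Linf_norm:
  assumes f: "continuous_on UNIV f" and B: "\<And>x. \<bar>f x\<bar> \<le> B"
  shows "\<bar>f x\<bar> \<le> Linf_norm f"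
proof -
  define E where "E = esssup lborel (\<lambda>x. ereal \<bar>f x\<bar>)"
  have [measurable]: "f \<in> borel_measurable borel"
    using f by (rule borel_measurable_continuous_onI)
  have ae: "AE x in lborel. ereal \<bar>f x\<bar> \<le> E"
    unfolding E_def by (rule esssup_AE)
  have "E \<le> ereal B"
    unfolding E_def using B by (intro esssup_I) auto
  moreover have "E \<noteq> - \<infinity>"
  proof
    assume "E = - \<infinity>"
    then have "AE x in (lborel :: real measure). (1 :: complex) = 0"
      by (intro eventually_mono[OF ae]) auto
    then show False
      using continuous_AE_0_imp_0[of "\<lambda>_. 1" 0] by simp
  qed
  ultimately obtain e where e: "E = ereal e"
    by (cases E) auto
  have "complex_of_real (max 0 (\<bar>f x\<bar> - e)) = 0"
  proof (rule continuous_AE_0_imp_0[where k = "\<lambda>x. complex_of_real (max 0 (\<bar>f x\<bar> - e))"])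
    show "continuous_on UNIV (\<lambda>x. complex_of_real (max 0 (\<bar>f x\<bar> - e)))"
      by (intro continuous_intros f)
    show "AE x in lborel. complex_of_real (max 0 (\<bar>f x\<bar> - e)) = 0"
      using ae by eventually_elim (simp add: e)
  qed
  then have "\<bar>f x\<bar> \<le> e"
    unfolding of_real_eq_0_iff by linarith
  then show ?thesis
    by (simp add: Linf_norm_def e flip: E_def)
qed

lemma sobolev_fun_tame:
  assumes "f \<in> sobolev_fun \<sigma>" "\<sigma> > 1 / 2"
  shows "tame f"
  using sobolev_fun_bounded[OF assms] by (intro tameI) auto

text \<open>Continuity of \<open>u\<close> in time with values in \<open>H\<^sup>s\<close> makes the slope locally bounded in time, and the
interval is compact.\<close>

lemma dp2_solution_slope_bound:
  assumes s: "s > 3 / 2" and sol: "dp2_solution c s u0 \<rho>0 T u \<rho>" and \<tau>: "ereal \<tau> < T"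
  shows "\<exists>L>0. \<forall>t\<in>{0..\<tau>}. \<forall>x. \<bar>deriv (u t) x\<bar> \<le> L"
proof (rule ccontr)
  assume no: "\<not> ?thesis"
  have sub: "{0..\<tau>} \<subseteq> time_interval T"
    using \<tau> by (auto simp: time_interval_def intro: le_less_trans[of _ "ereal \<tau>"])
  have "\<exists>t\<in>{0..\<tau>}. \<exists>x. real n + 1 < \<bar>deriv (u t) x\<bar>" for n
  proof (rule ccontr)
    assume "\<not> (\<exists>t\<in>{0..\<tau>}. \<exists>x. real n + 1 < \<bar>deriv (u t) x\<bar>)"
    then have "\<forall>t\<in>{0..\<tau>}. \<forall>x. \<bar>deriv (u t) x\<bar> \<le> real n + 1"
      by (auto simp: not_less)
    with no show False
      by (auto dest!: spec[of _ "real n + 1"])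
  qed
  then obtain t where t: "\<And>n. t n \<in> {0..\<tau>}" "\<And>n. \<exists>x. real n + 1 < \<bar>deriv (u (t n)) x\<bar>"
    by metis
  have "compact {0..\<tau>}" by simp
  then obtain l r where l: "l \<in> {0..\<tau>}" and r: "strict_mono (r :: nat \<Rightarrow> nat)" and lim: "(t \<circ> r) \<longlonglongrightarrow> l"
    using t(1) unfolding compact_def by metis
  have lI: "l \<in> time_interval T" using l sub by blast
  have ul: "u l \<in> sobolev_fun s"
    using sol lI unfolding dp2_solution_def by blast
  obtain e where e: "(e \<longlongrightarrow> 0) (at l within time_interval T)"
    and le: "\<And>r x. r \<in> time_interval T \<Longrightarrow> \<bar>deriv (u r) x - deriv (u l) x\<bar> \<le> e r"
    using dp2_solution_deriv_continuous_in_time[OF s sol lI] by blast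
  define B where "B = embedding_const (s - 1) * sobolev_norm s (distr_of (u l))"
  have B: "\<bar>deriv (u l) x\<bar> \<le> B" for x
    unfolding B_def by (rule sobolev_fun_C1(3)[OF ul s])
  from order_tendstoD(2)[OF e zero_less_one] obtain d where d: "0 < d"
    "\<And>r. r \<in> time_interval T \<Longrightarrow> r \<noteq> l \<Longrightarrow> dist r l < d \<Longrightarrow> e r < 1"
    unfolding eventually_at by auto
  have near: "\<bar>deriv (u r) x\<bar> \<le> B + 1" if "r \<in> time_interval T" "dist r l < d" for r x
  proof (cases "r = l")
    case True
    then show ?thesis using B[of x] by simp
  next
    case False
    then show ?thesis using B[of x] le[OF that(1), of x] d(2)[OF that(1) _ that(2)] by linarith
  qed
  obtain N where N: "\<And>n. n \<ge> N \<Longrightarrow> dist ((t \<circ> r) n) l < d"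
    using lim d(1) unfolding lim_sequentially by metis
  obtain m :: nat where m: "B \<le> real m" using real_arch_simple by blast
  let ?n = "max N m"
  obtain x where x: "real (r ?n) + 1 < \<bar>deriv (u (t (r ?n))) x\<bar>"
    using t(2) by blast
  have "\<bar>deriv (u (t (r ?n))) x\<bar> \<le> B + 1"
    by (rule near) (use t(1) sub N[of ?n] in auto)
  moreover have "real m \<le> real (r ?n)"
    using seq_suble[OF r, of ?n] by simp
  ultimately show False using x m by linarith
qed

lemma dp2_solution_strip:
  assumes s: "s > 3 / 2" and sol: "dp2_solution c s u0 \<rho>0 T u \<rho>" and \<tau>: "0 < \<tau>" "ereal \<tau> < T"
    and R: "0 \<le> R" "\<And>t. t \<in> {0..\<tau>} \<Longrightarrow> Linf_norm (\<rho> t) \<le> R" "\<And>t. t \<in> {0..\<tau>} \<Longrightarrow> L2_norm (\<rho> t) \<le> R"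
  shows "\<exists>L. dp2_strip c R L \<tau> u \<rho>"
proof -
  have sub: "{0..\<tau>} \<subseteq> time_interval T"
    using \<tau> by (auto simp: time_interval_def intro: le_less_trans[of _ "ereal \<tau>"])
  have mem: "u t \<in> sobolev_fun s" "\<rho> t \<in> sobolev_fun (s - 1)" if "t \<in> {0..\<tau>}" for t
    using sol that sub unfolding dp2_solution_def by blast+
  have s1: "s > 1 / 2" "s - 1 > 1 / 2" using s by auto
  obtain L where L: "0 < L" "\<And>t x. t \<in> {0..\<tau>} \<Longrightarrow> \<bar>deriv (u t) x\<bar> \<le> L"
    using dp2_solution_slope_bound[OF s sol \<tau>(2)] by blast
  have "dp2_strip c R L \<tau> u \<rho>"
  proof
    fix t assume t: "t \<in> {0..\<tau>}"
    show "tame (u t)" "tame (\<rho> t)"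
      using sobolev_fun_tame[OF mem(1)[OF t] s1(1)] sobolev_fun_tame[OF mem(2)[OF t] s1(2)] by auto
    note \<rho> = sobolev_fun_bounded[OF mem(2)[OF t] s1(2)]
    show "\<bar>\<rho> t x\<bar> \<le> R" for x
      using abs_le_Linf_norm[OF \<rho>(1,3), of x] R(2)[OF t] by linarith
    have "(L2_norm (\<rho> t))\<^sup>2 \<le> R\<^sup>2"
      by (intro power_mono R(3) t) (simp add: L2_norm_def)
    then show "(LINT x|lborel. (\<rho> t x)\<^sup>2) \<le> R\<^sup>2"
      by (simp add: L2_norm_def)
    have tI: "t \<in> time_interval T" using t sub by blast
    from dp2_solution_time_derivative[OF s sol tI] obtain e
      where e: "(e \<longlongrightarrow> 0) (at t within time_interval T)"
        and le: "\<And>r x. r \<in> time_interval T \<Longrightarrow> r \<noteq> t \<Longrightarrow>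
            \<bar>(u r x - u t x) / (r - t) - dp2_velocity c (u t) (\<rho> t) x\<bar> \<le> e r"
          "\<And>r. r \<in> time_interval T \<Longrightarrow> r \<noteq> t \<Longrightarrow>
            sqrt (LINT x|lborel. ((u r x - u t x) / (r - t) - dp2_velocity c (u t) (\<rho> t) x)\<^sup>2) \<le> e r"
      by blast
    show "\<exists>e. (e \<longlongrightarrow> 0) (at t within {0..\<tau>}) \<and>
      (\<forall>r\<in>{0..\<tau>}. r \<noteq> t \<longrightarrow>
        (\<forall>x. \<bar>(u r x - u t x) / (r - t) - dp2_velocity c (u t) (\<rho> t) x\<bar> \<le> e r) \<and>
        L2_norm (\<lambda>x. (u r x - u t x) / (r - t) - dp2_velocity c (u t) (\<rho> t) x) \<le> e r)"
    proof (intro exI conjI ballI impI allI)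
      show "(e \<longlongrightarrow> 0) (at t within {0..\<tau>})" by (rule tendsto_within_subset[OF e sub])
    qed (use le sub in \<open>auto simp: L2_norm_def\<close>)
  qed (use L \<tau> R sobolev_fun_C1[OF mem(1) s] in auto)
  then show ?thesis by blast
qed

lemma sobolev_norm_nonneg: "0 \<le> sobolev_norm \<sigma> \<Lambda>"
  unfolding sobolev_norm_def
  by (intro real_sqrt_ge_zero Bochner_Integration.integral_nonneg) auto

theorem theorem5p1:
  fixes c s M \<epsilon> x0 :: real
    and u0 \<rho>0 :: "real \<Rightarrow> real"
    and u \<rho> :: "real \<Rightarrow> real \<Rightarrow> real"
    and T :: ereal
  assumes "s > 3 / 2"
    and "u0 \<in> sobolev_fun s"
    and "\<rho>0 \<in> sobolev_fun (s - 1)"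
    and "dp2_maximal_solution c s u0 \<rho>0 T u \<rho>"
    and "M > 0"
    and "\<And>t. t \<in> time_interval T \<Longrightarrow>
           Linf_norm (\<rho> t) \<le> exp (2 * M * t) * sobolev_norm (s - 1) (distr_of \<rho>0)"
    and "\<And>t. t \<in> time_interval T \<Longrightarrow>
           L2_norm (\<rho> t) \<le> exp (2 * M * t) * sobolev_norm (s - 1) (distr_of \<rho>0)"
    and "\<epsilon> > 0"
    and "deriv u0 x0 < - (1 + \<epsilon>) * K_bound c s M u0 \<rho>0 (T_star c s \<rho>0 \<epsilon>)"
  shows "0 < T_star c s \<rho>0 \<epsilon> \<and>
         0 < K_bound c s M u0 \<rho>0 (T_star c s \<rho>0 \<epsilon>) \<and>
         T < ereal (T_star c s \<rho>0 \<epsilon>) \<and> T < \<infinity>"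
proof -
  define N where "N = sobolev_norm (s - 1) (distr_of \<rho>0)"
  define Ts where "Ts = T_star c s \<rho>0 \<epsilon>"
  define K where "K = K_bound c s M u0 \<rho>0 Ts"
  define J where "J = J_bound c s M u0 \<rho>0 Ts"
  define e where "e = exp (2 * M * Ts)"
  define R where "R = e * N"
  have N0: "0 \<le> N" unfolding N_def by (rule sobolev_norm_nonneg)
  have l0: "0 < ln (1 + 2 / \<epsilon>)" using assms(8) by (intro ln_gt_zero) simp
  have Ts_eq: "Ts = ln (1 + 2 / \<epsilon>) / (sqrt (\<bar>c\<bar> + 1) * (N + 1))"
    unfolding Ts_def T_star_def N_def ..
  have Ts0: "0 < Ts"
    unfolding Ts_eq using l0 N0 by (intro divide_pos_pos mult_pos_pos) auto
  have e1: "1 \<le> e" unfolding e_def using assms(5) Ts0 by simp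
  have R0: "0 \<le> R" unfolding R_def using e1 N0 by simp
  have P: "(\<bar>c\<bar> + 1) * (N + 1)\<^sup>2 \<le> (\<bar>c\<bar> + 1) * (e * (N + 1))\<^sup>2" "0 < (\<bar>c\<bar> + 1) * (N + 1)\<^sup>2"
  proof -
    have "N + 1 \<le> e * (N + 1)"
      using mult_right_mono[OF e1, of "N + 1"] N0 by simp
    then show "(\<bar>c\<bar> + 1) * (N + 1)\<^sup>2 \<le> (\<bar>c\<bar> + 1) * (e * (N + 1))\<^sup>2"
      using N0 by (intro mult_left_mono power_mono) auto
    show "0 < (\<bar>c\<bar> + 1) * (N + 1)\<^sup>2"
      using N0 by (intro mult_pos_pos zero_less_power) auto
  qed
  have K_eq: "K = sqrt (3 * (\<bar>c\<bar> + 1) / 4 * (e * (N + 1))\<^sup>2 + 3 / 2 * J\<^sup>2)"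
    unfolding K_def K_bound_def J_def e_def N_def ..
  have K2: "K\<^sup>2 = 3 / 4 * ((\<bar>c\<bar> + 1) * (e * (N + 1))\<^sup>2) + 3 / 2 * J\<^sup>2"
    unfolding K_eq by simp
  have K0: "0 < K"
  proof -
    have "3 * (\<bar>c\<bar> + 1) / 4 * (e * (N + 1))\<^sup>2 = 3 / 4 * ((\<bar>c\<bar> + 1) * (e * (N + 1))\<^sup>2)" by simp
    then show ?thesis
      unfolding K_eq using P zero_le_power2[of J] by (intro real_sqrt_gt_zero) linarith
  qed
  \<comment> \<open>Since \<open>(2 K)\<^sup>2\<close> is at least three times the square of the left-hand side, the collision time is
    strictly smaller than \<open>T\<^sup>\<star>\<close>, which also excludes the borderline case \<open>T = T\<^sup>\<star>\<close>.\<close>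
  have fast: "sqrt (\<bar>c\<bar> + 1) * (N + 1) < 2 * K"
  proof (rule power2_less_imp_less)
    have "(sqrt (\<bar>c\<bar> + 1) * (N + 1))\<^sup>2 = (\<bar>c\<bar> + 1) * (N + 1)\<^sup>2"
      by (simp add: power_mult_distrib)
    moreover have "(2 * K)\<^sup>2 = 3 * ((\<bar>c\<bar> + 1) * (e * (N + 1))\<^sup>2) + 6 * J\<^sup>2"
      unfolding power_mult_distrib K2 by simp
    ultimately show "(sqrt (\<bar>c\<bar> + 1) * (N + 1))\<^sup>2 < (2 * K)\<^sup>2"
      using P zero_le_power2[of J] by linarith
  qed (use K0 in simp)
  have "T < ereal Ts"
  proof (rule ccontr)
    assume "\<not> T < ereal Ts"
    define \<tau> where "\<tau> = ln (1 + 2 / \<epsilon>) / (2 * K)"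
    have \<tau>0: "0 < \<tau>" unfolding \<tau>_def using l0 K0 by simp
    have \<tau>Ts: "\<tau> < Ts"
      unfolding \<tau>_def Ts_eq using fast l0 K0 N0
      by (intro divide_strict_left_mono mult_pos_pos) auto
    have \<tau>T: "ereal \<tau> < T"
      using \<tau>Ts \<open>\<not> T < ereal Ts\<close> by (meson less_ereal.simps(1) less_le_trans not_less)
    have sub: "{0..\<tau>} \<subseteq> time_interval T"
      using \<tau>T by (auto simp: time_interval_def intro: le_less_trans[of _ "ereal \<tau>"])
    have sol: "dp2_solution c s u0 \<rho>0 T u \<rho>"
      using assms(4) unfolding dp2_maximal_solution_def by blast
    have u_0: "u 0 = u0" using sol unfolding dp2_solution_def by blast
    have ex: "exp (2 * M * t) * N \<le> R" if "t \<in> {0..\<tau>}" for t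
      unfolding R_def e_def using that \<tau>Ts assms(5) N0 by (intro mult_right_mono) auto
    obtain L where "dp2_strip c R L \<tau> u \<rho>"
      using dp2_solution_strip[OF assms(1) sol \<tau>0 \<tau>T R0] ex assms(6,7) sub
      unfolding N_def[symmetric] by (meson order_trans subsetD)
    then interpret dp2_strip c R L \<tau> u \<rho> .
    define l where "l = L2_norm u0"
    define X where "X = exp (2 * \<bar>c\<bar> * Ts)"
    define Y where "Y = X * (4 * l\<^sup>2 + \<bar>c\<bar> * Ts * R ^ 4 / 4)"
    have X1: "1 \<le> X" unfolding X_def using Ts0 by simp
    have Y: "(L2_norm (u t))\<^sup>2 \<le> Y" if "t \<in> {0..\<tau>}" for t
      using u_L2_bound[OF that less_imp_le[OF \<tau>Ts]] unfolding u_0 Y_def X_def l_def .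
    note u0 = sobolev_fun_bounded[OF assms(2)]
    have S: "\<bar>u 0 y\<bar> \<le> Linf_norm u0" for y
      unfolding u_0 by (rule abs_le_Linf_norm[OF u0(1,3)]) (use assms(1) in auto)
    have J_eq: "J = Linf_norm u0 + Ts * (3 / 2 * X * (2 * l\<^sup>2 + \<bar>c\<bar> * Ts * (1 + 8 * M * Ts) * R ^ 4 + \<bar>c\<bar> / 4 * R\<^sup>2))"
      unfolding J_def J_bound_def X_def l_def R_def e_def N_def by (simp add: mult_ac)
    \<comment> \<open>The energy estimate is better than what \<open>J\<close> asks for: the factor \<open>3/16\<close> of \<open>X A\<close> is below \<open>3/2\<close>, and
      the term with \<open>8 M T\<^sup>\<star>\<close> is nonnegative.\<close>
    have rate: "3 / 4 * Y + \<bar>c\<bar> / 4 * R\<^sup>2 \<le> 3 / 2 * X * (2 * l\<^sup>2 + \<bar>c\<bar> * Ts * (1 + 8 * M * Ts) * R ^ 4 + \<bar>c\<bar> / 4 * R\<^sup>2)"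
    proof -
      define A where "A = \<bar>c\<bar> * Ts * R ^ 4"
      define A' where "A' = 8 * M * Ts * A"
      define C where "C = \<bar>c\<bar> / 4 * R\<^sup>2"
      have A0: "0 \<le> A" "0 \<le> A'" "0 \<le> C"
        unfolding A_def A'_def C_def using Ts0 assms(5) R0 by simp_all
      have XA: "0 \<le> X * A" "0 \<le> X * A'" "C \<le> X * C"
        using A0 X1 mult_right_mono[OF X1 A0(3)] by simp_all
      have "3 / 4 * Y + C = 3 * (X * l\<^sup>2) + 3 / 16 * (X * A) + C"
        by (simp add: Y_def A_def algebra_simps)
      also have "\<dots> \<le> 3 * (X * l\<^sup>2) + 3 / 2 * (X * A) + 3 / 2 * (X * A') + 3 / 2 * (X * C)"
        using XA A0 by linarith
      also have "\<dots> = 3 / 2 * X * (2 * l\<^sup>2 + \<bar>c\<bar> * Ts * (1 + 8 * M * Ts) * R ^ 4 + C)"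
        by (simp add: A_def A'_def algebra_simps)
      finally show ?thesis unfolding C_def .
    qed
    have rate0: "0 \<le> 3 / 4 * Y + \<bar>c\<bar> / 4 * R\<^sup>2"
      unfolding Y_def using X1 Ts0 R0 by simp
    have B: "\<bar>u t x\<bar> \<le> J" if t: "t \<in> {0..\<tau>}" for t x
    proof -
      have "\<bar>u t x\<bar> \<le> Linf_norm u0 + t * (3 / 4 * Y + \<bar>c\<bar> / 4 * R\<^sup>2)"
        by (rule u_sup_bound[OF t Y S])
      also have "\<dots> \<le> J"
        unfolding J_eq using t \<tau>Ts rate rate0 by (intro add_left_mono mult_mono) auto
      finally show ?thesis .
    qed
    have KB: "3 / 2 * J\<^sup>2 + \<bar>c\<bar> / 2 * R\<^sup>2 \<le> K\<^sup>2"
    proof -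
      have "R\<^sup>2 \<le> (e * (N + 1))\<^sup>2"
        unfolding R_def using e1 N0 by (intro power_mono mult_left_mono) auto
      then have "\<bar>c\<bar> / 2 * R\<^sup>2 \<le> 3 / 4 * (\<bar>c\<bar> + 1) * (e * (N + 1))\<^sup>2"
        by (intro mult_mono) auto
      then have "\<bar>c\<bar> / 2 * R\<^sup>2 \<le> 3 / 4 * ((\<bar>c\<bar> + 1) * (e * (N + 1))\<^sup>2)"
        by (simp only: mult.assoc)
      then show ?thesis unfolding K2 by linarith
    qed
    have slope: "deriv (u 0) x0 < - (1 + \<epsilon>) * K"
      using assms(9) unfolding u_0 K_def Ts_def .
    have "exp (- (2 * K * \<tau>)) = inverse (1 + 2 / \<epsilon>)"
      unfolding \<tau>_def using K0 assms(8) by (simp add: exp_minus add_pos_pos)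
    also have "\<dots> = \<epsilon> / (2 + \<epsilon>)"
      using assms(8) by (simp add: field_simps)
    finally show False
      using no_steep_slope[OF K0 B KB assms(8) slope] by simp
  qed
  moreover from this have "T < \<infinity>"
    using less_trans[of T "ereal Ts" \<infinity>] by simp
  ultimately show ?thesis
    using Ts0 K0 unfolding Ts_def K_def by simp
qed

end
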